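(* Let $1\le k\le n$ be integers and let $B_1$ be the unit ball in $\mathbb{C}^n$. For a real parameter $a$ consider the Dirichlet problem $$S_k(u_{l\bar m})=a\,\frac{e^{-u}}{\int_{B_1}e^{-u}\,dV}\ \text{ on } B_1,\qquad u=0\ \text{ on }\partial B_1. \qquad ( * )$$ Then there exists $\alpha(k,n)>0$ such that there exists no solution $u\in C^2(\bar B_1)\cap C^4(B_1)$ of $( * )$ when $a>\alpha(k,n)$. Moreover, when $k=n$ (so that $( * )$ reads $\det(u_{l\bar m})=a\,e^{-u}/\int_{B_1}e^{-u}dV$ on $B_1$, $u=0$ on $\partial B_1$), one can take $\alpha(n,n)=a_0:=(n+1)^n\frac{\pi^n}{n!}$, and $( * )$ has no solution in $C^2(\bar B_1)\cap C^4(B_1)$ if $a\ge a_0$. In other words, for $k=n$ the constant $a_0$ in the range $0<a<a_0$, for which radially symmetric solutions of $( * )$ exist, is sharp and cannot be attained, at least for solutions with enough regularity (namely in $C^2(\bar B_1)\cap C^4(B_1)$).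
   Context: For a real-valued $C^2$ function $u$ on a domain of $\mathbb{C}^n$, $u_{l\bar m}=\frac{\partial^2u}{\partial z^l\partial\bar z^m}$, and $S_k(u_{l\bar m})$ is the $k$-th elementary symmetric function of the eigenvalues of the Hermitian matrix $(u_{l\bar m})$; thus $S_n(u_{l\bar m})=\det(u_{l\bar m})$. $dV$ is Lebesgue measure on $\mathbb{C}^n=\mathbb{R}^{2n}$. For $k=n$ and $0<a<a_0$, radially symmetric solutions are given by $u_\epsilon=(n+1)[\log(|z|^2+\epsilon^2)-\log(1+\epsilon^2)]$, $\epsilon>0$, with $a=a_\epsilon=(n+1)^n\frac{\pi^n}{n!\,(1+\epsilon^2)^n}$.
   Formalization: For even k, solutions u are additionally required to satisfy S_j(u_{l m̄}) ≥ 0 for 1 ≤ j ≤ k; without this nonexistence fails, e.g. n=k=2, u=3[log(R²−|z|²)−log(R²−1)], R→1. *)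

theory Defs
  imports "HOL-Analysis.Analysis" "HOL-Computational_Algebra.Computational_Algebra"
begin

text \<open>Meant for an open set \<open>S\<close>. Iterated directional derivatives in all directions stand for
  the partial derivatives.\<close>

primrec Ck_on :: "nat \<Rightarrow> 'a::euclidean_space set \<Rightarrow> ('a \<Rightarrow> real) \<Rightarrow> bool" where
  "Ck_on 0 = (\<lambda>S f. continuous_on S f)"
| "Ck_on (Suc k) = (\<lambda>S f. (\<forall>x\<in>S. f differentiable (at x)) \<and>
     (\<forall>v. Ck_on k S (\<lambda>x. frechet_derivative f (at x) v)))"

text \<open>\<open>C\<^sup>k\<close> up to the boundary of the open set \<open>S\<close>: \<open>f\<close> is continuous on \<open>closure S\<close>, is \<open>C\<^sup>k\<close> in \<open>S\<close>,
  and every derivative of order at most \<open>k\<close> extends continuously from \<open>S\<close> to \<open>closure S\<close> (the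
  function \<open>g\<close> below is such an extension). Derivatives are only ever taken at points of \<open>S\<close>.\<close>

primrec Ck_closure :: "nat \<Rightarrow> 'a::euclidean_space set \<Rightarrow> ('a \<Rightarrow> real) \<Rightarrow> bool" where
  "Ck_closure 0 = (\<lambda>S f. continuous_on (closure S) f)"
| "Ck_closure (Suc k) = (\<lambda>S f. continuous_on (closure S) f \<and>
     (\<forall>x\<in>S. f differentiable (at x)) \<and>
     (\<forall>v. \<exists>g. Ck_closure k S g \<and> (\<forall>x\<in>S. g x = frechet_derivative f (at x) v)))"

text \<open>The Wirtinger derivatives \<open>\<partial>/\<partial>z\<^sup>l = (\<partial>/\<partial>x\<^sup>l - \<i> \<partial>/\<partial>y\<^sup>l) / 2\<close> and its conjugate.\<close>

definition dz :: "'n::finite \<Rightarrow> (complex^'n \<Rightarrow> complex) \<Rightarrow> complex^'n \<Rightarrow> complex" where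
  "dz l f z = (frechet_derivative f (at z) (axis l 1)
               - \<i> * frechet_derivative f (at z) (axis l \<i>)) / 2"

definition dzbar :: "'n::finite \<Rightarrow> (complex^'n \<Rightarrow> complex) \<Rightarrow> complex^'n \<Rightarrow> complex" where
  "dzbar l f z = (frechet_derivative f (at z) (axis l 1)
                  + \<i> * frechet_derivative f (at z) (axis l \<i>)) / 2"

definition complex_hessian :: "(complex^'n::finite \<Rightarrow> real) \<Rightarrow> complex^'n \<Rightarrow> complex^'n^'n" where
  "complex_hessian u z = (\<chi> l m. dz l (dzbar m (\<lambda>w. complex_of_real (u w))) z)"

definition charpoly :: "complex^'n^'n::finite \<Rightarrow> complex poly" where
  "charpoly A = det (\<chi> i j. (if i = j then [:0, 1:] else 0) - [:A $ i $ j:])"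

text \<open>An enumeration of the (real) eigenvalues of a Hermitian matrix, repeated according to their
  multiplicity. Their order is unspecified, and the value is unspecified if \<open>A\<close> is not Hermitian.\<close>

definition eigvals :: "complex^'n^'n::finite \<Rightarrow> 'n \<Rightarrow> real" where
  "eigvals A = (SOME ev. charpoly A = (\<Prod>i\<in>UNIV. [:- complex_of_real (ev i), 1:]))"

definition elem_sym :: "nat \<Rightarrow> ('n::finite \<Rightarrow> real) \<Rightarrow> real" where
  "elem_sym k x = (\<Sum>I | I \<subseteq> UNIV \<and> card I = k. \<Prod>i\<in>I. x i)"

definition Sk :: "nat \<Rightarrow> complex^'n^'n::finite \<Rightarrow> real" where
  "Sk k A = elem_sym k (eigvals A)"

definition dirichlet_solution :: "nat \<Rightarrow> real \<Rightarrow> (complex^'n::finite \<Rightarrow> real) \<Rightarrow> bool" where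
  "dirichlet_solution k a u \<longleftrightarrow>
     Ck_closure 2 (ball 0 1) u \<and> Ck_on 4 (ball 0 1) u \<and>
     (\<forall>z\<in>ball 0 1. Sk k (complex_hessian u z) = a * (exp (- u z) / (LINT w:ball 0 1|lborel. exp (- u w)))) \<and>
     (\<forall>z\<in>sphere 0 1. u z = 0)"

text \<open>The admissibility condition for the \<open>k\<close>-th complex Hessian operator (plurisubharmonicity if
  \<open>k = n\<close>). If \<open>k\<close> is odd, every solution with \<open>a > 0\<close> satisfies it automatically. If \<open>k\<close> is even it
  does not follow, as \<open>Sk k\<close> is invariant under \<open>u \<mapsto> - u\<close>, and it cannot be dropped: for
  \<open>n = k = 2\<close> and \<open>R > 1\<close> the function \<open>3 (ln (R\<^sup>2 - |z|\<^sup>2) - ln (R\<^sup>2 - 1))\<close>, the negative of a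
  plurisubharmonic function, solves the Dirichlet problem with \<open>a = (9 \<pi>\<^sup>2 / 2) / (R\<^sup>2 - 1)\<^sup>2\<close>, which
  is unbounded as \<open>R\<close> tends to 1.\<close>

definition k_subharmonic :: "nat \<Rightarrow> (complex^'n::finite \<Rightarrow> real) \<Rightarrow> bool" where
  "k_subharmonic k u \<longleftrightarrow> (\<forall>z\<in>ball 0 1. \<forall>j\<in>{1..k}. Sk j (complex_hessian u z) \<ge> 0)"

definition a_crit :: "nat \<Rightarrow> real" where
  "a_crit n = (real n + 1) ^ n * (pi ^ n / fact n)"

definition a_eps :: "nat \<Rightarrow> real \<Rightarrow> real" where
  "a_eps n \<epsilon> = (real n + 1) ^ n * (pi ^ n / (fact n * (1 + \<epsilon>\<^sup>2) ^ n))"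

definition u_eps :: "real \<Rightarrow> complex^'n::finite \<Rightarrow> real" where
  "u_eps \<epsilon> z = (real CARD('n) + 1) * (ln ((norm z)\<^sup>2 + \<epsilon>\<^sup>2) - ln (1 + \<epsilon>\<^sup>2))"

end

theory Submission
  imports Defs
begin

text \<open>The nonexistence part is a Pohozaev argument. Put \<open>\<lambda> = a / \<integral> e\<^sup>-\<^sup>u\<close> and \<open>T = \<partial>S\<^sub>k/\<partial>u\<^sub>l\<^sub>m\<close>, which is divergence
  free. By the maximum principle \<open>u \<le> 0\<close>. On the sphere \<open>u = 0\<close>, hence \<open>u\<^sub>l\<close> is \<open>h\<close> times the conjugate of \<open>z\<^sub>l\<close> for
  some \<open>h \<ge> 0\<close>, and the Hessian is \<open>h\<close> times the identity modulo terms that \<open>T\<close> does not see in the normal direction.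
  So \<open>S\<^sub>k\<close> and, up to a term of the right sign, \<open>S\<^sub>k\<close> times the radial derivative of \<open>u\<close> are divergences whose fluxes through the sphere are multiples of
  \<open>h\<^sup>k\<close> and \<open>h\<^sup>k\<^sup>+\<^sup>1\<close>. Instead of Hoelder's inequality for their integrals, the linear inequality
  \<open>k h\<^sup>k\<^sup>+\<^sup>1 - (k + 1) c h\<^sup>k + c\<^sup>k\<^sup>+\<^sup>1 \<ge> 0\<close> with \<open>c = n + 1\<close> is used, so that everything fits into one vector field with
  nonnegative flux, and no surface integral is needed: integrating the divergence against radial cutoff functions shows that its
  integral over the ball is nonnegative. This reads \<open>a < const\<close>, and for \<open>k = n\<close> the constant is \<open>a\<^sub>0\<close>. The integral of
  \<open>e\<^sup>-\<^sup>u\<close> for the radial solutions follows from the divergence of a field that vanishes on the sphere.\<close>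

text \<open>The value c = n + 1 is the limit, as the parameter tends to 0, of h = (n + 1) / (1 +
  \<open>\<epsilon>\<close>^2) for the radial solutions; this is why for k = n the linear inequality
  loses nothing in the limit. The resulting inequality for a is nevertheless strict, because n (k +
  1) lambda times the volume of the ball is left over. The Pohozaev identity can be evaluated
  because S_k = lambda e^-u turns S_k times the radial derivative of u into a derivative of e^-u.
  One obstacle is regularity at the sphere: u is C^2 up to the sphere, so the field is continuous on
  the closed ball, but its derivatives exist only inside and need not extend. Integration against
  cutoffs tolerates this as long as the divergence is integrable, which holds since the
  cancellations and the equation leave no derivative of u in it. The other obstacle is that the
  eigenvalues come from a choice without any regularity; hence S_k and T enter as coefficients of
  det (A + t I) and of its cofactors, polynomial in the entries.\<close>

unbundle no Formal_Power_Series.fps_syntax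

section \<open>Cofactors\<close>

text \<open>A unit vector in row \<open>l\<close> produces the signed cofactor, the partial
  derivative of the determinant in the entry (l, m), and keeps the index type, which deleting a row
  and a column would change.\<close>

definition cof :: "'a::comm_ring_1^'n^'n \<Rightarrow> 'n \<Rightarrow> 'n \<Rightarrow> 'a" where
  "cof M l m = det (\<chi> i. if i = l then axis m 1 else M $ i)"

lemma det_row_expand:
  fixes M :: "'a::comm_ring_1^'n^'n"
  shows "det (\<chi> i. if i = l then v else M $ i) = (\<Sum>m\<in>UNIV. v $ m * cof M l m)"
proof -
  have "det (\<chi> i. if i = l then v else M $ i)
      = det (\<chi> i. if i = l then (\<Sum>m\<in>UNIV. v $ m *s axis m 1) else M $ i)"
    by (simp only: basis_expansion)
  also have "\<dots> = (\<Sum>m\<in>UNIV. v $ m * cof M l m)"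
    unfolding det_linear_row_sum[OF finite_class.finite_UNIV] cof_def det_row_mul ..
  finally show ?thesis .
qed

lemma cof_mult_row:
  fixes M :: "'a::comm_ring_1^'n^'n"
  shows "(\<Sum>m\<in>UNIV. M $ p $ m * cof M l m) = (if p = l then det M else 0)"
proof -
  have "(\<Sum>m\<in>UNIV. M $ p $ m * cof M l m) = det (\<chi> i. if i = l then M $ p else M $ i)"
    by (rule det_row_expand[symmetric])
  also have "\<dots> = (if p = l then det M else 0)"
  proof (cases "p = l")
    case True
    then have "(\<chi> i. if i = l then M $ p else M $ i) = M" by (simp add: vec_eq_iff)
    then show ?thesis using True by simp
  next
    case False
    then have "det (\<chi> i. if i = l then M $ p else M $ i) = 0"
      by (intro det_identical_rows[of p l]) (simp_all add: row_def)
    then show ?thesis using False by simp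
  qed
  finally show ?thesis .
qed

lemma cof_transpose:
  fixes M :: "'a::comm_ring_1^'n^'n"
  shows "cof (transpose M) m l = cof M l m"
proof -
  have "cof (transpose M) m l = det (transpose (\<chi> i. if i = m then axis l 1 else transpose M $ i))"
    by (simp add: cof_def)
  also have "\<dots> = cof M l m"
    unfolding cof_def det_def
  proof (rule sum.cong[OF refl])
    fix p :: "'n \<Rightarrow> 'n" assume "p \<in> {p. p permutes UNIV}"
    then have p: "p permutes UNIV" by simp
    \<comment> \<open>Both products vanish unless \<open>p l = m\<close>. For such \<open>p\<close>
      the replaced row contributes the factor 1 on either side, at i = l, and all other factors
      coincide.\<close>
    have "(\<Prod>i\<in>UNIV. transpose (\<chi> i. if i = m then axis l 1 else transpose M $ i) $ i $ p i)
        = (\<Prod>i\<in>UNIV. (\<chi> i. if i = l then axis m 1 else M $ i) $ i $ p i)"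
    proof (cases "p l = m")
      case True
      then have "p i = m \<longleftrightarrow> i = l" for i
        using p by (metis permutes_def)
      then show ?thesis
        by (intro prod.cong) (auto simp: transpose_def axis_def)
    next
      case False
      obtain i where i: "p i = m" using p by (metis permutes_def)
      have "(\<Prod>i\<in>UNIV. transpose (\<chi> i. if i = m then axis l 1 else transpose M $ i) $ i $ p i) = 0"
        by (rule prod_zero[OF _ bexI[of _ i]]) (use i False in \<open>auto simp: transpose_def axis_def\<close>)
      moreover have "(\<Prod>i\<in>UNIV. (\<chi> i. if i = l then axis m 1 else M $ i) $ i $ p i) = 0"
        by (rule prod_zero[OF _ bexI[of _ l]]) (use False in \<open>auto simp: axis_def\<close>)
      ultimately show ?thesis by simp
    qed
    then show "of_int (sign p) * (\<Prod>i\<in>UNIV. transpose (\<chi> i. if i = m then axis l 1 else transpose M $ i) $ i $ p i)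
        = of_int (sign p) * (\<Prod>i\<in>UNIV. (\<chi> i. if i = l then axis m 1 else M $ i) $ i $ p i)"
      by simp
  qed
  finally show ?thesis .
qed

text \<open>The rows are changed one at a time; row \<open>l\<close> remains \<open>v\<close>
  throughout, so each change is an elementary row operation.\<close>

lemma det_subtract_row:
  fixes A :: "'n::finite \<Rightarrow> 'a::comm_ring_1^'n"
  shows "det (\<chi> i. if i = l then v else A i + a i *s v) = det (\<chi> i. if i = l then v else A i)"
proof -
  have "det (\<chi> i. if i = l then v else if i \<in> S then A i + a i *s v else A i)
      = det (\<chi> i. if i = l then v else A i)" if "finite S" for S
    using that
  proof (induction S)
    case (insert s S)
    show ?case
    proof (cases "s = l")
      case True
      then have "(\<chi> i. if i = l then v else if i \<in> insert s S then A i + a i *s v else A i)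
          = (\<chi> i. if i = l then v else if i \<in> S then A i + a i *s v else A i)"
        by (simp add: vec_eq_iff)
      then show ?thesis using insert.IH by simp
    next
      case False
      let ?B = "\<chi> i. if i = l then v else if i \<in> S then A i + a i *s v else A i"
      have "(\<chi> i. if i = l then v else if i \<in> insert s S then A i + a i *s v else A i)
          = (\<chi> k. if k = s then row s ?B + a s *s row l ?B else row k ?B)"
        using False insert.hyps by (simp add: vec_eq_iff row_def)
      then show ?thesis using det_row_operation[OF False, of ?B "a s"] insert.IH by simp
    qed
  qed (simp cong: if_cong)
  from this[of UNIV] show ?thesis by (simp cong: if_cong)
qed

lemma cof_scalar:
  fixes c :: "'a::field"
  shows "cof (\<chi> i j. if i = j then c else 0) l (m::'n::finite)
      = (if l = m then c ^ (CARD('n) - 1) else 0)"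
proof (cases "l = m")
  case True
  have "cof (\<chi> i j. if i = j then c else 0) l m
      = (\<Prod>i\<in>UNIV. (\<chi> i. if i = l then axis m 1 else (\<chi> i j. if i = j then c else 0) $ i) $ i $ i)"
    unfolding cof_def by (rule det_diagonal) (use True in \<open>auto simp: axis_def\<close>)
  also have "\<dots> = (\<Prod>i\<in>UNIV. if i = l then 1 else c)"
    by (rule prod.cong) (use True in \<open>auto simp: axis_def\<close>)
  also have "\<dots> = (\<Prod>i\<in>UNIV-{l}. c)"
    by (rule prod.mono_neutral_cong_right) auto
  also have "\<dots> = c ^ (CARD('n) - 1)" by (simp add: card_Diff_singleton)
  finally show ?thesis using True by simp
next
  case False
  have "cof (\<chi> i j. if i = j then c else 0) l m = 0"
    unfolding cof_def
    by (rule det_zero_column(2)[of l]) (use False in \<open>auto simp: column_def vec_eq_iff axis_def\<close>)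
  then show ?thesis using False by simp
qed

text \<open>Contracting the cofactors of row \<open>l\<close> with \<open>z\<close> puts
  \<open>z\<close> into row \<open>l\<close>, and multiples of that row in the other rows do not
  affect the determinant.\<close>

lemma cof_scalar_plus_rank_one:
  fixes c :: "'a::field" and z b :: "'n::finite \<Rightarrow> 'a"
  assumes "\<And>i j. M $ i $ j = N $ i $ j + b i * z j"
  shows "(\<Sum>m\<in>UNIV. z m * cof M l m) = (\<Sum>m\<in>UNIV. z m * cof N l m)"
proof -
  have M: "M $ i = N $ i + b i *s (\<chi> j. z j)" for i
    by (simp add: vec_eq_iff assms)
  have "(\<Sum>m\<in>UNIV. z m * cof M l m) = det (\<chi> i. if i = l then (\<chi> j. z j) else M $ i)"
    by (simp add: det_row_expand)
  also have "\<dots> = det (\<chi> i. if i = l then (\<chi> j. z j) else N $ i)"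
    unfolding M by (rule det_subtract_row)
  also have "\<dots> = (\<Sum>m\<in>UNIV. z m * cof N l m)" by (simp add: det_row_expand)
  finally show ?thesis .
qed

text \<open>This is the shape of the complex Hessian on the sphere. The term along \<open>z\<close>
  is removed through the rows, the one along \<open>w\<close> after transposing, and the cofactors
  of a scalar matrix remain.\<close>

lemma cof_scalar_plus_rank_two:
  fixes c :: "'a::field" and w z a b :: "'n::finite \<Rightarrow> 'a"
  assumes M: "\<And>i j. M $ i $ j = (if i = j then c else 0) + a i * z j + w i * b j"
  shows "(\<Sum>l\<in>UNIV. \<Sum>m\<in>UNIV. w l * (z m * cof M l m))
       = c ^ (CARD('n) - 1) * (\<Sum>l\<in>UNIV. w l * z l)"
proof -
  define D :: "'a^'n^'n" where "D = (\<chi> i j. if i = j then c else 0)"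
  define N where "N = (\<chi> i j. (if i = j then c else 0) + w i * b j)"
  have "(\<Sum>l\<in>UNIV. \<Sum>m\<in>UNIV. w l * (z m * cof M l m)) = (\<Sum>l\<in>UNIV. w l * (\<Sum>m\<in>UNIV. z m * cof M l m))"
    by (simp add: sum_distrib_left)
  also have "\<dots> = (\<Sum>l\<in>UNIV. w l * (\<Sum>m\<in>UNIV. z m * cof N l m))"
    by (subst cof_scalar_plus_rank_one[of M N a z]) (auto simp: M N_def algebra_simps)
  also have "\<dots> = (\<Sum>l\<in>UNIV. \<Sum>m\<in>UNIV. z m * (w l * cof (transpose N) m l))"
    by (simp add: sum_distrib_left cof_transpose mult_ac)
  also have "\<dots> = (\<Sum>m\<in>UNIV. z m * (\<Sum>l\<in>UNIV. w l * cof (transpose N) m l))"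
    by (subst sum.swap) (simp add: sum_distrib_left)
  also have "\<dots> = (\<Sum>m\<in>UNIV. z m * (\<Sum>l\<in>UNIV. w l * cof D m l))"
    by (subst cof_scalar_plus_rank_one[of _ D b w]) (auto simp: D_def N_def transpose_def algebra_simps)
  also have "\<dots> = c ^ (CARD('n) - 1) * (\<Sum>l\<in>UNIV. w l * z l)"
    by (simp add: D_def cof_scalar sum_distrib_left if_distrib[of "\<lambda>x. _ * x"] mult_ac sum.delta' cong: if_cong)
  finally show ?thesis .
qed

text \<open>Jacobi's formula. The Leibniz summands in which the factor of row \<open>i\<close> is
  differentiated form the determinant with row \<open>i\<close> replaced by its derivative, which is
  then expanded along that row.\<close>

lemma has_derivative_det:
  fixes M :: "'b::real_normed_vector \<Rightarrow> 'a::real_normed_field^'n^'n"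
  assumes "\<And>i j. ((\<lambda>x. M x $ i $ j) has_derivative M' i j) (at x)"
  shows "((\<lambda>x. det (M x)) has_derivative (\<lambda>v. \<Sum>i\<in>UNIV. \<Sum>j\<in>UNIV. M' i j v * cof (M x) i j)) (at x)"
proof -
  have "((\<lambda>x. det (M x)) has_derivative (\<lambda>v. \<Sum>p | p permutes (UNIV::'n set). of_int (sign p) *
      (\<Sum>i\<in>UNIV. M' i (p i) v * (\<Prod>j\<in>UNIV - {i}. M x $ j $ p j)))) (at x)"
    unfolding det_def
    by (rule has_derivative_sum, rule has_derivative_mult_right, rule has_derivative_prod, rule assms)
  moreover have "(\<Sum>p | p permutes (UNIV::'n set). of_int (sign p) *
      (\<Sum>i\<in>UNIV. M' i (p i) v * (\<Prod>j\<in>UNIV - {i}. M x $ j $ p j)))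
      = (\<Sum>i\<in>UNIV. \<Sum>j\<in>UNIV. M' i j v * cof (M x) i j)" for v
  proof -
    have *: "(\<Sum>j\<in>UNIV. M' i j v * cof (M x) i j)
        = (\<Sum>p | p permutes (UNIV::'n set). of_int (sign p) * (M' i (p i) v * (\<Prod>j\<in>UNIV - {i}. M x $ j $ p j)))" for i
    proof -
      have "(\<Sum>j\<in>UNIV. M' i j v * cof (M x) i j) = det (\<chi> a. if a = i then (\<chi> j. M' i j v) else M x $ a)"
        by (simp add: det_row_expand)
      also have "\<dots> = (\<Sum>p | p permutes (UNIV::'n set). of_int (sign p) * (M' i (p i) v * (\<Prod>j\<in>UNIV - {i}. M x $ j $ p j)))"
        unfolding det_def
      proof (rule sum.cong[OF refl])
        fix p :: "'n \<Rightarrow> 'n"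
        have "(\<Prod>j\<in>UNIV. (\<chi> a. if a = i then (\<chi> j. M' i j v) else M x $ a) $ j $ p j)
            = M' i (p i) v * (\<Prod>j\<in>UNIV - {i}. (\<chi> a. if a = i then (\<chi> j. M' i j v) else M x $ a) $ j $ p j)"
          by (subst prod.remove[of _ i]) auto
        also have "(\<Prod>j\<in>UNIV - {i}. (\<chi> a. if a = i then (\<chi> j. M' i j v) else M x $ a) $ j $ p j) = (\<Prod>j\<in>UNIV - {i}. M x $ j $ p j)"
          by (rule prod.cong) auto
        finally show "of_int (sign p) * (\<Prod>j\<in>UNIV. (\<chi> a. if a = i then (\<chi> j. M' i j v) else M x $ a) $ j $ p j)
            = of_int (sign p) * (M' i (p i) v * (\<Prod>j\<in>UNIV - {i}. M x $ j $ p j))" by simp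
      qed
      finally show ?thesis .
    qed
    show ?thesis unfolding * sum_distrib_left by (rule sum.swap)
  qed
  ultimately show ?thesis by (simp only:)
qed

text \<open>Jacobi's formula again: row \<open>l\<close> is a constant unit vector and drops out,
  and second cofactors appear.\<close>

lemma has_derivative_cof:
  fixes M :: "'b::real_normed_vector \<Rightarrow> 'a::real_normed_field^'n^'n"
  assumes "\<And>i j. ((\<lambda>x. M x $ i $ j) has_derivative M' i j) (at x)"
  shows "((\<lambda>x. cof (M x) l m) has_derivative (\<lambda>v. \<Sum>i\<in>UNIV-{l}. \<Sum>j\<in>UNIV. M' i j v *
           cof (\<chi> a. if a = l then axis m 1 else M x $ a) i j)) (at x)"
proof -
  have "((\<lambda>x. cof (M x) l m) has_derivative (\<lambda>v. \<Sum>i\<in>UNIV. \<Sum>j\<in>UNIV. (if i = l then \<lambda>v. 0 else M' i j) v *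
           cof (\<chi> a. if a = l then axis m 1 else M x $ a) i j)) (at x)"
    unfolding cof_def[of "M _" l m]
  proof (rule has_derivative_det)
    fix i j
    show "((\<lambda>x. (\<chi> a. if a = l then axis m 1 else M x $ a) $ i $ j) has_derivative
        (if i = l then \<lambda>v. 0 else M' i j)) (at x)"
      by (cases "i = l") (simp_all add: assms)
  qed
  moreover have "(\<Sum>i\<in>UNIV. \<Sum>j\<in>UNIV. (if i = l then \<lambda>v. 0 else M' i j) v *
           cof (\<chi> a. if a = l then axis m 1 else M x $ a) i j) = (\<Sum>i\<in>UNIV-{l}. \<Sum>j\<in>UNIV. M' i j v *
           cof (\<chi> a. if a = l then axis m 1 else M x $ a) i j)" for v
    by (rule sum.mono_neutral_cong_right) auto
  ultimately show ?thesis by (simp only:)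
qed

text \<open>With the rows \<open>l\<close> and \<open>i\<close> replaced, the determinant is an
  alternating bilinear form \<open>B\<close> in these two rows, and exchanging \<open>m\<close> and
  \<open>j\<close> exchanges its arguments.\<close>

lemma cof_cof_antisym:
  fixes M :: "'a::comm_ring_1^'n^'n"
  assumes "i \<noteq> l"
  shows "cof (\<chi> a. if a = l then axis m 1 else M $ a) i j
       = - cof (\<chi> a. if a = l then axis j 1 else M $ a) i m"
proof -
  define B where "B v w = det (\<chi> a. if a = l then v else if a = i then w else M $ a)" for v w
  have B': "B v w = det (\<chi> a. if a = i then w else if a = l then v else M $ a)" for v w
    unfolding B_def by (rule arg_cong[of _ _ det]) (use assms in \<open>simp add: vec_eq_iff\<close>)
  have 0: "B v v = 0" for v unfolding B_def
    by (rule det_identical_rows[OF assms]) (simp add: row_def vec_eq_iff)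
  have "B (v + v') w = B v w + B v' w" for v v' w unfolding B_def by (rule det_row_add)
  moreover have "B v (w + w') = B v w + B v w'" for v w w' unfolding B' by (rule det_row_add)
  ultimately have "B v w + B w v = 0" for v w using 0[of "v + w"] 0[of v] 0[of w] by (simp add: add.commute)
  moreover have "cof (\<chi> a. if a = l then axis m 1 else M $ a) i j = B (axis m 1) (axis j 1)" for m j
    unfolding B' cof_def by (simp add: if_distrib[of "\<lambda>f. f $ _"] cong: if_cong)
  ultimately show ?thesis by (simp add: eq_neg_iff_add_eq_0)
qed

text \<open>The Piola identity in complex form. \<open>N i j m\<close> stands for the derivative of
  the entry (i, j) in direction m. Its symmetry in j and m meets the antisymmetry of the second
  cofactors, so the sum equals its own negative.\<close>

lemma cof_divergence_free:
  fixes M :: "complex^'n^'n" and N :: "'n \<Rightarrow> 'n \<Rightarrow> 'n \<Rightarrow> complex"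
  assumes "\<And>i j m. N i j m = N i m j"
  shows "(\<Sum>m\<in>UNIV. \<Sum>i\<in>UNIV-{l}. \<Sum>j\<in>UNIV. N i j m * cof (\<chi> a. if a = l then axis m 1 else M $ a) i j) = 0"
proof -
  let ?B = "\<lambda>i m j. cof (\<chi> a. if a = l then axis m 1 else M $ a) i j"
  have neg: "x = 0" if "x = - x" for x :: complex
    using that by (simp add: eq_neg_iff_add_eq_0 flip: mult_2)
  have "(\<Sum>m\<in>UNIV. \<Sum>j\<in>UNIV. N i j m * ?B i m j) = 0" if "i \<noteq> l" for i
  proof -
    have "(\<Sum>m\<in>UNIV. \<Sum>j\<in>UNIV. N i j m * ?B i m j) = (\<Sum>m\<in>UNIV. \<Sum>j\<in>UNIV. N i m j * (- ?B i j m))"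
      by (intro sum.cong refl arg_cong2[of _ _ _ _ "(*)"] assms cof_cof_antisym that)
    also have "\<dots> = - (\<Sum>m\<in>UNIV. \<Sum>j\<in>UNIV. N i m j * ?B i j m)" by (simp add: sum_negf)
    also have "(\<Sum>m\<in>UNIV. \<Sum>j\<in>UNIV. N i m j * ?B i j m) = (\<Sum>m\<in>UNIV. \<Sum>j\<in>UNIV. N i j m * ?B i m j)"
      by (rule sum.swap)
    finally show ?thesis by (rule neg)
  qed
  then have "(\<Sum>i\<in>UNIV-{l}. \<Sum>m\<in>UNIV. \<Sum>j\<in>UNIV. N i j m * ?B i m j) = 0"
    by (intro sum.neutral) simp
  then show ?thesis by (rule trans[OF sum.swap])
qed

lemma cnj_det: "cnj (det M) = det (\<chi> i j. cnj (M $ i $ j))"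
  by (simp add: det_def)

lemma cnj_cof: "cnj (cof M l m) = cof (\<chi> i j. cnj (M $ i $ j)) l m"
  unfolding cof_def cnj_det
  by (rule arg_cong[of _ _ det]) (auto simp: vec_eq_iff axis_def)

section \<open>Elementary symmetric functions of a Hermitian matrix\<close>

text \<open>\<open>\<Sum>i. \<gamma> i * f i\<close> is the coefficient of degree \<open>j\<close> of every polynomial \<open>f\<close> of degree at most \<open>n\<close>.
  It turns identities for \<open>det (A + t I)\<close> and its cofactors, valid for all \<open>t\<close>, into identities for \<open>S\<^sub>k\<close>,
  and keeps all coefficients visibly smooth functions of \<open>A\<close>.\<close>

definition extracts :: "nat \<Rightarrow> nat \<Rightarrow> (nat \<Rightarrow> real) \<Rightarrow> bool" where
  "extracts n j \<gamma> \<longleftrightarrow> (\<forall>m\<le>n. (\<Sum>i\<le>n. \<gamma> i * real i ^ m) = (if m = j then 1 else 0))"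

text \<open>Lagrange interpolation at the nodes 0, ..., n: \<open>\<gamma> i\<close> is the
  coefficient of degree \<open>j\<close> of the basis polynomial \<open>L i\<close>, because a
  monomial of degree at most n is its own interpolation polynomial.\<close>

lemma coefficient_functional:
  obtains \<gamma> where "extracts n j \<gamma>"
proof -
  define L where "L i = (\<Prod>r\<in>{..n}-{i}. smult (1 / (real i - real r)) [:- real r, 1:])" for i
  have deg: "degree (L i) \<le> n" if "i \<le> n" for i
  proof -
    have "degree (L i) \<le> (\<Sum>r\<in>{..n}-{i}. degree (smult (1 / (real i - real r)) [:- real r, 1:]))"
      unfolding L_def by (rule order_trans[OF degree_prod_sum_le]) auto
    also have "\<dots> \<le> (\<Sum>r\<in>{..n}-{i}. 1)" by (intro sum_mono) auto
    also have "\<dots> = n" using that by simp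
    finally show ?thesis .
  qed
  have val: "poly (L i) (real q) = (if q = i then 1 else 0)" if "i \<le> n" "q \<le> n" for i q
  proof (cases "q = i")
    case True
    then show ?thesis unfolding L_def poly_prod by (auto intro!: prod.neutral simp: diff_divide_distrib[symmetric])
  next
    case False
    then have "poly (L i) (real q) = 0" unfolding L_def poly_prod
      by (intro prod_zero bexI[of _ q]) (use that in auto)
    then show ?thesis using False by simp
  qed
  have "(\<Sum>i\<le>n. coeff (L i) j * real i ^ m) = (if m = j then 1 else 0)" if "m \<le> n" for m
  proof -
    have "monom 1 m = (\<Sum>i\<le>n. smult (real i ^ m) (L i))"
    proof (rule poly_eqI_degree[where A = "real ` {..n}"])
      fix x assume "x \<in> real ` {..n}"
      then obtain q where q: "q \<le> n" "x = real q" by auto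
      have "(\<Sum>i\<le>n. real i ^ m * poly (L i) (real q)) = (\<Sum>i\<le>n. if i = q then real i ^ m else 0)"
        by (rule sum.cong) (use q val in auto)
      then show "poly (monom 1 m) x = poly (\<Sum>i\<le>n. smult (real i ^ m) (L i)) x"
        using q by (simp add: poly_monom poly_sum)
    next
      have c: "card (real ` {..n}) = Suc n" by (simp add: card_image)
      show "card (real ` {..n}) > degree (monom 1 m :: real poly)"
        using that by (simp add: c degree_monom_eq)
      have "degree (\<Sum>i\<le>n. smult (real i ^ m) (L i)) \<le> n"
        by (intro degree_sum_le) (auto simp: deg)
      then show "card (real ` {..n}) > degree (\<Sum>i\<le>n. smult (real i ^ m) (L i))" by (simp add: c)
    qed
    then have "coeff (monom 1 m) j = coeff (\<Sum>i\<le>n. smult (real i ^ m) (L i)) j" by simp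
    then show ?thesis by (simp add: coeff_sum mult.commute)
  qed
  then have "extracts n j (\<lambda>i. coeff (L i) j)" by (simp add: extracts_def)
  then show ?thesis by (rule that)
qed

section \<open>Hermitian matrices: the characteristic polynomial and its real roots\<close>

definition hermitian :: "complex^'n^'n \<Rightarrow> bool" where
  "hermitian A \<longleftrightarrow> (\<forall>i j. cnj (A $ i $ j) = A $ j $ i)"

definition shift :: "complex^'n^'n \<Rightarrow> complex \<Rightarrow> complex^'n^'n" where
  "shift A t = (\<chi> i j. A $ i $ j + (if i = j then t else 0))"

lemma poly_det: "poly (det P) x = det (\<chi> i j. poly (P $ i $ j) x)"
  by (simp add: det_def poly_sum poly_prod)

lemma det_uminus: "det (\<chi> i j. - A $ i $ j :: 'a::comm_ring_1^'n^'n) = (-1) ^ CARD('n) * det A"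
proof -
  have "det (\<chi> i j. - A $ i $ j :: 'a^'n^'n) = det (\<chi> i. (-1) *s (A $ i))"
    by (rule arg_cong[of _ _ det]) (simp add: vec_eq_iff)
  also have "\<dots> = (\<Prod>i\<in>(UNIV::'n set). -1) * det (\<chi> i. A $ i)"
    by (rule det_rows_mul)
  finally show ?thesis by simp
qed

lemma poly_charpoly: "poly (charpoly A) (- t) = (-1) ^ CARD('n) * det (shift A t)"
  for A :: "complex^'n^'n"
  unfolding charpoly_def poly_det det_uminus[symmetric]
  by (rule arg_cong[of _ _ det]) (simp add: vec_eq_iff shift_def)

text \<open>In the Leibniz sum the degree contributed by a permutation is at most the number of its
  fixed points, hence only the identity reaches n.\<close>

lemma charpoly_monic:
  fixes A :: "complex^'n^'n"
  shows "degree (charpoly A) = CARD('n)" "lead_coeff (charpoly A) = 1"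
proof -
  define P where "P i j = (if i = j then [:0, 1:] else 0) - [:A $ i $ j:]" for i j
  have degP: "degree (P i j) = (if i = j then 1 else 0)" for i j by (auto simp: P_def)
  have char: "charpoly A = (\<Sum>p | p permutes UNIV. of_int (sign p) * (\<Prod>i\<in>UNIV. P i (p i)))"
    by (simp add: charpoly_def det_def P_def)
  have deg: "degree (\<Prod>i\<in>UNIV. P i (p i)) \<le> card {i. p i = i}" for p
  proof -
    have "degree (\<Prod>i\<in>UNIV. P i (p i)) \<le> (\<Sum>i\<in>UNIV. degree (P i (p i)))"
      by (rule order_trans[OF degree_prod_sum_le]) auto
    also have "\<dots> = (\<Sum>i\<in>UNIV. if p i = i then 1 else 0)"
      by (rule sum.cong) (auto simp: degP)
    also have "\<dots> = card {i. p i = i}" by (simp add: sum.If_cases)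
    finally show ?thesis .
  qed
  have "degree (charpoly A) \<le> CARD('n)" unfolding char
    by (intro degree_sum_le order_trans[OF degree_mult_le])
       (auto intro!: order_trans[OF deg] card_mono)
  have co: "coeff (of_int (sign p) * (\<Prod>i\<in>UNIV. P i (p i))) CARD('n) = (if p = id then 1 else 0)"
    for p :: "'n \<Rightarrow> 'n"
  proof (cases "p = id")
    case True
    have "lead_coeff (P i i) = 1" for i by (simp add: P_def)
    then have "lead_coeff (\<Prod>i\<in>UNIV. P i i) = 1" by (simp only: lead_coeff_prod prod.neutral_const)
    moreover have "degree (\<Prod>i\<in>UNIV. P i i) = CARD('n)"
      by (subst degree_prod_eq_sum_degree) (auto simp: degP, simp add: P_def)
    ultimately show ?thesis using True by simp
  next
    case False
    then have "{i. p i = i} \<subset> UNIV" by (auto simp: fun_eq_iff)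
    then have "card {i. p i = i} < CARD('n)" by (intro psubset_card_mono) auto
    then have "degree (of_int (sign p) * (\<Prod>i\<in>UNIV. P i (p i))) < CARD('n)"
      by (intro le_less_trans[OF degree_mult_le]) (auto intro: le_less_trans[OF deg])
    then show ?thesis using False by (simp add: coeff_eq_0)
  qed
  have "coeff (charpoly A) CARD('n) = 1"
    unfolding char coeff_sum co by (simp add: permutes_id sum.delta cong: if_cong)
  then show "degree (charpoly A) = CARD('n)" 
    using \<open>degree (charpoly A) \<le> CARD('n)\<close> le_degree[of "charpoly A" "CARD('n)"] by simp
  then show "lead_coeff (charpoly A) = 1" using \<open>coeff (charpoly A) CARD('n) = 1\<close> by simp
qed

lemma charpoly_root_eigenvector:
  fixes A :: "complex^'n^'n"
  assumes "poly (charpoly A) \<mu> = 0"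
  obtains x where "x \<noteq> 0" "A *v x = \<mu> *s x"
proof -
  have "det (shift A (- \<mu>)) = 0" using assms poly_charpoly[of A "- \<mu>"] by simp
  then have "\<not> invertible (shift A (- \<mu>))" by (simp add: invertible_det_nz)
  then obtain x where x: "shift A (- \<mu>) *v x = 0" "x \<noteq> 0"
    using matrix_left_invertible_ker[of "shift A (- \<mu>)"] by (metis invertible_left_inverse)
  have "A *v x = \<mu> *s x"
  proof (rule vec_eq_iff[THEN iffD2], rule allI)
    fix i
    have "(\<Sum>j\<in>UNIV. (A $ i $ j + (if i = j then - \<mu> else 0)) * x $ j) = 0"
      using x(1) by (simp add: vec_eq_iff matrix_vector_mult_def shift_def)
    then show "(A *v x) $ i = (\<mu> *s x) $ i"
      by (simp add: matrix_vector_mult_def algebra_simps sum.distrib if_distrib[of "\<lambda>a. _ * a"] sum.delta' cong: if_cong)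
  qed
  then show ?thesis using x that by blast
qed

lemma hermitian_eigenvalue_form:
  fixes A :: "complex^'n^'n"
  assumes "A *v x = \<mu> *s x"
  shows "(\<Sum>l\<in>UNIV. \<Sum>m\<in>UNIV. cnj (x $ l) * x $ m * A $ l $ m) = \<mu> * (\<Sum>l\<in>UNIV. of_real ((cmod (x $ l))\<^sup>2))"
proof -
  have "(\<Sum>m\<in>UNIV. A $ l $ m * x $ m) = \<mu> * x $ l" for l
    using assms by (simp add: vec_eq_iff matrix_vector_mult_def)
  then have "(\<Sum>l\<in>UNIV. cnj (x $ l) * (\<Sum>m\<in>UNIV. A $ l $ m * x $ m)) = (\<Sum>l\<in>UNIV. \<mu> * (x $ l * cnj (x $ l)))"
    by (simp add: mult_ac)
  then show ?thesis by (simp add: sum_distrib_left mult_ac flip: complex_norm_square)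
qed

lemma norm_complex_vec_pos:
  fixes x :: "complex^'n"
  assumes "x \<noteq> 0" shows "(\<Sum>l\<in>UNIV. (cmod (x $ l))\<^sup>2) > 0"
proof -
  have "(\<Sum>l\<in>UNIV. (cmod (x $ l))\<^sup>2) = (norm x)\<^sup>2" by (simp add: norm_vec_def L2_set_def sum_nonneg)
  then show ?thesis using assms by simp
qed

lemma hermitian_eigenvalue_real:
  fixes A :: "complex^'n^'n"
  assumes "hermitian A" "A *v x = \<mu> *s x" "x \<noteq> 0"
  shows "\<mu> \<in> \<real>"
proof -
  let ?q = "\<Sum>l\<in>UNIV. \<Sum>m\<in>UNIV. cnj (x $ l) * x $ m * A $ l $ m"
  let ?N = "\<Sum>l\<in>UNIV. (cmod (x $ l))\<^sup>2"
  have "cnj ?q = (\<Sum>l\<in>UNIV. \<Sum>m\<in>UNIV. cnj (x $ m) * x $ l * A $ m $ l)"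
    using assms(1) by (simp add: hermitian_def mult_ac)
  also have "\<dots> = ?q" by (rule sum.swap)
  finally have "cnj \<mu> * of_real ?N = \<mu> * of_real ?N"
    unfolding hermitian_eigenvalue_form[OF assms(2)] by simp
  then have "cnj \<mu> = \<mu>" using norm_complex_vec_pos[OF assms(3)] by (metis mult_cancel_right of_real_eq_0_iff less_irrefl)
  then show ?thesis by (simp add: Reals_cnj_iff)
qed

text \<open>This justifies the choice in \<open>eigvals\<close>: the characteristic polynomial
  splits over the complex numbers, and its roots are eigenvalues of a Hermitian matrix, hence
  real.\<close>

lemma charpoly_eigvals:
  fixes A :: "complex^'n^'n"
  assumes "hermitian A"
  shows "charpoly A = (\<Prod>i\<in>UNIV. [:- complex_of_real (eigvals A i), 1:])"
proof -
  obtain r where r: "smult (lead_coeff (charpoly A)) (\<Prod>i<degree (charpoly A). [:- r i, 1:]) = charpoly A"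
    by (rule complex_poly_decompose')
  then have r: "charpoly A = (\<Prod>i<CARD('n). [:- r i, 1:])" 
    unfolding charpoly_monic(2) by (simp add: charpoly_monic(1))
  obtain b where b: "bij_betw b (UNIV :: 'n set) {..<CARD('n)}"
    using finite_same_card_bij[of "UNIV :: 'n set" "{..<CARD('n)}"] by auto
  have b': "charpoly A = (\<Prod>i\<in>UNIV. [:- r (b i), 1:])"
    unfolding r by (rule prod.reindex_bij_betw[OF b, symmetric])
  have "r (b i) \<in> \<real>" for i
  proof -
    have "poly (charpoly A) (r (b i)) = 0" unfolding b' poly_prod
      by (intro prod_zero bexI[of _ i]) auto
    then show ?thesis using hermitian_eigenvalue_real[OF assms] charpoly_root_eigenvector by metis
  qed
  then have "charpoly A = (\<Prod>i\<in>UNIV. [:- complex_of_real (Re (r (b i))), 1:])"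
    unfolding b' by (simp add: of_real_Re)
  then show ?thesis unfolding eigvals_def
    by (rule someI[of "\<lambda>ev. charpoly A = (\<Prod>i\<in>UNIV. [:- complex_of_real (ev i), 1:])"])
qed

lemma eigvals_eigenvector:
  fixes A :: "complex^'n^'n"
  assumes "hermitian A"
  obtains x where "x \<noteq> 0" "A *v x = of_real (eigvals A i) *s x"
proof -
  have "poly (charpoly A) (of_real (eigvals A i)) = 0"
    unfolding charpoly_eigvals[OF assms] poly_prod by (intro prod_zero bexI[of _ i]) auto
  then show ?thesis using charpoly_root_eigenvector that by blast
qed

text \<open>The product of the factors t + eigenvalue is expanded over subsets and grouped by their
  size. From here on \<open>Sk\<close> is a coefficient of a determinant and no longer depends on
  the chosen enumeration.\<close>

lemma det_shift:
  fixes A :: "complex^'n^'n"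
  assumes "hermitian A"
  shows "det (shift A t) = (\<Sum>m\<le>CARD('n). of_real (Sk m A) * t ^ (CARD('n) - m))"
proof -
  have "(-1) ^ CARD('n) * det (shift A t) = (\<Prod>i\<in>UNIV. - complex_of_real (eigvals A i) + - t)"
    unfolding poly_charpoly[symmetric] charpoly_eigvals[OF assms] poly_prod by simp
  also have "\<dots> = (\<Prod>i\<in>(UNIV::'n set). (-1) * (complex_of_real (eigvals A i) + t))"
    by (simp add: algebra_simps)
  also have "\<dots> = (-1) ^ CARD('n) * (\<Prod>i\<in>UNIV. complex_of_real (eigvals A i) + t)"
    by (subst prod.distrib) simp
  finally have "det (shift A t) = (\<Prod>i\<in>UNIV. complex_of_real (eigvals A i) + t)" by simp
  also have "\<dots> = (\<Sum>I\<in>Pow UNIV. (\<Prod>i\<in>I. complex_of_real (eigvals A i)) * t ^ card (UNIV - I))"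
    by (subst prod_add) simp_all
  also have "\<dots> = (\<Sum>m\<in>{..CARD('n)}. \<Sum>I\<in>{I \<in> Pow UNIV. card I = m}. (\<Prod>i\<in>I. complex_of_real (eigvals A i)) * t ^ card (UNIV - I))"
    by (rule sum.group[symmetric]) (auto intro: card_mono)
  also have "\<dots> = (\<Sum>m\<le>CARD('n). of_real (Sk m A) * t ^ (CARD('n) - m))"
    unfolding Sk_def elem_sym_def of_real_sum sum_distrib_right
    by (intro sum.cong) (auto simp: card_Diff_subset)
  finally show ?thesis .
qed

section \<open>Derivatives of the elementary symmetric functions by coefficient extraction\<close>

definition lam :: "nat \<Rightarrow> (nat \<Rightarrow> real) \<Rightarrow> (complex \<Rightarrow> complex) \<Rightarrow> complex" where
  "lam n \<gamma> f = (\<Sum>i\<le>n. of_real (\<gamma> i) * f (of_nat i))"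

lemma lam_power:
  assumes "extracts n j \<gamma>" "m \<le> n"
  shows "lam n \<gamma> (\<lambda>t. t ^ m) = (if m = j then 1 else 0)"
proof -
  have "lam n \<gamma> (\<lambda>t. t ^ m) = of_real (\<Sum>i\<le>n. \<gamma> i * real i ^ m)" by (simp add: lam_def)
  also have "(\<Sum>i\<le>n. \<gamma> i * real i ^ m) = (if m = j then 1 else 0)"
    using assms by (simp add: extracts_def)
  finally show ?thesis by simp
qed

lemma lam_sum: "lam n \<gamma> (\<lambda>t. \<Sum>i\<in>I. f i t) = (\<Sum>i\<in>I. lam n \<gamma> (f i))"
  unfolding lam_def sum_distrib_left by (rule sum.swap)

lemma lam_cmult: "lam n \<gamma> (\<lambda>t. c * f t) = c * lam n \<gamma> f"
  unfolding lam_def sum_distrib_left by (simp add: mult_ac)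

lemma lam_add: "lam n \<gamma> (\<lambda>t. f t + g t) = lam n \<gamma> f + lam n \<gamma> g"
  unfolding lam_def by (simp add: distrib_left sum.distrib)

lemma lam_poly:
  assumes "extracts n j \<gamma>" "j \<le> n"
  shows "lam n \<gamma> (\<lambda>t. \<Sum>m\<le>n. a m * t ^ (n - m)) = a (n - j)"
proof -
  have "lam n \<gamma> (\<lambda>t. \<Sum>m\<le>n. a m * t ^ (n - m)) = (\<Sum>m\<le>n. a m * (if n - m = j then 1 else 0))"
    unfolding lam_sum lam_cmult by (intro sum.cong) (simp_all add: lam_power[OF assms(1)])
  also have "\<dots> = (\<Sum>m\<le>n. if m = n - j then a m else 0)"
    by (rule sum.cong) (use assms(2) in auto)
  finally show ?thesis by simp
qed

text \<open>For \<open>\<gamma>\<close> extracting degree \<open>n - k\<close>, \<open>Tk \<gamma> A l m\<close> is \<open>\<partial>S\<^sub>k/\<partial>A\<^sub>l\<^sub>m\<close> and \<open>Rk \<gamma> A l m\<close> is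
  \<open>\<partial>S\<^sub>k\<^sub>+\<^sub>1/\<partial>A\<^sub>l\<^sub>m\<close>, which is 0 for \<open>k = n\<close>.\<close>

definition Tk :: "(nat \<Rightarrow> real) \<Rightarrow> complex^'n^'n \<Rightarrow> 'n \<Rightarrow> 'n \<Rightarrow> complex" where
  "Tk \<gamma> A l m = lam CARD('n) \<gamma> (\<lambda>t. cof (shift A t) l m)"

definition Rk :: "(nat \<Rightarrow> real) \<Rightarrow> complex^'n^'n \<Rightarrow> 'n \<Rightarrow> 'n \<Rightarrow> complex" where
  "Rk \<gamma> A l m = lam CARD('n) \<gamma> (\<lambda>t. t * cof (shift A t) l m)"

lemma cnj_lam: "cnj (lam n \<gamma> f) = lam n \<gamma> (\<lambda>t. cnj (f (cnj t)))"
  by (simp add: lam_def)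

lemma cnj_cof_shift:
  assumes "hermitian A"
  shows "cnj (cof (shift A (cnj t)) l m) = cof (shift A t) m l"
proof -
  have "(\<chi> i j. cnj (shift A (cnj t) $ i $ j)) = transpose (shift A t)"
    using assms by (auto simp: vec_eq_iff shift_def hermitian_def transpose_def)
  then show ?thesis by (simp add: cnj_cof cof_transpose)
qed

lemma cnj_Rk: "hermitian A \<Longrightarrow> cnj (Rk \<gamma> A l m) = Rk \<gamma> A m l"
  by (simp add: Rk_def cnj_lam cnj_cof_shift)

context
  fixes A :: "complex^'n^'n" and k :: nat and \<gamma> :: "nat \<Rightarrow> real"
  assumes herm: "hermitian A" and ex: "extracts CARD('n) (CARD('n) - k) \<gamma>" and k: "1 \<le> k" "k \<le> CARD('n)"
begin


lemma lam_det_shift: "lam CARD('n) \<gamma> (\<lambda>t. det (shift A t)) = of_real (Sk k A)"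
  unfolding det_shift[OF herm] using lam_poly[OF ex, of "\<lambda>m. of_real (Sk m A)"] k by simp

text \<open>The coefficient of degree n - k in the adjugate identity for A + t I; the part t I of
  the matrix accounts for \<open>Rk\<close>.\<close>

lemma Tk_mult_row:
  "(\<Sum>m\<in>UNIV. A $ p $ m * Tk \<gamma> A l m) + Rk \<gamma> A l p = (if p = l then of_real (Sk k A) else 0)"
proof -
  have *: "(\<Sum>m\<in>UNIV. A $ p $ m * cof (shift A t) l m) + t * cof (shift A t) l p = (if p = l then det (shift A t) else 0)" for t
  proof -
    have "(\<Sum>m\<in>UNIV. A $ p $ m * cof (shift A t) l m) + t * cof (shift A t) l p
        = (\<Sum>m\<in>UNIV. shift A t $ p $ m * cof (shift A t) l m)"
      by (simp add: shift_def distrib_right sum.distrib if_distrib[of "\<lambda>x. x * _"] cong: if_cong)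
    then show ?thesis by (simp add: cof_mult_row)
  qed
  have "(\<Sum>m\<in>UNIV. A $ p $ m * Tk \<gamma> A l m) + Rk \<gamma> A l p
      = lam CARD('n) \<gamma> (\<lambda>t. if p = l then det (shift A t) else 0)"
    unfolding Tk_def Rk_def lam_cmult[symmetric] lam_sum[symmetric] lam_add[symmetric] * ..
  also have "\<dots> = (if p = l then of_real (Sk k A) else 0)"
    by (simp add: lam_det_shift) (simp add: lam_def)
  finally show ?thesis .
qed

text \<open>The derivative of det (A + t I) in t is the trace of the cofactors, and t d/dt
  multiplies the coefficient of degree n - k by n - k.\<close>

lemma trace_Rk: "(\<Sum>l\<in>UNIV. Rk \<gamma> A l l) = (of_nat CARD('n) - of_nat k) * of_real (Sk k A)"
proof -
  let ?n = "CARD('n)"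
  have d: "t * (\<Sum>l\<in>UNIV. cof (shift A t) l l) = (\<Sum>m\<le>?n. (of_nat (?n - m) * of_real (Sk m A)) * t ^ (?n - m))" for t
  proof -
    have "((\<lambda>t. det (shift A t)) has_derivative (\<lambda>v. \<Sum>i\<in>UNIV. \<Sum>j\<in>UNIV. (if i = j then v else 0) * cof (shift A t) i j)) (at t)"
    proof (rule has_derivative_det)
      fix i j :: 'n
      show "((\<lambda>x. shift A x $ i $ j) has_derivative (\<lambda>v. if i = j then v else 0)) (at t)"
        by (cases "i = j") (auto simp: shift_def intro!: derivative_eq_intros)
    qed
    moreover have "((\<lambda>t. det (shift A t)) has_field_derivative (\<Sum>m\<le>?n. of_real (Sk m A) * (of_nat (?n - m) * t ^ (?n - m - 1)))) (at t)"
      unfolding det_shift[OF herm]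
    proof (rule DERIV_sum)
      fix m
      have "((\<lambda>t. t ^ (?n - m)) has_field_derivative of_nat (?n - m) * t ^ (?n - m - 1)) (at t)"
        using DERIV_pow[of "?n - m"] by (auto intro!: derivative_eq_intros)
      then show "((\<lambda>t. of_real (Sk m A) * t ^ (?n - m)) has_field_derivative
          of_real (Sk m A) * (of_nat (?n - m) * t ^ (?n - m - 1))) (at t)"
        by (rule DERIV_cmult)
    qed
    then have "((\<lambda>t. det (shift A t)) has_derivative (*) (\<Sum>m\<le>?n. of_real (Sk m A) * (of_nat (?n - m) * t ^ (?n - m - 1)))) (at t)"
      by (rule has_field_derivative_imp_has_derivative)
    ultimately have "(\<Sum>i\<in>UNIV. \<Sum>j\<in>UNIV. (if i = j then 1 else 0) * cof (shift A t) i j) =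
        (\<Sum>m\<le>?n. of_real (Sk m A) * (of_nat (?n - m) * t ^ (?n - m - 1))) * 1"
      by (rule has_derivative_unique[THEN fun_cong])
    then have "t * (\<Sum>l\<in>UNIV. cof (shift A t) l l) = t * (\<Sum>m\<le>?n. of_real (Sk m A) * (of_nat (?n - m) * t ^ (?n - m - 1)))"
      by (simp add: if_distrib[of "\<lambda>x. x * _"] cong: if_cong)
    also have "\<dots> = (\<Sum>m\<le>?n. (of_nat (?n - m) * of_real (Sk m A)) * t ^ (?n - m))"
      unfolding sum_distrib_left
    proof (rule sum.cong[OF refl])
      fix m
      show "t * (of_real (Sk m A) * (of_nat (?n - m) * t ^ (?n - m - 1))) = of_nat (?n - m) * of_real (Sk m A) * t ^ (?n - m)"
        by (cases "?n - m") auto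
    qed
    finally show ?thesis .
  qed
  have "(\<Sum>l\<in>UNIV. Rk \<gamma> A l l) = lam ?n \<gamma> (\<lambda>t. t * (\<Sum>l\<in>UNIV. cof (shift A t) l l))"
    unfolding Rk_def lam_sum[symmetric] sum_distrib_left ..
  also have "\<dots> = of_nat (?n - k) * of_real (Sk k A)"
    unfolding d using lam_poly[OF ex, of "\<lambda>m. of_nat (?n - m) * of_real (Sk m A)"] k by simp
  finally show ?thesis using k by (simp add: of_nat_diff)
qed

text \<open>Euler's identity for S_k, homogeneous of degree k, obtained as the trace of
  \<open>Tk_mult_row\<close>: n - (n - k) = k.\<close>

lemma Tk_mult_trace: "(\<Sum>l\<in>UNIV. \<Sum>m\<in>UNIV. A $ l $ m * Tk \<gamma> A l m) = of_nat k * of_real (Sk k A)"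
proof -
  have "(\<Sum>l\<in>UNIV. (\<Sum>m\<in>UNIV. A $ l $ m * Tk \<gamma> A l m) + Rk \<gamma> A l l) = of_nat CARD('n) * of_real (Sk k A)"
    by (subst Tk_mult_row) simp
  then show ?thesis by (simp add: sum.distrib trace_Rk algebra_simps)
qed

end

text \<open>By \<open>cof_scalar_plus_rank_two\<close> the contraction of the cofactors of A + t I
  is (h + t)^(n-1), from which the coefficient of degree n - k is read off. On the sphere this
  expresses the flux through \<open>h\<close> alone, although \<open>a\<close> and \<open>b\<close>
  are unknown there.\<close>

lemma Tk_scalar_plus_rank_two:
  fixes A :: "complex^'n^'n" and z :: "complex^'n"
  assumes ex: "extracts CARD('n) (CARD('n) - k) \<gamma>" and k: "1 \<le> k" "k \<le> CARD('n)"
    and A: "\<And>i j. A $ i $ j = (if i = j then h else 0) + a i * z $ j + cnj (z $ i) * b j"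
    and z: "(\<Sum>l\<in>UNIV. cnj (z $ l) * z $ l) = 1"
  shows "(\<Sum>l\<in>UNIV. \<Sum>m\<in>UNIV. cnj (z $ l) * (z $ m * Tk \<gamma> A l m)) = of_nat ((CARD('n) - 1) choose (k - 1)) * h ^ (k - 1)"
proof -
  let ?n = "CARD('n)"
  have *: "(\<Sum>l\<in>UNIV. \<Sum>m\<in>UNIV. cnj (z $ l) * (z $ m * cof (shift A t) l m)) = (h + t) ^ (?n - 1)" for t
    using cof_scalar_plus_rank_two[of "shift A t" "h + t" a "\<lambda>j. z $ j" "\<lambda>i. cnj (z $ i)" b] z
    by (simp add: shift_def A)
  have "(\<Sum>l\<in>UNIV. \<Sum>m\<in>UNIV. cnj (z $ l) * (z $ m * Tk \<gamma> A l m)) = lam ?n \<gamma> (\<lambda>t. (h + t) ^ (?n - 1))"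
    unfolding Tk_def lam_cmult[symmetric] lam_sum[symmetric] * ..
  also have "\<dots> = lam ?n \<gamma> (\<lambda>t. \<Sum>m\<le>?n-1. (of_nat ((?n - 1) choose m) * h ^ (?n - 1 - m)) * t ^ m)"
    by (subst add.commute, subst binomial_ring) (simp add: mult_ac)
  also have "\<dots> = (\<Sum>m\<le>?n-1. (of_nat ((?n - 1) choose m) * h ^ (?n - 1 - m)) * (if m = ?n - k then 1 else 0))"
    unfolding lam_sum lam_cmult by (intro sum.cong) (auto simp: lam_power[OF ex])
  also have "\<dots> = of_nat ((?n - 1) choose (?n - k)) * h ^ (?n - 1 - (?n - k))"
    using k by (simp add: if_distrib[of "\<lambda>x. _ * x"] cong: if_cong) 
  also have "?n - 1 - (?n - k) = k - 1" using k by simp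
  also have "(?n - 1) choose (?n - k) = (?n - 1) choose (k - 1)"
    using binomial_symmetric[of "k - 1" "?n - 1"] k by simp
  finally show ?thesis .
qed

section \<open>A divergence inequality on the unit ball\<close>

lemma lborel_integral_translation:
  fixes g :: "'a::euclidean_space \<Rightarrow> real"
  assumes "g \<in> borel_measurable borel"
  shows "integral\<^sup>L lborel (\<lambda>x. g (c + x)) = integral\<^sup>L lborel g"
proof -
  have "integral\<^sup>L lborel g = integral\<^sup>L (distr lborel borel ((+) c)) g"
    by (simp only: lborel_distr_plus)
  also have "\<dots> = integral\<^sup>L lborel (\<lambda>x. g (c + x))"
    by (rule integral_distr) (use assms in auto)
  finally show ?thesis by simp
qed

lemma continuous_compact_support_integrable:
  fixes g :: "'a::euclidean_space \<Rightarrow> real"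
  assumes "continuous_on UNIV g" "\<And>x. norm x > R \<Longrightarrow> g x = 0"
  shows "integrable lborel g"
proof -
  have "integrable lborel (\<lambda>x. indicator (cball 0 R) x *\<^sub>R g x)"
    by (rule borel_integrable_compact) (auto intro: continuous_on_subset[OF assms(1)])
  moreover have "(\<lambda>x. indicator (cball 0 R) x *\<^sub>R g x) = g"
    using assms(2) by (auto simp: fun_eq_iff indicator_def not_le)
  ultimately show ?thesis by (simp only:)
qed

lemma directional_mvt:
  fixes g :: "'a::real_normed_vector \<Rightarrow> real"
  assumes "h > 0" "\<And>t. 0 \<le> t \<Longrightarrow> t \<le> h \<Longrightarrow> (g has_derivative g' (x + t *\<^sub>R b)) (at (x + t *\<^sub>R b))"
  obtains t where "0 < t" "t < h" "g (x + h *\<^sub>R b) - g x = h * g' (x + t *\<^sub>R b) b"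
proof -
  have d: "((\<lambda>t. g (x + t *\<^sub>R b)) has_field_derivative g' (x + t *\<^sub>R b) b) (at t)" if "0 \<le> t" "t \<le> h" for t
  proof -
    have "((\<lambda>t. g (x + t *\<^sub>R b)) has_derivative (\<lambda>s. g' (x + t *\<^sub>R b) (s *\<^sub>R b))) (at t)"
      by (rule has_derivative_compose[of "\<lambda>t. x + t *\<^sub>R b" "\<lambda>t. t *\<^sub>R b" t UNIV g])
         (auto intro!: derivative_eq_intros assms(2) that)
    moreover have "linear (g' (x + t *\<^sub>R b))" using assms(2)[OF that] by (rule has_derivative_linear)
    ultimately show ?thesis by (simp add: has_field_derivative_def linear_cmul mult.commute[of _ "g' _ _"])
  qed
  obtain t where "0 < t" "t < h" "g (x + h *\<^sub>R b) - g (x + 0 *\<^sub>R b) = (h - 0) * g' (x + t *\<^sub>R b) b"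
    using MVT2[OF assms(1), of "\<lambda>t. g (x + t *\<^sub>R b)" "\<lambda>t. g' (x + t *\<^sub>R b) b"] d by blast
  then show ?thesis using that by simp
qed

text \<open>By translation invariance every difference quotient of \<open>g\<close> along
  \<open>b\<close> has integral 0. The quotients converge to the derivative and are dominated by a
  multiple of the indicator of one ball, because the step lengths 1/(i+1) are at most 1.\<close>

lemma integral_directional_derivative_eq_0:
  fixes g :: "'a::euclidean_space \<Rightarrow> real"
  assumes d: "\<And>x. (g has_derivative g' x) (at x)"
    and c: "continuous_on UNIV (\<lambda>x. g' x b)"
    and z: "\<And>x. norm x > R \<Longrightarrow> g x = 0"
  shows "integrable lborel (\<lambda>x. g' x b)" "integral\<^sup>L lborel (\<lambda>x. g' x b) = 0"
proof -
  have z': "g' x b = 0" if "norm x > R" for x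
  proof -
    have "(g has_derivative (\<lambda>_. 0)) (at x)"
      by (rule has_derivative_transform_within_open[of "\<lambda>_. 0" _ _ _ "{x. norm x > R}"])
         (use that z in \<open>auto intro!: open_Collect_less continuous_intros\<close>)
    then have "g' x = (\<lambda>_. 0)" using d has_derivative_unique by blast
    then show ?thesis by simp
  qed
  show int: "integrable lborel (\<lambda>x. g' x b)"
    by (rule continuous_compact_support_integrable[OF c z'])
  have cg: "continuous_on UNIV g"
    by (intro continuous_at_imp_continuous_on ballI has_derivative_continuous[OF d])
  then have mg: "g \<in> borel_measurable borel" by (rule borel_measurable_continuous_onI)
  have ig: "integrable lborel g" by (rule continuous_compact_support_integrable[OF cg z])
  have "bounded ((\<lambda>x. g' x b) ` cball 0 R)"
    by (intro compact_imp_bounded compact_continuous_image continuous_on_subset[OF c]) auto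
  then obtain K0 where "\<forall>y\<in>(\<lambda>x. g' x b) ` cball 0 R. norm y \<le> K0" unfolding bounded_iff by blast
  then have K0: "norm (g' x b) \<le> K0" if "norm x \<le> R" for x using that by auto
  define K where "K = max K0 0"
  have K: "\<bar>g' x b\<bar> \<le> K" for x using K0[of x] z'[of x] by (cases "norm x > R") (auto simp: K_def)
  define s where "s i x = real (Suc i) * (g (inverse (real (Suc i)) *\<^sub>R b + x) - g x)" for i x
  have s_lim: "(\<lambda>i. s i x) \<longlonglongrightarrow> g' x b" for x
  proof -
    have "((\<lambda>t. g (x + t *\<^sub>R b)) has_derivative (\<lambda>t. g' x (t *\<^sub>R b))) (at 0)"
      by (rule has_derivative_compose[of "\<lambda>t. x + t *\<^sub>R b" "\<lambda>t. t *\<^sub>R b" 0 UNIV g]) (auto intro!: derivative_eq_intros d)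
    moreover have "linear (g' x)" using d by (rule has_derivative_linear)
    ultimately have "((\<lambda>t. g (x + t *\<^sub>R b)) has_field_derivative g' x b) (at 0)"
      by (simp add: has_field_derivative_def linear_cmul mult.commute[of _ "g' _ _"])
    then have "((\<lambda>h. (g (x + h *\<^sub>R b) - g x) / h) \<longlongrightarrow> g' x b) (at 0)"
      by (simp add: DERIV_def)
    then have "(\<lambda>i. (g (x + inverse (real (Suc i)) *\<^sub>R b) - g x) / inverse (real (Suc i))) \<longlonglongrightarrow> g' x b"
      by (rule filterlim_compose) (auto simp: filterlim_at intro: LIMSEQ_inverse_real_of_nat simp del: of_nat_Suc)
    then show ?thesis by (simp add: s_def divide_inverse add.commute mult.commute del: of_nat_Suc)
  qed
  have s_bound: "norm (s i x) \<le> K * indicator (cball 0 (R + norm b)) x" for i x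
  proof (cases "norm x \<le> R + norm b")
    case True
    obtain t where t: "g (x + inverse (real (Suc i)) *\<^sub>R b) - g x = inverse (real (Suc i)) * g' (x + t *\<^sub>R b) b"
      by (rule directional_mvt[of "inverse (real (Suc i))" g g' x b]) (auto intro: d)
    then have "s i x = g' (x + t *\<^sub>R b) b" by (simp add: s_def add.commute)
    then show ?thesis using K True by simp
  next
    case False
    let ?c = "inverse (real (Suc i))"
    have "norm (?c *\<^sub>R b) \<le> norm b" by (simp add: field_simps mult_left_le)
    moreover have "norm x \<le> norm (?c *\<^sub>R b + x) + norm (?c *\<^sub>R b)"
      using norm_triangle_ineq4[of "?c *\<^sub>R b + x" "?c *\<^sub>R b"] by simp
    ultimately have "norm (?c *\<^sub>R b + x) > R" using False by linarith
    moreover have "norm x > R" using False norm_ge_zero[of b] by linarith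
    ultimately show ?thesis using False z by (simp add: s_def)
  qed
  have s_int: "integral\<^sup>L lborel (s i) = 0" for i
  proof -
    have "integrable lborel (\<lambda>x. g (inverse (real (Suc i)) *\<^sub>R b + x))"
    proof (rule continuous_compact_support_integrable[where R = "R + norm (inverse (real (Suc i)) *\<^sub>R b)"])
      show "continuous_on UNIV (\<lambda>x. g (inverse (real (Suc i)) *\<^sub>R b + x))"
        by (rule continuous_on_compose2[OF cg]) (auto intro!: continuous_intros)
      fix x :: 'a assume "norm x > R + norm (inverse (real (Suc i)) *\<^sub>R b)"
      moreover have "norm x \<le> norm (inverse (real (Suc i)) *\<^sub>R b + x) + norm (inverse (real (Suc i)) *\<^sub>R b)"
        using norm_triangle_ineq4[of "inverse (real (Suc i)) *\<^sub>R b + x" "inverse (real (Suc i)) *\<^sub>R b"] by simp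
      ultimately show "g (inverse (real (Suc i)) *\<^sub>R b + x) = 0" by (intro z) linarith
    qed
    then show ?thesis unfolding s_def using ig
      by (simp only: integral_mult_right_zero Bochner_Integration.integral_diff lborel_integral_translation[OF mg] diff_self mult_zero_right)
  qed
  have "(\<lambda>i. integral\<^sup>L lborel (s i)) \<longlonglongrightarrow> integral\<^sup>L lborel (\<lambda>x. g' x b)"
  proof (rule integral_dominated_convergence[where w = "\<lambda>x. K * indicator (cball 0 (R + norm b)) x"])
    show "(\<lambda>x. g' x b) \<in> borel_measurable lborel" using int by (rule borel_measurable_integrable)
    show "s i \<in> borel_measurable lborel" for i
      unfolding s_def using mg by measurable
    show "integrable lborel (\<lambda>x::'a. K * indicator (cball 0 (R + norm b)) x)"
      using emeasure_lborel_cball_finite[of "0::'a" "R + norm b"]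
      by (intro integrable_mult_right integrable_real_indicator) auto
  qed (use s_lim s_bound in auto)
  then show "integral\<^sup>L lborel (\<lambda>x. g' x b) = 0"
    unfolding s_int using LIMSEQ_unique tendsto_const by blast
qed

section \<open>Radial cutoff functions and integration by parts\<close>

lemma DERIV_max_square: "((\<lambda>x::real. (max 0 x)\<^sup>2) has_field_derivative 2 * max 0 x) (at x)"
proof -
  consider "x > 0" | "x < 0" | "x = 0" by linarith
  then show ?thesis
  proof cases
    case 1
    have "((\<lambda>x::real. x\<^sup>2) has_field_derivative 2 * max 0 x) (at x)"
      using 1 by (auto intro!: derivative_eq_intros)
    then show ?thesis
      by (rule DERIV_cong_ev[THEN iffD1, rotated 3])
         (use 1 eventually_nhds_in_open[of "{0<..}" x] in \<open>auto elim!: eventually_mono\<close>)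
  next
    case 2
    have "((\<lambda>x::real. 0) has_field_derivative 2 * max 0 x) (at x)"
      using 2 by (auto intro!: derivative_eq_intros)
    then show ?thesis
      by (rule DERIV_cong_ev[THEN iffD1, rotated 3])
         (use 2 eventually_nhds_in_open[of "{..<0}" x] in \<open>auto elim!: eventually_mono\<close>)
  next
    case 3
    have "((\<lambda>h. ((max 0 h)\<^sup>2) / h) \<longlongrightarrow> 0) (at (0::real))"
    proof (rule tendsto_sandwich[of "\<lambda>h. 0" _ _ "\<lambda>h. \<bar>h\<bar>"])
      show "\<forall>\<^sub>F h in at (0::real). 0 \<le> (max 0 h)\<^sup>2 / h"
        by (rule always_eventually) (auto simp: max_def power2_eq_square)
      show "\<forall>\<^sub>F h in at (0::real). (max 0 h)\<^sup>2 / h \<le> \<bar>h\<bar>"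
        by (rule always_eventually) (auto simp: max_def power2_eq_square)
    qed (auto intro!: tendsto_eq_intros)
    then show ?thesis using 3 by (simp add: DERIV_def)
  qed
qed

text \<open>A \<open>C\<^sup>1\<close> step from 0 to 1: its second derivative is 4 and -4 on the two halves of the unit interval.\<close>

definition step :: "real \<Rightarrow> real" where
  "step x = 2 * (max 0 x)\<^sup>2 - 4 * (max 0 (x - 1/2))\<^sup>2 + 2 * (max 0 (x - 1))\<^sup>2"

definition step' :: "real \<Rightarrow> real" where
  "step' x = 4 * max 0 x - 8 * max 0 (x - 1/2) + 4 * max 0 (x - 1)"

lemma DERIV_step: "(step has_field_derivative step' x) (at x)"
proof -
  have "((\<lambda>x. (max 0 (x - c))\<^sup>2) has_field_derivative 2 * max 0 (x - c)) (at x)" for c :: real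
  proof -
    have "((\<lambda>x. x - c) has_field_derivative 1) (at x)" by (auto intro!: derivative_eq_intros)
    from DERIV_chain2[of "\<lambda>x. (max 0 x)\<^sup>2" "2 * max 0 (x - c)" "\<lambda>x. x - c", OF DERIV_max_square this]
    show ?thesis by simp
  qed
  from DERIV_add[OF DERIV_diff[OF DERIV_cmult[OF this[of 0], of 2] DERIV_cmult[OF this[of "1/2"], of 4]] DERIV_cmult[OF this[of 1], of 2]]
  show ?thesis unfolding step_def[abs_def] step'_def by simp
qed

lemma step_eq_0: "x \<le> 0 \<Longrightarrow> step x = 0" and step'_eq_0: "x \<le> 0 \<Longrightarrow> step' x = 0"
  by (auto simp: step_def step'_def)

lemma step_eq_1: "x \<ge> 1 \<Longrightarrow> step x = 1" and step'_eq_0_right: "x \<ge> 1 \<Longrightarrow> step' x = 0"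
  by (auto simp: step_def step'_def power2_eq_square algebra_simps)

lemma step'_nonneg: "step' x \<ge> 0"
  by (auto simp: step'_def max_def)

lemma step_mono: "x \<le> y \<Longrightarrow> step x \<le> step y"
  by (rule DERIV_nonneg_imp_nondecreasing) (use DERIV_step step'_nonneg in blast)+

lemma step_bounds: "0 \<le> step x" "step x \<le> 1"
  using step_mono[of "min x 0" x] step_mono[of x "max x 1"] step_eq_0[of "min x 0"] step_eq_1[of "max x 1"] by auto

lemma continuous_step': "continuous_on S step'"
  unfolding step'_def by (intro continuous_intros)

text \<open>The cutoff times \<open>X\<close>, extended by 0, is continuously differentiable on the
  whole space, so \<open>integral_directional_derivative_eq_0\<close> applies to each component; by
  the product rule \<open>Y\<close> is its divergence.\<close>

lemma integral_cutoff_divergence: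
  fixes X :: "'a::euclidean_space \<Rightarrow> 'a"
  assumes dX: "\<And>x. x \<in> ball 0 1 \<Longrightarrow> (X has_derivative X' x) (at x)"
    and cX: "\<And>b. b \<in> Basis \<Longrightarrow> continuous_on (ball 0 1) (\<lambda>x. X' x b)"
    and d\<phi>: "\<And>s. (\<phi> has_field_derivative \<phi>' s) (at s)" and c\<phi>: "continuous_on UNIV \<phi>'"
    and r: "r < 1" and \<phi>0: "\<And>s. s \<ge> r \<Longrightarrow> \<phi> s = 0" and \<phi>'0: "\<And>s. s \<ge> r \<Longrightarrow> \<phi>' s = 0"
  defines "Y \<equiv> \<lambda>x. indicator (ball 0 1) x * (\<phi> (x \<bullet> x) * (\<Sum>b\<in>Basis. X' x b \<bullet> b) + 2 * \<phi>' (x \<bullet> x) * (X x \<bullet> x))"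
  shows "integrable lborel Y" "integral\<^sup>L lborel Y = 0"
proof -
  \<comment> \<open>The ball, where \<open>X\<close> is differentiable, and \<open>U\<close>, where
    the cutoff and its derivative vanish, are open and cover the space because \<open>r < 1\<close>.
    All regularity is checked on these two sets.\<close>
  define U where "U = {x::'a. r < x \<bullet> x}"
  have U: "open U" unfolding U_def by (intro open_Collect_less continuous_intros)
  have cover: "ball 0 1 \<union> U = UNIV"
  proof -
    have "x \<in> U" if "x \<notin> ball 0 1" for x
    proof -
      have "1 \<le> norm x" using that by simp
      then have "1 \<le> (norm x)\<^sup>2" by (simp add: one_le_power)
      then show ?thesis using r by (simp add: U_def dot_square_norm)
    qed
    then show ?thesis by blast
  qed
  define g where "g b x = indicator (ball 0 1) x * (\<phi> (x \<bullet> x) * (X x \<bullet> b))" for b x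
  define g' where "g' b x v = indicator (ball 0 1) x * (\<phi> (x \<bullet> x) * (X' x v \<bullet> b) + 2 * \<phi>' (x \<bullet> x) * (x \<bullet> v) * (X x \<bullet> b))" for b x v
  have gU: "g b x = 0" "g' b x v = 0" if "x \<in> U" for b x v
    using that \<phi>0 \<phi>'0 by (auto simp: g_def g'_def U_def)
  have dg: "(g b has_derivative g' b x) (at x)" for b x
  proof (cases "x \<in> U")
    case True
    have "(g b has_derivative (\<lambda>_. 0)) (at x)"
      by (rule has_derivative_transform_within_open[of "\<lambda>_. 0" _ _ _ U]) (use True U gU in auto)
    moreover have "g' b x = (\<lambda>_. 0)" using True gU by auto
    ultimately show ?thesis by simp
  next
    case False
    then have x: "x \<in> ball 0 1" using cover by blast
    have d1: "((\<lambda>x. \<phi> (x \<bullet> x)) has_derivative (\<lambda>v. \<phi>' (x \<bullet> x) * (2 * (x \<bullet> v)))) (at x)"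
    proof (rule has_derivative_compose[of "\<lambda>x. x \<bullet> x" "\<lambda>v. 2 * (x \<bullet> v)" x UNIV \<phi> "(*) (\<phi>' (x \<bullet> x))"])
      show "((\<lambda>x. x \<bullet> x) has_derivative (\<lambda>v. 2 * (x \<bullet> v))) (at x)"
        by (auto intro!: derivative_eq_intros simp: inner_commute)
      show "(\<phi> has_derivative (*) (\<phi>' (x \<bullet> x))) (at (x \<bullet> x))"
        using d\<phi> by (simp add: has_field_derivative_def)
    qed
    have "((\<lambda>x. X x \<bullet> b) has_derivative (\<lambda>v. X' x v \<bullet> b)) (at x)"
      by (rule has_derivative_inner_left[OF dX[OF x]])
    from has_derivative_mult[OF d1 this]
    have "((\<lambda>x. \<phi> (x \<bullet> x) * (X x \<bullet> b)) has_derivative g' b x) (at x)"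
      by (rule has_derivative_eq_rhs) (use x in \<open>simp add: g'_def fun_eq_iff\<close>)
    then show ?thesis
      by (rule has_derivative_transform_within_open[of _ _ _ _ "ball 0 1"]) (use x in \<open>auto simp: g_def\<close>)
  qed
  have cXX: "continuous_on (ball 0 1) X"
    by (intro continuous_at_imp_continuous_on ballI has_derivative_continuous[OF dX])
  have c\<phi>2: "continuous_on UNIV \<phi>"
    by (intro continuous_at_imp_continuous_on ballI DERIV_continuous[OF d\<phi>])
  have cg': "continuous_on UNIV (\<lambda>x. g' b x b)" if b: "b \<in> Basis" for b
  proof -
    have "continuous_on (ball 0 1) (\<lambda>x. \<phi> (x \<bullet> x) * (X' x b \<bullet> b) + 2 * \<phi>' (x \<bullet> x) * (x \<bullet> b) * (X x \<bullet> b))"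
      by (intro continuous_intros cXX cX b continuous_on_compose2[OF c\<phi>] continuous_on_compose2[OF c\<phi>2]) auto
    then have "continuous_on (ball 0 1) (\<lambda>x. g' b x b)"
      by (rule continuous_on_eq) (simp add: g'_def)
    moreover have "continuous_on U (\<lambda>x. g' b x b)"
      by (rule continuous_on_eq[of _ "\<lambda>_. 0"]) (use gU in auto)
    ultimately show ?thesis using continuous_on_open_Un[of "ball 0 1" U] U cover by auto
  qed
  have g0: "g b x = 0" if "norm x > 1" for b x using that by (simp add: g_def)
  note int = integral_directional_derivative_eq_0[OF dg cg' g0]
  have Y: "Y = (\<lambda>x. \<Sum>b\<in>Basis. g' b x b)"
  proof
    fix x
    have "(\<Sum>b\<in>Basis. 2 * \<phi>' (x \<bullet> x) * (x \<bullet> b) * (X x \<bullet> b)) = 2 * \<phi>' (x \<bullet> x) * (X x \<bullet> x)"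
      by (subst (2) euclidean_inner) (simp add: sum_distrib_left mult_ac)
    then show "Y x = (\<Sum>b\<in>Basis. g' b x b)"
      by (simp add: Y_def g'_def sum_distrib_left[symmetric] sum.distrib)
  qed
  show "integrable lborel Y" unfolding Y using int(1) by (intro Bochner_Integration.integrable_sum)
  show "integral\<^sup>L lborel Y = 0" unfolding Y using int by (subst Bochner_Integration.integral_sum) auto
qed

text \<open>For a radially decreasing cutoff the term of \<open>integral_cutoff_divergence\<close>
  with the derivative of the cutoff is nonpositive wherever the field points outwards. So the other
  term has a nonnegative integral, and it tends to the integral of the divergence as the cutoffs
  tend to 1.\<close>

theorem integral_divergence_nonneg:
  fixes X :: "'a::euclidean_space \<Rightarrow> 'a"
  assumes dX: "\<And>x. x \<in> ball 0 1 \<Longrightarrow> (X has_derivative X' x) (at x)"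
    and cX: "\<And>b. b \<in> Basis \<Longrightarrow> continuous_on (ball 0 1) (\<lambda>x. X' x b)"
    and cG: "continuous_on (cball 0 1) G" and GX: "\<And>x. x \<in> ball 0 1 \<Longrightarrow> G x = X x"
    and pos: "\<And>x. x \<in> sphere 0 1 \<Longrightarrow> 0 \<le> G x \<bullet> x"
    and int: "set_integrable lborel (ball 0 1) (\<lambda>x. \<Sum>b\<in>Basis. X' x b \<bullet> b)"
  shows "0 \<le> (LINT x:ball 0 1|lborel. (\<Sum>b\<in>Basis. X' x b \<bullet> b))"
proof -
  let ?D = "\<lambda>x. \<Sum>b\<in>Basis. X' x b \<bullet> b"
  let ?N = "real DIM('a) * measure lborel (ball (0::'a) 1)"
  \<comment> \<open>A nonnegative normal component on the sphere says nothing about points nearby.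
    Adding e x raises it to at least e there, hence it is nonnegative in a collar, at the cost of e
    times the dimension in the divergence.\<close>
  have *: "0 \<le> (LINT x:ball 0 1|lborel. ?D x) + e * ?N" if e: "e > 0" for e
  proof -
    define D where "D x = (\<Sum>b\<in>Basis. (X' x b + e *\<^sub>R b) \<bullet> b)" for x
    have D: "D x = ?D x + e * real DIM('a)" for x
      by (simp add: D_def inner_add_left sum.distrib sum_distrib_left[symmetric] inner_same_Basis)
    have fin: "emeasure lborel (ball (0::'a) 1) < \<infinity>" by (rule emeasure_lborel_ball_finite)
    have c: "set_integrable lborel (ball 0 1) (\<lambda>x::'a. e * real DIM('a))"
      unfolding set_integrable_def using fin by (simp add: integrable_real_indicator)
    have Dint: "set_integrable lborel (ball 0 1) D" unfolding D by (rule set_integral_add(1)[OF int c])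
    have Dval: "(LINT x:ball 0 1|lborel. D x) = (LINT x:ball 0 1|lborel. ?D x) + e * ?N"
    proof -
      have "(LINT x:ball (0::'a) 1|lborel. e * real DIM('a)) = e * ?N"
        unfolding set_lebesgue_integral_def using fin by (simp add: emeasure_lborel_ball_finite)
      then show ?thesis unfolding D using set_integral_add(2)[OF int c] by simp
    qed
    have "\<exists>d>0. \<forall>x\<in>ball 0 1. 1 - d < norm x \<longrightarrow> 0 \<le> (X x + e *\<^sub>R x) \<bullet> x"
    proof -
      have "uniformly_continuous_on (cball 0 1) (\<lambda>x. (G x + e *\<^sub>R x) \<bullet> x)"
        by (intro compact_uniformly_continuous continuous_intros cG) auto
      then obtain d where d: "d > 0" and dd: "\<And>x y. x \<in> cball 0 1 \<Longrightarrow> y \<in> cball 0 1 \<Longrightarrow> dist y x < d \<Longrightarrow>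
          dist ((G y + e *\<^sub>R y) \<bullet> y) ((G x + e *\<^sub>R x) \<bullet> x) < e"
        unfolding uniformly_continuous_on_def using e by metis
      show ?thesis
      proof (intro exI[of _ "min d 1"] conjI ballI impI)
        fix x :: 'a assume x: "x \<in> ball 0 1" "1 - min d 1 < norm x"
        then have nx: "norm x > 0" "norm x < 1" "1 - norm x < d" by auto
        define y where "y = (1 / norm x) *\<^sub>R x"
        have ny: "norm y = 1" using nx by (simp add: y_def)
        have "y - x = (1 / norm x - 1) *\<^sub>R x" by (simp add: y_def algebra_simps)
        then have "dist y x = \<bar>1 / norm x - 1\<bar> * norm x" by (simp add: dist_norm)
        also have "\<dots> = 1 - norm x" using nx by (simp add: abs_if field_simps)
        finally have "dist y x < d" using nx by simp
        then have "dist ((G y + e *\<^sub>R y) \<bullet> y) ((G x + e *\<^sub>R x) \<bullet> x) < e"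
          using dd x ny by simp
        moreover have "(G y + e *\<^sub>R y) \<bullet> y \<ge> e"
          using pos[of y] ny by (simp add: inner_add_left dot_square_norm)
        ultimately show "0 \<le> (X x + e *\<^sub>R x) \<bullet> x"
          using GX[OF x(1)] by (simp add: dist_real_def)
      qed (use d in auto)
    qed
    then obtain d where d: "d > 0" and near: "\<And>x. x \<in> ball 0 1 \<Longrightarrow> 1 - d < norm x \<Longrightarrow> 0 \<le> (X x + e *\<^sub>R x) \<bullet> x"
      by blast
    \<comment> \<open>The cutoff is 0 for 1 - s <= 1/j, so that it vanishes before the sphere is
      reached, and 1 for 1 - s >= 2/j.\<close>
    define \<phi> where "\<phi> j s = step (real j * (1 - s) - 1)" for j s
    have m\<phi>: "(\<lambda>x::'a. \<phi> j (x \<bullet> x)) \<in> borel_measurable lborel" for j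
    proof -
      have "continuous_on UNIV step" by (intro continuous_at_imp_continuous_on ballI DERIV_continuous[OF DERIV_step])
      then have "continuous_on UNIV (\<lambda>x::'a. \<phi> j (x \<bullet> x))" unfolding \<phi>_def
        by (rule continuous_on_compose2) (auto intro!: continuous_intros)
      then show ?thesis using borel_measurable_continuous_onI by simp
    qed
    have ev: "\<forall>\<^sub>F j in sequentially. 0 \<le> integral\<^sup>L lborel (\<lambda>x. indicator (ball 0 1) x * (\<phi> j (x \<bullet> x) * D x))"
    proof -
      \<comment> \<open>With 2/j < d the cutoff varies only in the collar in which the perturbed
        field points outwards.\<close>
      obtain j0 :: nat where j0: "real j0 > 2 / d" "j0 > 0" using reals_Archimedean2[of "max (2 / d) 0"] by (metis max_less_iff_conj of_nat_0_less_iff)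
      show ?thesis
      proof (rule eventually_sequentiallyI[of j0])
        fix j assume "j0 \<le> j"
        then have j: "real j > 2 / d" "j > 0" using j0 by (simp_all add: less_le_trans)
        define \<phi>' where "\<phi>' s = step' (real j * (1 - s) - 1) * (- real j)" for s
        have *: "(\<phi> j has_field_derivative \<phi>' s) (at s)" for s
          unfolding \<phi>_def \<phi>'_def by (rule DERIV_chain2[OF DERIV_step]) (auto intro!: derivative_eq_intros)
        have **: "continuous_on UNIV \<phi>'" unfolding \<phi>'_def
          by (intro continuous_intros continuous_on_compose2[OF continuous_step'[of UNIV]]) auto
        have z: "real j * (1 - s) - 1 \<le> 0" if "s \<ge> 1 - 1 / real j" for s
          using that j by (simp add: field_simps)
        have p1: "((\<lambda>x. X x + e *\<^sub>R x) has_derivative (\<lambda>v. X' x v + e *\<^sub>R v)) (at x)" if "x \<in> ball 0 1" for x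
          using that by (auto intro!: derivative_eq_intros dX)
        have p2: "continuous_on (ball 0 1) (\<lambda>x. X' x b + e *\<^sub>R b)" if "b \<in> Basis" for b
          using that by (intro continuous_intros cX)
        have p3: "1 - 1 / real j < 1" using j by simp
        have p4: "\<phi> j s = 0" and p5: "\<phi>' s = 0" if "s \<ge> 1 - 1 / real j" for s
          using z[OF that] by (simp_all add: \<phi>_def \<phi>'_def step_eq_0 step'_eq_0)
        define Y where "Y = (\<lambda>x. indicator (ball 0 1) x * (\<phi> j (x \<bullet> x) * D x + 2 * \<phi>' (x \<bullet> x) * ((X x + e *\<^sub>R x) \<bullet> x)))"
        have Y: "integrable lborel Y" "integral\<^sup>L lborel Y = 0"
          unfolding Y_def D_def using integral_cutoff_divergence[OF p1 p2 * ** p3 p4 p5] by blast+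
        have "integrable lborel (\<lambda>x. indicator (ball 0 1) x *\<^sub>R D x)"
          using Dint by (simp add: set_integrable_def)
        then have "integrable lborel (\<lambda>x. \<phi> j (x \<bullet> x) * (indicator (ball 0 1) x * D x))"
        proof (rule Bochner_Integration.integrable_bound)
          show "(\<lambda>x. \<phi> j (x \<bullet> x) * (indicator (ball 0 1) x * D x)) \<in> borel_measurable lborel"
            using borel_measurable_times[OF m\<phi> borel_measurable_integrable[OF Dint[unfolded set_integrable_def]]]
            by simp
        qed (auto simp: \<phi>_def abs_mult step_bounds intro!: mult_left_le_one_le)
        then have I: "integrable lborel (\<lambda>x. indicator (ball 0 1) x * (\<phi> j (x \<bullet> x) * D x))"
          by (simp add: mult_ac)
        \<comment> \<open>\<open>Y\<close> has integral 0 and exceeds the right side only by the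
          term with the derivative of the cutoff, which is nonpositive.\<close>
        have le: "Y x \<le> indicator (ball 0 1) x * (\<phi> j (x \<bullet> x) * D x)" for x
        proof (cases "x \<in> ball 0 1")
          case True
          have "\<phi>' (x \<bullet> x) * ((X x + e *\<^sub>R x) \<bullet> x) \<le> 0"
          proof (cases "1 - d < norm x")
            case True
            then show ?thesis using near \<open>x \<in> ball 0 1\<close> step'_nonneg
              by (intro mult_nonpos_nonneg) (auto simp: \<phi>'_def)
          next
            case False
            have "norm x < 1" using \<open>x \<in> ball 0 1\<close> by simp
            then have "x \<bullet> x \<le> norm x" by (simp add: dot_square_norm power2_eq_square mult_left_le_one_le)
            then have "1 - x \<bullet> x \<ge> d" using False by simp
            then have "real j * (1 - x \<bullet> x) \<ge> real j * d" by (intro mult_left_mono) auto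
            moreover have "real j * d > 2" using j d by (simp add: field_simps)
            ultimately have "\<phi>' (x \<bullet> x) = 0" by (simp add: \<phi>'_def step'_eq_0_right)
            then show ?thesis by simp
          qed
          then show ?thesis using True by (simp add: Y_def)
        qed (simp add: Y_def)
        show "0 \<le> integral\<^sup>L lborel (\<lambda>x. indicator (ball 0 1) x * (\<phi> j (x \<bullet> x) * D x))"
          using integral_mono[OF Y(1) I le] Y(2) by simp
      qed
    qed
    have "(\<lambda>j. integral\<^sup>L lborel (\<lambda>x. indicator (ball 0 1) x * (\<phi> j (x \<bullet> x) * D x)))
      \<longlonglongrightarrow> integral\<^sup>L lborel (\<lambda>x. indicator (ball 0 1) x * D x)"
    proof (rule integral_dominated_convergence[where w = "\<lambda>x. norm (indicator (ball 0 1) x * D x)"])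
      have i: "integrable lborel (\<lambda>x. indicator (ball 0 1) x * D x)"
        using Dint by (simp add: set_integrable_def)
      then show "integrable lborel (\<lambda>x. norm (indicator (ball 0 1) x * D x))" by (rule integrable_norm)
      show m: "(\<lambda>x. indicator (ball 0 1) x * D x) \<in> borel_measurable lborel"
        using i by (rule borel_measurable_integrable)
      fix j
      from borel_measurable_times[OF m\<phi>[of j] m]
      show "(\<lambda>x. indicator (ball 0 1) x * (\<phi> j (x \<bullet> x) * D x)) \<in> borel_measurable lborel"
        by (simp add: mult_ac)
      show "AE x in lborel. norm (indicator (ball 0 1) x * (\<phi> j (x \<bullet> x) * D x)) \<le> norm (indicator (ball 0 1) x * D x)"
        by (auto simp: \<phi>_def abs_mult step_bounds split: split_indicator intro!: mult_left_le_one_le)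
    next
      show "AE x in lborel. (\<lambda>j. indicator (ball 0 1) x * (\<phi> j (x \<bullet> x) * D x)) \<longlonglongrightarrow> indicator (ball 0 1) x * D x"
      proof (rule AE_I2)
        fix x :: 'a
        show "(\<lambda>j. indicator (ball 0 1) x * (\<phi> j (x \<bullet> x) * D x)) \<longlonglongrightarrow> indicator (ball 0 1) x * D x"
        proof (cases "x \<in> ball 0 1")
          case True
          then have p: "1 - x \<bullet> x > 0" by (simp add: dot_square_norm abs_square_less_1)
          obtain j0 :: nat where j0: "real j0 > 2 / (1 - x \<bullet> x)" using reals_Archimedean2 by blast
          have "\<phi> j (x \<bullet> x) = 1" if "j0 \<le> j" for j
          proof -
            have "real j > 2 / (1 - x \<bullet> x)" using j0 that by simp
            then have "real j * (1 - x \<bullet> x) > 2" using p by (simp add: field_simps)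
            then show ?thesis by (simp add: \<phi>_def step_eq_1)
          qed
          then have "\<forall>\<^sub>F j in sequentially. indicator (ball 0 1) x * D x = indicator (ball 0 1) x * (\<phi> j (x \<bullet> x) * D x)"
            by (intro eventually_sequentiallyI[of j0]) simp
          then show ?thesis by (rule tendsto_eventually[OF eventually_mono]) simp
        qed simp
      qed
    qed
    then have "0 \<le> integral\<^sup>L lborel (\<lambda>x. indicator (ball 0 1) x * D x)"
      using ev tendsto_lowerbound trivial_limit_sequentially by blast
    then show ?thesis using Dval by (simp add: set_lebesgue_integral_def)
  qed
  show ?thesis
  proof (rule ccontr)
    assume "\<not> ?thesis"
    then have neg: "(LINT x:ball 0 1|lborel. ?D x) < 0" by simp
    have N: "?N > 0" using content_ball_pos[of 1 "0::'a"] by simp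
    \<comment> \<open>This e is half the value at which the correction would cancel the supposedly
      negative integral, so a negative number is left.\<close>
    have "0 \<le> (LINT x:ball 0 1|lborel. ?D x) + (- (LINT x:ball 0 1|lborel. ?D x) / (2 * ?N)) * ?N"
      by (rule *) (use neg N in \<open>simp add: divide_neg_pos\<close>)
    also have "(- (LINT x:ball 0 1|lborel. ?D x) / (2 * ?N)) * ?N = - (LINT x:ball 0 1|lborel. ?D x) / 2"
      using N by (metis (no_types, lifting) less_irrefl mult.commute nonzero_mult_divide_mult_cancel_right times_divide_eq_left)
    finally show False using neg by simp
  qed
qed

section \<open>Functions of class \<open>C\<^sup>k\<close>\<close>

text \<open>The mean value theorem is applied in direction \<open>v\<close> to the increment of
  \<open>f\<close> by h w, then in direction \<open>w\<close> to the derivative along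
  \<open>v\<close>.\<close>

lemma second_difference_mvt:
  fixes f :: "'a::real_normed_vector \<Rightarrow> real"
  assumes h: "h > 0"
    and f: "\<And>y. y \<in> B \<Longrightarrow> (f has_derivative f' y) (at y)"
    and p: "\<And>y. y \<in> B \<Longrightarrow> ((\<lambda>y. f' y v) has_derivative p' y) (at y)"
    and B: "\<And>s t. 0 \<le> s \<Longrightarrow> s \<le> h \<Longrightarrow> 0 \<le> t \<Longrightarrow> t \<le> h \<Longrightarrow> x + s *\<^sub>R v + t *\<^sub>R w \<in> B"
  obtains s t where "0 < s" "s < h" "0 < t" "t < h"
    "f (x + h *\<^sub>R v + h *\<^sub>R w) - f (x + h *\<^sub>R v) - f (x + h *\<^sub>R w) + f x = h * (h * p' (x + s *\<^sub>R v + t *\<^sub>R w) w)"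
proof -
  define \<phi> where "\<phi> y = f (y + h *\<^sub>R w) - f y" for y
  have 1: "(\<phi> has_derivative (\<lambda>u. f' (x + s *\<^sub>R v + h *\<^sub>R w) u - f' (x + s *\<^sub>R v) u)) (at (x + s *\<^sub>R v))"
    if "0 \<le> s" "s \<le> h" for s
  proof -
    have "((\<lambda>y. f (y + h *\<^sub>R w)) has_derivative f' (x + s *\<^sub>R v + h *\<^sub>R w)) (at (x + s *\<^sub>R v))"
      by (rule has_derivative_compose[of "\<lambda>y. y + h *\<^sub>R w" "\<lambda>u. u" _ UNIV f, simplified])
         (use f[OF B[of s h]] that h in \<open>auto intro!: derivative_eq_intros\<close>)
    moreover have "(f has_derivative f' (x + s *\<^sub>R v)) (at (x + s *\<^sub>R v))"
      using f[OF B[of s 0]] that h by simp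
    ultimately show ?thesis unfolding \<phi>_def by (rule has_derivative_diff)
  qed
  obtain s where s: "0 < s" "s < h"
    and "\<phi> (x + h *\<^sub>R v) - \<phi> x = h * (f' (x + s *\<^sub>R v + h *\<^sub>R w) v - f' (x + s *\<^sub>R v) v)"
    by (rule directional_mvt[OF h, of \<phi> "\<lambda>y u. f' (y + h *\<^sub>R w) u - f' y u" x v]) (use 1 in auto)
  moreover obtain t where t: "0 < t" "t < h"
    and "f' (x + s *\<^sub>R v + h *\<^sub>R w) v - f' (x + s *\<^sub>R v) v = h * p' (x + s *\<^sub>R v + t *\<^sub>R w) w"
    by (rule directional_mvt[OF h, of "\<lambda>y. f' y v" p' "x + s *\<^sub>R v" w]) (use p[OF B] s in auto)
  ultimately show ?thesis using that[OF s t] by (simp add: \<phi>_def algebra_simps)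
qed

text \<open>The second difference over a small parallelogram is symmetric in \<open>v\<close> and
  \<open>w\<close>; evaluated in the two orders it is h^2 times either mixed derivative at a nearby
  point.\<close>

lemma symmetric_second_derivative:
  fixes f :: "'a::real_normed_vector \<Rightarrow> real"
  assumes S: "open S" "x \<in> S"
    and f: "\<And>y. y \<in> S \<Longrightarrow> (f has_derivative f' y) (at y)"
    and p: "\<And>y. y \<in> S \<Longrightarrow> ((\<lambda>y. f' y v) has_derivative p' y) (at y)"
    and q: "\<And>y. y \<in> S \<Longrightarrow> ((\<lambda>y. f' y w) has_derivative q' y) (at y)"
    and cp: "continuous_on S (\<lambda>y. p' y w)" and cq: "continuous_on S (\<lambda>y. q' y v)"
  shows "p' x w = q' x v"
proof (rule ccontr)
  assume "p' x w \<noteq> q' x v"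
  \<comment> \<open>Half the supposed gap. The two mixed derivatives at the intermediate points
    coincide, and each lies within e of its value at \<open>x\<close>, so the gap would be less than
    2 e.\<close>
  define e where "e = \<bar>p' x w - q' x v\<bar> / 2"
  have e: "e > 0" using \<open>p' x w \<noteq> q' x v\<close> by (simp add: e_def)
  obtain d0 where d0: "d0 > 0" "ball x d0 \<subseteq> S" using S openE by blast
  obtain d1 where d1: "d1 > 0" "\<And>y. y \<in> S \<Longrightarrow> dist y x < d1 \<Longrightarrow> dist (p' y w) (p' x w) < e"
    using cp S(2) e unfolding continuous_on_iff by meson
  obtain d2 where d2: "d2 > 0" "\<And>y. y \<in> S \<Longrightarrow> dist y x < d2 \<Longrightarrow> dist (q' y v) (q' x v) < e"
    using cq S(2) e unfolding continuous_on_iff by meson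
  define d where "d = min d0 (min d1 d2)"
  define h where "h = d / (norm v + norm w + 1)"
  have pos: "norm v + norm w + 1 > 0" by (simp add: add_nonneg_pos)
  have d: "d > 0" using d0 d1 d2 by (simp add: d_def)
  have h: "h > 0" using d pos by (simp add: h_def)
  have near: "dist (x + s *\<^sub>R v + t *\<^sub>R w) x < d" if "0 \<le> s" "s \<le> h" "0 \<le> t" "t \<le> h" for s t
  proof -
    have "dist (x + s *\<^sub>R v + t *\<^sub>R w) x \<le> s * norm v + t * norm w"
      using norm_triangle_ineq[of "s *\<^sub>R v" "t *\<^sub>R w"] that by (simp add: dist_norm)
    also have "\<dots> \<le> h * norm v + h * norm w" using that by (intro add_mono mult_right_mono) auto
    also have "\<dots> < h * (norm v + norm w + 1)" using h by (simp add: algebra_simps)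
    also have "\<dots> = d" using pos by (simp add: h_def)
    finally show ?thesis .
  qed
  have inB: "x + s *\<^sub>R v + t *\<^sub>R w \<in> S" if "0 \<le> s" "s \<le> h" "0 \<le> t" "t \<le> h" for s t
    using near[OF that] d0 by (auto simp: d_def dist_commute)
  have inB': "x + s *\<^sub>R w + t *\<^sub>R v \<in> S" if "0 \<le> s" "s \<le> h" "0 \<le> t" "t \<le> h" for s t
    using inB[of t s] that by (simp add: algebra_simps)
  obtain s t where st: "0 < s" "s < h" "0 < t" "t < h"
    "f (x + h *\<^sub>R v + h *\<^sub>R w) - f (x + h *\<^sub>R v) - f (x + h *\<^sub>R w) + f x = h * (h * p' (x + s *\<^sub>R v + t *\<^sub>R w) w)"
    by (rule second_difference_mvt[OF h f p inB])
  obtain s' t' where st': "0 < s'" "s' < h" "0 < t'" "t' < h"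
    "f (x + h *\<^sub>R w + h *\<^sub>R v) - f (x + h *\<^sub>R w) - f (x + h *\<^sub>R v) + f x = h * (h * q' (x + s' *\<^sub>R w + t' *\<^sub>R v) v)"
    by (rule second_difference_mvt[OF h f q inB'])
  have "h * (h * p' (x + s *\<^sub>R v + t *\<^sub>R w) w) = h * (h * q' (x + s' *\<^sub>R w + t' *\<^sub>R v) v)"
    using st(5) st'(5) by (simp add: algebra_simps)
  then have eq: "p' (x + s *\<^sub>R v + t *\<^sub>R w) w = q' (x + t' *\<^sub>R v + s' *\<^sub>R w) v" using h by (simp add: algebra_simps)
  have "dist (p' (x + s *\<^sub>R v + t *\<^sub>R w) w) (p' x w) < e"
    by (rule d1(2)[OF inB]) (use st near[of s t] in \<open>auto simp: d_def\<close>)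
  moreover have "dist (q' (x + t' *\<^sub>R v + s' *\<^sub>R w) v) (q' x v) < e"
    by (rule d2(2)[OF inB]) (use st' near[of t' s'] in \<open>auto simp: d_def\<close>)
  ultimately show False using eq unfolding e_def dist_real_def by argo
qed

text \<open>\<open>Ck_on\<close> for functions with values in an arbitrary normed space.\<close>

primrec CC :: "nat \<Rightarrow> 'a::euclidean_space set \<Rightarrow> ('a \<Rightarrow> 'b::real_normed_vector) \<Rightarrow> bool" where
  "CC 0 S f \<longleftrightarrow> continuous_on S f"
| "CC (Suc k) S f \<longleftrightarrow> (\<forall>x\<in>S. f differentiable (at x)) \<and> (\<forall>v. CC k S (\<lambda>x. frechet_derivative f (at x) v))"

lemma Ck_on_iff_CC: "Ck_on k S f \<longleftrightarrow> CC k S f"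
  by (induction k arbitrary: f) auto

lemma CC_cong:
  assumes "open S" "\<And>x. x \<in> S \<Longrightarrow> f x = g x" "CC k S f"
  shows "CC k S g"
  using assms(2,3)
proof (induction k arbitrary: f g)
  case 0
  then show ?case by (simp cong: continuous_on_cong)
next
  case (Suc k)
  have d: "(g has_derivative frechet_derivative f (at x)) (at x)" if "x \<in> S" for x
    by (rule has_derivative_transform_within_open[OF _ assms(1) that Suc.prems(1)])
       (use Suc.prems that in \<open>auto simp: frechet_derivative_works\<close>)
  have eq: "frechet_derivative f (at x) = frechet_derivative g (at x)" if "x \<in> S" for x
    by (rule frechet_derivative_at[OF d[OF that]])
  show ?case unfolding CC.simps
  proof (intro conjI ballI allI)
    show "g differentiable (at x)" if "x \<in> S" for x using d[OF that] by (rule differentiableI)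
    show "CC k S (\<lambda>x. frechet_derivative g (at x) v)" for v
      by (rule Suc.IH[of "\<lambda>x. frechet_derivative f (at x) v"]) (use eq Suc.prems in auto)
  qed
qed

lemma CC_SucI:
  assumes "open S" "\<And>x. x \<in> S \<Longrightarrow> (f has_derivative f' x) (at x)" "\<And>v. CC k S (\<lambda>x. f' x v)"
  shows "CC (Suc k) S f"
proof -
  have "frechet_derivative f (at x) = f' x" if "x \<in> S" for x
    using frechet_derivative_at[OF assms(2)[OF that]] by simp
  then have "CC k S (\<lambda>x. frechet_derivative f (at x) v)" for v
    by (intro CC_cong[OF assms(1) _ assms(3)]) auto
  then show ?thesis using assms(2) unfolding CC.simps by (blast intro: differentiableI)
qed

lemma CC_SucD:
  assumes "CC (Suc k) S f"
  shows "\<And>x. x \<in> S \<Longrightarrow> (f has_derivative frechet_derivative f (at x)) (at x)"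
    "\<And>v. CC k S (\<lambda>x. frechet_derivative f (at x) v)"
  using assms by (auto simp: frechet_derivative_works)

lemma CC_continuous: "CC k S f \<Longrightarrow> continuous_on S f"
  by (cases k) (simp_all add: continuous_at_imp_continuous_on differentiable_imp_continuous_within)

lemma CC_Suc_imp: "CC (Suc k) S f \<Longrightarrow> CC k S f"
proof (induction k arbitrary: f)
  case 0
  then show ?case unfolding CC.simps(1) by (rule CC_continuous)
next
  case (Suc k)
  show ?case unfolding CC.simps(2)[of k]
    using Suc.prems[unfolded CC.simps(2)[of "Suc k"]] Suc.IH by blast
qed

lemma CC_mono: "CC k S f \<Longrightarrow> j \<le> k \<Longrightarrow> CC j S f"
  by (induction k) (auto simp: le_Suc_eq dest: CC_Suc_imp simp del: CC.simps)

lemma CC_subset: "CC k S f \<Longrightarrow> T \<subseteq> S \<Longrightarrow> CC k T f"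
  by (induction k arbitrary: f) (auto intro: continuous_on_subset)

lemma CC_const: "open S \<Longrightarrow> CC k S (\<lambda>x. c)"
  by (induction k arbitrary: c) (auto simp: continuous_intros)

lemma CC_bounded_linear:
  assumes "open S" "bounded_linear L"
  shows "CC k S L"
proof (cases k)
  case 0
  then show ?thesis using assms(2) by (simp add: linear_continuous_on)
next
  case (Suc j)
  show ?thesis unfolding Suc
    by (rule CC_SucI[OF assms(1) bounded_linear.has_derivative[OF assms(2) has_derivative_ident]])
       (rule CC_const[OF assms(1)])
qed

lemma CC_compose_linear:
  assumes "open S" "bounded_linear L" "CC k S f"
  shows "CC k S (\<lambda>x. L (f x))"
  using assms(3)
proof (induction k arbitrary: f)
  case 0
  then show ?case using assms(2) by (simp add: bounded_linear.continuous_on)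
next
  case (Suc k)
  show ?case
    by (rule CC_SucI[OF assms(1) bounded_linear.has_derivative[OF assms(2) CC_SucD(1)[OF Suc.prems]]])
       (assumption | intro Suc.IH CC_SucD(2)[OF Suc.prems])+
qed

lemma CC_add:
  assumes "open S" "CC k S f" "CC k S g"
  shows "CC k S (\<lambda>x. f x + g x)"
  using assms(2,3)
proof (induction k arbitrary: f g)
  case 0
  then show ?case by (auto intro: continuous_intros)
next
  case (Suc k)
  show ?case
    by (rule CC_SucI[OF assms(1) has_derivative_add[OF CC_SucD(1)[OF Suc.prems(1)] CC_SucD(1)[OF Suc.prems(2)]]])
       (assumption | intro Suc.IH CC_SucD(2) Suc.prems)+
qed

lemma CC_mult:
  fixes f g :: "'a::euclidean_space \<Rightarrow> 'b::real_normed_algebra"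
  assumes "open S" "CC k S f" "CC k S g"
  shows "CC k S (\<lambda>x. f x * g x)"
  using assms(2,3)
proof (induction k arbitrary: f g)
  case 0
  then show ?case by (auto intro: continuous_intros)
next
  case (Suc k)
  show ?case
    by (rule CC_SucI[OF assms(1) has_derivative_mult[OF CC_SucD(1)[OF Suc.prems(1)] CC_SucD(1)[OF Suc.prems(2)]]])
       (assumption | intro CC_add assms(1) Suc.IH CC_SucD(2)[OF Suc.prems(1)] CC_SucD(2)[OF Suc.prems(2)] CC_Suc_imp[OF Suc.prems(1)] CC_Suc_imp[OF Suc.prems(2)])+
qed

lemma CC_cmult:
  fixes f :: "'a::euclidean_space \<Rightarrow> 'b::real_normed_algebra"
  shows "open S \<Longrightarrow> CC k S f \<Longrightarrow> CC k S (\<lambda>x. c * f x)"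
  by (intro CC_mult CC_const)

lemma CC_sum: "open S \<Longrightarrow> (\<And>i. i \<in> I \<Longrightarrow> CC k S (f i)) \<Longrightarrow> CC k S (\<lambda>x. \<Sum>i\<in>I. f i x)"
  by (induction I rule: infinite_finite_induct) (auto intro!: CC_const CC_add)

lemma CC_prod:
  fixes f :: "'i \<Rightarrow> 'a::euclidean_space \<Rightarrow> 'b::real_normed_field"
  shows "open S \<Longrightarrow> (\<And>i. i \<in> I \<Longrightarrow> CC k S (f i)) \<Longrightarrow> CC k S (\<lambda>x. \<Prod>i\<in>I. f i x)"
  by (induction I rule: infinite_finite_induct) (auto intro!: CC_const CC_mult)

lemma CC_inverse:
  fixes f :: "'a::euclidean_space \<Rightarrow> 'b::real_normed_field"
  assumes "open S" "CC k S f" "\<And>x. x \<in> S \<Longrightarrow> f x \<noteq> 0"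
  shows "CC k S (\<lambda>x. inverse (f x))"
  using assms(2)
proof (induction k)
  case 0
  then show ?case using assms(3) by (auto intro: continuous_intros)
next
  case (Suc k)
  have d: "((\<lambda>x. inverse (f x)) has_derivative (\<lambda>v. (-1) * (inverse (f x) * frechet_derivative f (at x) v * inverse (f x)))) (at x)"
    if "x \<in> S" for x
    using Deriv.has_derivative_inverse[OF assms(3)[OF that] CC_SucD(1)[OF Suc.prems that]] by simp
  show ?case
    by (rule CC_SucI[OF assms(1) d])
       (assumption | intro CC_cmult CC_mult assms(1) Suc.IH CC_SucD(2)[OF Suc.prems] CC_Suc_imp[OF Suc.prems])+
qed

lemma CC_exp:
  fixes f :: "'a::euclidean_space \<Rightarrow> real"
  assumes "open S" "CC k S f"
  shows "CC k S (\<lambda>x. exp (f x))"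
  using assms(2)
proof (induction k)
  case 0
  then show ?case by (auto intro: continuous_intros)
next
  case (Suc k)
  have d: "((\<lambda>x. exp (f x)) has_derivative (\<lambda>v. exp (f x) * frechet_derivative f (at x) v)) (at x)" if "x \<in> S" for x
    using CC_SucD(1)[OF Suc.prems that] by (auto intro!: derivative_eq_intros)
  show ?case
    by (rule CC_SucI[OF assms(1) d])
       (assumption | intro CC_mult assms(1) Suc.IH CC_SucD(2)[OF Suc.prems] CC_Suc_imp[OF Suc.prems])+
qed

lemma CC_symmetric_real:
  fixes f :: "'a::euclidean_space \<Rightarrow> real"
  assumes "open S" "CC (Suc (Suc 0)) S f" "x \<in> S"
  shows "frechet_derivative (\<lambda>y. frechet_derivative f (at y) v) (at x) w
       = frechet_derivative (\<lambda>y. frechet_derivative f (at y) w) (at x) v"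
  by (rule symmetric_second_derivative[OF assms(1,3)])
     (use CC_SucD[OF assms(2)] CC_SucD[OF CC_SucD(2)[OF assms(2)]] in \<open>auto simp del: CC.simps simp: CC.simps(1)\<close>)

text \<open>A function that is \<open>C\<^sup>1\<close> up to the sphere is differentiable within the closed ball at the points
  of the sphere, because the open segments from there to points of the closed ball are in the ball.\<close>

lemma has_derivative_within_cball:
  fixes g :: "'a::euclidean_space \<Rightarrow> real"
  assumes cg: "continuous_on (cball 0 1) g"
    and dg: "\<And>y. y \<in> ball 0 1 \<Longrightarrow> (g has_derivative (\<lambda>v. G y \<bullet> v)) (at y)"
    and cG: "continuous_on (cball 0 1) G" and x: "x \<in> cball 0 1"
  shows "(g has_derivative (\<lambda>v. G x \<bullet> v)) (at x within cball 0 1)"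
  unfolding has_derivative_within_alt
proof (intro conjI allI impI)
  show "bounded_linear (\<lambda>v. G x \<bullet> v)" by (rule bounded_linear_inner_right)
next
  fix e :: real assume e: "0 < e"
  obtain d where d: "d > 0" and dd: "\<And>y. y \<in> cball 0 1 \<Longrightarrow> dist y x < d \<Longrightarrow> dist (G y) (G x) < e"
    using cG x e unfolding continuous_on_iff by meson
  show "\<exists>d>0. \<forall>y\<in>cball 0 1. norm (y - x) < d \<longrightarrow> norm (g y - g x - G x \<bullet> (y - x)) \<le> e * norm (y - x)"
  proof (intro exI[of _ d] conjI d ballI impI)
    fix y assume y: "y \<in> cball 0 1" "norm (y - x) < d"
    show "norm (g y - g x - G x \<bullet> (y - x)) \<le> e * norm (y - x)"
    proof (cases "y = x")
      case False
      have seg: "x + t *\<^sub>R (y - x) \<in> ball 0 1" if "0 < t" "t < 1" for t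
      proof -
        have "x + t *\<^sub>R (y - x) \<in> open_segment x y"
          unfolding in_segment using that False by (auto intro!: exI[of _ t] simp: algebra_simps)
        then show ?thesis using dist_decreases_open_segment[of "x + t *\<^sub>R (y - x)" x y 0] x y by (auto simp: dist_commute)
      qed
      have cseg: "x + t *\<^sub>R (y - x) \<in> cball 0 1" if "0 \<le> t" "t \<le> 1" for t
        using convexD_alt[OF convex_cball x y(1) that] by (simp add: algebra_simps)
      have "continuous_on {0..1} (\<lambda>t. g (x + t *\<^sub>R (y - x)))"
        by (rule continuous_on_compose2[OF cg]) (auto intro!: continuous_intros cseg)
      moreover have "((\<lambda>t. g (x + t *\<^sub>R (y - x))) has_derivative (\<lambda>s. G (x + t *\<^sub>R (y - x)) \<bullet> (s *\<^sub>R (y - x)))) (at t)"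
        if "0 < t" "t < 1" for t
        by (rule has_derivative_compose[of "\<lambda>t. x + t *\<^sub>R (y - x)" "\<lambda>s. s *\<^sub>R (y - x)" t UNIV g])
           (auto intro!: derivative_eq_intros dg seg that)
      ultimately obtain t where t: "0 < t" "t < 1"
        and eq: "g (x + 1 *\<^sub>R (y - x)) - g (x + 0 *\<^sub>R (y - x)) = G (x + t *\<^sub>R (y - x)) \<bullet> ((1 - 0) *\<^sub>R (y - x))"
        using mvt[of 0 1 "\<lambda>t. g (x + t *\<^sub>R (y - x))" "\<lambda>t s. G (x + t *\<^sub>R (y - x)) \<bullet> (s *\<^sub>R (y - x))"] by auto
      have eq: "g y - g x = G (x + t *\<^sub>R (y - x)) \<bullet> (y - x)" using eq by simp
      have "dist (x + t *\<^sub>R (y - x)) x < d" using t y(2)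
        by (simp add: dist_norm) (smt (verit) mult_left_le_one_le norm_ge_zero)
      then have "norm (G (x + t *\<^sub>R (y - x)) - G x) < e"
        using dd[OF cseg[of t]] t unfolding dist_norm by simp
      moreover have "g y - g x - G x \<bullet> (y - x) = (G (x + t *\<^sub>R (y - x)) - G x) \<bullet> (y - x)" by (simp add: eq inner_diff_left)
      moreover have "norm ((G (x + t *\<^sub>R (y - x)) - G x) \<bullet> (y - x)) \<le> norm (G (x + t *\<^sub>R (y - x)) - G x) * norm (y - x)"
        by (simp add: Cauchy_Schwarz_ineq2)
      ultimately show ?thesis by (smt (verit) mult_right_mono norm_ge_zero)
    qed simp
  qed
qed

text \<open>A tangential part of the gradient would be seen along the great circle through
  \<open>x\<close> in its direction, on which \<open>g\<close> is 0. The circle stays in the closed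
  ball, so the chain rule can use the derivative within the ball from
  \<open>has_derivative_within_cball\<close>.\<close>

lemma boundary_gradient:
  fixes g :: "'a::euclidean_space \<Rightarrow> real"
  assumes cg: "continuous_on (cball 0 1) g"
    and dg: "\<And>y. y \<in> ball 0 1 \<Longrightarrow> (g has_derivative (\<lambda>v. G y \<bullet> v)) (at y)"
    and cG: "continuous_on (cball 0 1) G" and g0: "\<And>y. y \<in> sphere 0 1 \<Longrightarrow> g y = 0" and x: "x \<in> sphere 0 1"
  shows "G x = (G x \<bullet> x) *\<^sub>R x"
proof -
  have xx: "x \<bullet> x = 1" using x by (simp add: dot_square_norm)
  define v where "v = G x - (G x \<bullet> x) *\<^sub>R x"
  have vx: "v \<bullet> x = 0" by (simp add: v_def inner_diff_left xx)
  have D: "(g has_derivative (\<lambda>v. G x \<bullet> v)) (at x within cball 0 1)"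
    by (rule has_derivative_within_cball[OF cg dg cG]) (use x in auto)
  have "v = 0"
  proof (rule ccontr)
    assume "v \<noteq> 0"
    define w where "w = (1 / norm v) *\<^sub>R v"
    have ww: "w \<bullet> w = 1" "x \<bullet> w = 0" using \<open>v \<noteq> 0\<close> vx by (simp_all add: w_def inner_commute power2_eq_square flip: power2_norm_eq_inner)
    define \<gamma> where "\<gamma> s = cos s *\<^sub>R x + sin s *\<^sub>R w" for s
    have sph: "\<gamma> s \<in> sphere 0 1" for s
    proof -
      have "\<gamma> s \<bullet> \<gamma> s = (cos s)\<^sup>2 + (sin s)\<^sup>2"
        using ww xx by (simp add: \<gamma>_def inner_add_left inner_add_right power2_eq_square inner_commute[of w x])
      then show ?thesis by (simp add: norm_eq_sqrt_inner)
    qed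
    have d\<gamma>: "(\<gamma> has_derivative (\<lambda>s. s *\<^sub>R w)) (at 0)"
      unfolding \<gamma>_def by (auto intro!: derivative_eq_intros)
    have "\<gamma> 0 = x" by (simp add: \<gamma>_def)
    have "((\<lambda>s. g (\<gamma> s)) has_derivative (\<lambda>s. G (\<gamma> 0) \<bullet> (s *\<^sub>R w))) (at 0)"
    proof (rule has_derivative_in_compose2[of "cball 0 1" g "\<lambda>y v. G y \<bullet> v" \<gamma> UNIV 0])
      show "(g has_derivative (\<lambda>v. G y \<bullet> v)) (at y within cball 0 1)" if "y \<in> cball 0 1" for y
        using has_derivative_within_cball[OF cg dg cG that] .
      show "\<gamma> ` UNIV \<subseteq> cball 0 1" using sph by (auto simp: less_imp_le)
    qed (use d\<gamma> in auto)
    then have "((\<lambda>s. g (\<gamma> s)) has_derivative (\<lambda>s. G x \<bullet> (s *\<^sub>R w))) (at 0)"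
      unfolding \<open>\<gamma> 0 = x\<close> .
    moreover have "((\<lambda>s. g (\<gamma> s)) has_derivative (\<lambda>s. 0)) (at 0)" using g0[OF sph] by simp
    ultimately have "(\<lambda>s. G x \<bullet> (s *\<^sub>R w)) = (\<lambda>s. 0)" by (rule has_derivative_unique)
    from fun_cong[OF this, of 1] have "G x \<bullet> w = 0" by simp
    then have "G x \<bullet> v = 0" using \<open>v \<noteq> 0\<close> by (simp add: w_def)
    then have "v \<bullet> v = 0" using vx by (simp add: v_def inner_diff_right inner_commute)
    then show False using \<open>v \<noteq> 0\<close> by simp
  qed
  then show ?thesis by (simp add: v_def)
qed

lemma boundary_gradient_nonneg:
  fixes g :: "'a::euclidean_space \<Rightarrow> real"
  assumes cg: "continuous_on (cball 0 1) g"
    and dg: "\<And>y. y \<in> ball 0 1 \<Longrightarrow> (g has_derivative (\<lambda>v. G y \<bullet> v)) (at y)"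
    and cG: "continuous_on (cball 0 1) G" and g0: "\<And>y. y \<in> sphere 0 1 \<Longrightarrow> g y = 0"
    and neg: "\<And>y. y \<in> ball 0 1 \<Longrightarrow> g y \<le> 0" and x: "x \<in> sphere 0 1"
  shows "G x \<bullet> x \<ge> 0"
proof (rule ccontr)
  assume not: "\<not> ?thesis"
  \<comment> \<open>Half the size of the supposedly negative normal derivative. At distance s
    inwards the linear term is 2 e s and the error at most e s, which would make \<open>g\<close>
    positive there.\<close>
  define e where "e = - (G x \<bullet> x) / 2"
  have e: "e > 0" using not by (simp add: e_def)
  have "(g has_derivative (\<lambda>v. G x \<bullet> v)) (at x within cball 0 1)"
    by (rule has_derivative_within_cball[OF cg dg cG]) (use x in auto)
  then obtain d where d: "d > 0"
    and dd: "\<And>y. y \<in> cball 0 1 \<Longrightarrow> norm (y - x) < d \<Longrightarrow> norm (g y - g x - G x \<bullet> (y - x)) \<le> e * norm (y - x)"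
    unfolding has_derivative_within_alt using e by meson
  define s where "s = min (d / 2) (1 / 2)"
  have s: "0 < s" "s < d" "s < 1" using d by (auto simp: s_def)
  define y where "y = (1 - s) *\<^sub>R x"
  have yx: "y - x = - (s *\<^sub>R x)" by (simp add: y_def algebra_simps)
  have y: "y \<in> ball 0 1" using s x by (simp add: y_def)
  have "norm (g y - g x - G x \<bullet> (y - x)) \<le> e * s"
    using dd[of y] y s x by (simp add: yx)
  then have "norm (g y + s * (G x \<bullet> x)) \<le> e * s" using g0[OF x] by (simp add: yx)
  then have "- g y - s * (G x \<bullet> x) \<le> e * s" by simp
  then have "- g y \<le> - (e * s)" by (simp add: e_def algebra_simps)
  moreover have "e * s > 0" using e s by simp
  ultimately show False using neg[OF y] by simp
qed

section \<open>Wirtinger derivatives\<close>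

lemma frechet_derivative_eq: "(f has_derivative f') (at x) \<Longrightarrow> frechet_derivative f (at x) = f'"
  using frechet_derivative_at by metis

lemma dz_eq: "(f has_derivative f') (at z) \<Longrightarrow> dz l f z = (f' (axis l 1) - \<i> * f' (axis l \<i>)) / 2"
  and dzbar_eq: "(f has_derivative f') (at z) \<Longrightarrow> dzbar l f z = (f' (axis l 1) + \<i> * f' (axis l \<i>)) / 2"
  by (simp_all add: dz_def dzbar_def frechet_derivative_eq)

lemma wirtinger_cong:
  assumes "open S" "z \<in> S" "\<And>y. y \<in> S \<Longrightarrow> f y = g y"
  shows "f differentiable (at z) \<Longrightarrow> dz l f z = dz l g z" "f differentiable (at z) \<Longrightarrow> dzbar l f z = dzbar l g z"
  using frechet_derivative_transform_within_open[OF _ assms(1-3)] by (simp_all add: dz_def dzbar_def)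

lemma dzbar_const [simp]: "dzbar l (\<lambda>z. c) z = 0"
  by (simp add: dzbar_def)

lemma dzbar_mult:
  assumes "f differentiable (at z)" "g differentiable (at z)"
  shows "dzbar l (\<lambda>z. f z * g z) z = f z * dzbar l g z + dzbar l f z * g z"
  unfolding dzbar_eq[OF has_derivative_mult[OF assms[unfolded frechet_derivative_works]]]
  unfolding dzbar_def by (simp add: field_simps)

lemma dzbar_add:
  assumes "f differentiable (at z)" "g differentiable (at z)"
  shows "dzbar l (\<lambda>z. f z + g z) z = dzbar l f z + dzbar l g z"
  unfolding dzbar_eq[OF has_derivative_add[OF assms[unfolded frechet_derivative_works]]]
  unfolding dzbar_def by (simp add: field_simps)

lemma dzbar_cmult: "f differentiable (at z) \<Longrightarrow> dzbar l (\<lambda>z. c * f z) z = c * dzbar l f z"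
  by (subst dzbar_mult) auto

lemma dzbar_sum:
  assumes "\<And>i. i \<in> I \<Longrightarrow> f i differentiable (at z)"
  shows "dzbar l (\<lambda>z. \<Sum>i\<in>I. f i z) z = (\<Sum>i\<in>I. dzbar l (f i) z)"
  using assms by (induction I rule: infinite_finite_induct) (simp_all add: dzbar_add)

lemma differentiable_cnj: "f differentiable (at z) \<Longrightarrow> (\<lambda>z. cnj (f z)) differentiable (at z)"
  unfolding differentiable_def using bounded_linear.has_derivative[OF bounded_linear_cnj] by blast

lemma dzbar_cnj:
  assumes "f differentiable (at z)"
  shows "dzbar l (\<lambda>z. cnj (f z)) z = cnj (dz l f z)"
  unfolding dzbar_eq[OF bounded_linear.has_derivative[OF bounded_linear_cnj assms[unfolded frechet_derivative_works]]]
  by (simp add: dz_def)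

lemma bounded_linear_coord: "bounded_linear (\<lambda>z::complex^'n. z $ p)"
  by (rule bounded_linear_vec_nth)

lemma dzbar_coord [simp]: "dzbar l (\<lambda>z. z $ p) z = 0"
  using dzbar_eq[OF bounded_linear.has_derivative[OF bounded_linear_coord has_derivative_ident], of l p z]
  by (cases "p = l") (simp_all add: axis_def)

lemma dz_coord [simp]: "dz l (\<lambda>z. z $ p) z = (if l = p then 1 else 0)"
  using dz_eq[OF bounded_linear.has_derivative[OF bounded_linear_coord has_derivative_ident], of l p z]
  by (cases "p = l") (simp_all add: axis_def)

lemma differentiable_coord [simp]: "(\<lambda>z::complex^'n. z $ p) differentiable (at z)"
  using bounded_linear.has_derivative[OF bounded_linear_coord has_derivative_ident] by (rule differentiableI)

lemma differentiable_cnj_coord [simp]: "(\<lambda>z::complex^'n. cnj (z $ p)) differentiable (at z)"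
  by (rule differentiable_cnj) simp

lemma dzbar_cnj_coord [simp]: "dzbar l (\<lambda>z. cnj (z $ p)) z = (if l = p then 1 else 0)"
  by (simp add: dzbar_cnj)

lemma frechet_compose_linear:
  assumes "bounded_linear L" "f differentiable (at x)"
  shows "frechet_derivative (\<lambda>x. L (f x)) (at x) v = L (frechet_derivative f (at x) v)"
  using frechet_derivative_eq[OF bounded_linear.has_derivative[OF assms(1) assms(2)[unfolded frechet_derivative_works]]]
  by simp

lemma CC_differentiable: "CC (Suc k) S f \<Longrightarrow> x \<in> S \<Longrightarrow> f differentiable (at x)"
  by simp

lemma CC_symmetric:
  fixes f :: "'a::euclidean_space \<Rightarrow> complex"
  assumes S: "open S" and f: "CC (Suc (Suc 0)) S f" and x: "x \<in> S"
  shows "frechet_derivative (\<lambda>y. frechet_derivative f (at y) v) (at x) w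
       = frechet_derivative (\<lambda>y. frechet_derivative f (at y) w) (at x) v"
proof -
  have *: "L (frechet_derivative (\<lambda>y. frechet_derivative f (at y) v) (at x) w)
      = frechet_derivative (\<lambda>y. frechet_derivative (\<lambda>y. L (f y)) (at y) v) (at x) w"
    if L: "bounded_linear L" for L :: "complex \<Rightarrow> real" and v w
  proof -
    have d: "(\<lambda>y. frechet_derivative f (at y) v) differentiable (at x)"
      by (rule CC_differentiable[OF CC_SucD(2)[OF f] x])
    have "L (frechet_derivative (\<lambda>y. frechet_derivative f (at y) v) (at x) w)
        = frechet_derivative (\<lambda>y. L (frechet_derivative f (at y) v)) (at x) w"
      by (rule frechet_compose_linear[OF L d, symmetric])
    also have "\<dots> = frechet_derivative (\<lambda>y. frechet_derivative (\<lambda>y. L (f y)) (at y) v) (at x) w"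
    proof (rule fun_cong[OF frechet_derivative_transform_within_open[OF _ S x]])
      show "(\<lambda>y. L (frechet_derivative f (at y) v)) differentiable (at x)"
        using bounded_linear.has_derivative[OF L d[unfolded frechet_derivative_works]] by (rule differentiableI)
      show "L (frechet_derivative f (at y) v) = frechet_derivative (\<lambda>y. L (f y)) (at y) v" if "y \<in> S" for y
        by (rule frechet_compose_linear[OF L CC_differentiable[OF f that], symmetric])
    qed
    finally show ?thesis .
  qed
  have "L (frechet_derivative (\<lambda>y. frechet_derivative f (at y) v) (at x) w)
       = L (frechet_derivative (\<lambda>y. frechet_derivative f (at y) w) (at x) v)" if L: "bounded_linear L" for L :: "complex \<Rightarrow> real"
    unfolding *[OF L] by (rule CC_symmetric_real[OF S CC_compose_linear[OF S L f] x])
  from this[OF bounded_linear_Re] this[OF bounded_linear_Im] show ?thesis by (rule complex_eqI)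
qed

lemma CC_dz: "open S \<Longrightarrow> CC (Suc k) S f \<Longrightarrow> CC k S (dz l f)"
  and CC_dzbar: "open S \<Longrightarrow> CC (Suc k) S f \<Longrightarrow> CC k S (dzbar l f)"
proof -
  assume S: "open S" and f: "CC (Suc k) S f"
  have "CC k S (\<lambda>z. (1/2) * (frechet_derivative f (at z) (axis l 1) + (- \<i>) * frechet_derivative f (at z) (axis l \<i>)))"
    by (intro CC_cmult CC_add S CC_SucD(2)[OF f])
  moreover have "dz l f = (\<lambda>z. (1/2) * (frechet_derivative f (at z) (axis l 1) + (- \<i>) * frechet_derivative f (at z) (axis l \<i>)))"
    by (simp add: dz_def fun_eq_iff)
  ultimately show "CC k S (dz l f)" by simp
  have "CC k S (\<lambda>z. (1/2) * (frechet_derivative f (at z) (axis l 1) + \<i> * frechet_derivative f (at z) (axis l \<i>)))"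
    by (intro CC_cmult CC_add S CC_SucD(2)[OF f])
  moreover have "dzbar l f = (\<lambda>z. (1/2) * (frechet_derivative f (at z) (axis l 1) + \<i> * frechet_derivative f (at z) (axis l \<i>)))"
    by (simp add: dzbar_def fun_eq_iff)
  ultimately show "CC k S (dzbar l f)" by simp
qed

abbreviation D2 :: "('a::real_normed_vector \<Rightarrow> 'b::real_normed_vector) \<Rightarrow> 'a \<Rightarrow> 'a \<Rightarrow> 'a \<Rightarrow> 'b" where
  "D2 f z v w \<equiv> frechet_derivative (\<lambda>y. frechet_derivative f (at y) v) (at z) w"

lemma second_wirtinger:
  assumes f: "CC (Suc (Suc 0)) S f" and z: "z \<in> S"
  shows "dz l (dzbar m f) z = (D2 f z (axis m 1) (axis l 1) + D2 f z (axis m \<i>) (axis l \<i>)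
           + \<i> * (D2 f z (axis m \<i>) (axis l 1) - D2 f z (axis m 1) (axis l \<i>))) / 4"
    and "dzbar l (dz m f) z = (D2 f z (axis m 1) (axis l 1) + D2 f z (axis m \<i>) (axis l \<i>)
           + \<i> * (D2 f z (axis m 1) (axis l \<i>) - D2 f z (axis m \<i>) (axis l 1))) / 4"
    and "dzbar l (dzbar m f) z = (D2 f z (axis m 1) (axis l 1) - D2 f z (axis m \<i>) (axis l \<i>)
           + \<i> * (D2 f z (axis m \<i>) (axis l 1) + D2 f z (axis m 1) (axis l \<i>))) / 4"
proof -
  have d: "((\<lambda>y. frechet_derivative f (at y) v) has_derivative D2 f z v) (at z)" for v
    using CC_differentiable[OF CC_SucD(2)[OF f] z] by (simp add: frechet_derivative_works)
  have zb: "(dzbar m f has_derivative (\<lambda>v. (D2 f z (axis m 1) v + \<i> * D2 f z (axis m \<i>) v) / 2)) (at z)"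
    unfolding dzbar_def[abs_def] by (auto intro!: derivative_eq_intros d)
  have zz: "(dz m f has_derivative (\<lambda>v. (D2 f z (axis m 1) v - \<i> * D2 f z (axis m \<i>) v) / 2)) (at z)"
    unfolding dz_def[abs_def] by (auto intro!: derivative_eq_intros d)
  show "dz l (dzbar m f) z = (D2 f z (axis m 1) (axis l 1) + D2 f z (axis m \<i>) (axis l \<i>)
           + \<i> * (D2 f z (axis m \<i>) (axis l 1) - D2 f z (axis m 1) (axis l \<i>))) / 4"
    unfolding dz_eq[OF zb] by (simp add: field_simps)
  show "dzbar l (dz m f) z = (D2 f z (axis m 1) (axis l 1) + D2 f z (axis m \<i>) (axis l \<i>)
           + \<i> * (D2 f z (axis m 1) (axis l \<i>) - D2 f z (axis m \<i>) (axis l 1))) / 4"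
    unfolding dzbar_eq[OF zz] by (simp add: field_simps)
  show "dzbar l (dzbar m f) z = (D2 f z (axis m 1) (axis l 1) - D2 f z (axis m \<i>) (axis l \<i>)
           + \<i> * (D2 f z (axis m \<i>) (axis l 1) + D2 f z (axis m 1) (axis l \<i>))) / 4"
    unfolding dzbar_eq[OF zb] by (simp add: field_simps)
qed

lemma dz_dzbar_commute:
  assumes "open S" "CC (Suc (Suc 0)) S f" "z \<in> S"
  shows "dz l (dzbar m f) z = dzbar m (dz l f) z"
  unfolding second_wirtinger[OF assms(2,3)] using CC_symmetric[OF assms] by (simp add: add.commute)

lemma dzbar_dzbar_commute:
  assumes "open S" "CC (Suc (Suc 0)) S f" "z \<in> S"
  shows "dzbar l (dzbar m f) z = dzbar m (dzbar l f) z"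
  unfolding second_wirtinger[OF assms(2,3)] using CC_symmetric[OF assms] by (simp add: add.commute)

lemma sum_Basis_complex_vec:
  fixes f :: "complex^'n \<Rightarrow> 'b::comm_monoid_add"
  shows "(\<Sum>b\<in>Basis. f b) = (\<Sum>m\<in>UNIV. f (axis m 1) + f (axis m \<i>))"
proof -
  have B: "(Basis :: (complex^'n) set) = (\<lambda>(m, u). axis m u) ` (UNIV \<times> Basis)"
    by (auto simp: Basis_vec_def)
  have inj: "inj_on (\<lambda>(m, u). axis m u :: complex^'n) (UNIV \<times> Basis)"
    by (auto simp: inj_on_def axis_eq_axis)
  have "(\<Sum>b\<in>Basis. f b) = (\<Sum>p\<in>UNIV \<times> Basis. f ((\<lambda>(m, u). axis m u) p))"
    unfolding B by (subst sum.reindex[OF inj]) simp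
  also have "\<dots> = (\<Sum>m\<in>UNIV. \<Sum>u\<in>Basis. f (axis m u))"
    by (subst sum.cartesian_product) (simp add: case_prod_unfold)
  finally show ?thesis by (simp add: Basis_complex_def)
qed

text \<open>The real field with components conj F_m has the inner product Re (sum of F_m z_m) with z
  and the divergence 2 Re (sum of dzbar_m F_m). \<open>G\<close> supplies the boundary values, and
  \<open>D\<close> a formula for half the divergence whose integrability can be checked.\<close>

theorem integral_complex_divergence_nonneg:
  fixes F G :: "'n::finite \<Rightarrow> complex^'n \<Rightarrow> complex"
  assumes F: "\<And>m. CC (Suc 0) (ball 0 1) (F m)"
    and cG: "\<And>m. continuous_on (cball 0 1) (G m)" and GF: "\<And>m z. z \<in> ball 0 1 \<Longrightarrow> G m z = F m z"
    and pos: "\<And>z. z \<in> sphere 0 1 \<Longrightarrow> 0 \<le> Re (\<Sum>m\<in>UNIV. G m z * z $ m)"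
    and int: "set_integrable lborel (ball 0 1) D"
    and D: "\<And>z. z \<in> ball 0 1 \<Longrightarrow> Re (\<Sum>m\<in>UNIV. dzbar m (F m) z) = D z"
  shows "0 \<le> (LINT z:ball 0 1|lborel. D z)"
proof -
  define X :: "complex^'n \<Rightarrow> complex^'n" where "X z = (\<chi> m. cnj (F m z))" for z
  define X' where "X' z v = (\<chi> m. cnj (frechet_derivative (F m) (at z) v))" for z v
  have dX: "(X has_derivative X' z) (at z)" if "z \<in> ball 0 1" for z
  proof (subst has_derivative_componentwise_within, rule ballI)
    fix b :: "complex^'n" assume "b \<in> Basis"
    then obtain m u where b: "b = axis m u" by (auto simp: Basis_vec_def)
    have "((\<lambda>z. cnj (F m z) \<bullet> u) has_derivative (\<lambda>v. cnj (frechet_derivative (F m) (at z) v) \<bullet> u)) (at z)"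
      by (intro has_derivative_inner_left bounded_linear.has_derivative[OF bounded_linear_cnj] CC_SucD(1)[OF F that])
    then show "((\<lambda>z. X z \<bullet> b) has_derivative (\<lambda>v. X' z v \<bullet> b)) (at z)"
      by (simp add: b inner_axis X_def X'_def)
  qed
  have cX: "continuous_on (ball 0 1) (\<lambda>z. X' z b)" for b
    unfolding X'_def using CC_SucD(2)[OF F] by (intro continuous_intros) simp
  have div: "(\<Sum>b\<in>Basis. X' z b \<bullet> b) = 2 * D z" if "z \<in> ball 0 1" for z
  proof -
    have i: "a \<bullet> axis m c = a $ m \<bullet> c" for a :: "complex^'n" and m c
      by (rule inner_axis)
    have "(\<Sum>b\<in>Basis. X' z b \<bullet> b) = 2 * Re (\<Sum>m\<in>UNIV. dzbar m (F m) z)"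
      unfolding sum_Basis_complex_vec Re_sum sum_distrib_left
      by (rule sum.cong) (simp_all add: i X'_def dzbar_def inner_complex_def)
    then show ?thesis using D[OF that] by simp
  qed
  have "0 \<le> (LINT z:ball 0 1|lborel. (\<Sum>b\<in>Basis. X' z b \<bullet> b))"
  proof (rule integral_divergence_nonneg[where G = "\<lambda>z. \<chi> m. cnj (G m z)"])
    show "continuous_on (cball 0 1) (\<lambda>z. \<chi> m. cnj (G m z))" by (intro continuous_intros cG)
    show "(\<chi> m. cnj (G m z)) = X z" if "z \<in> ball 0 1" for z using GF[OF that] by (simp add: X_def)
    show "0 \<le> (\<chi> m. cnj (G m z)) \<bullet> z" if "z \<in> sphere 0 1" for z
      using pos[OF that] by (simp add: inner_vec_def inner_complex_def)
    have "set_integrable lborel (ball 0 1) (\<lambda>z. 2 * D z)" using int by simp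
    then show "set_integrable lborel (ball 0 1) (\<lambda>z. \<Sum>b\<in>Basis. X' z b \<bullet> b)"
      by (rule set_integrable_cong[THEN iffD1, rotated 3]) (simp_all add: div)
  qed (use dX cX in auto)
  also have "\<dots> = (LINT z:ball 0 1|lborel. 2 * D z)"
    by (rule set_lebesgue_integral_cong) (simp_all add: div)
  finally show ?thesis by simp
qed

section \<open>Divergence-free cofactor fields\<close>

lemma CC_det:
  fixes M :: "'a::euclidean_space \<Rightarrow> complex^'n^'n"
  assumes "open S" "\<And>i j. CC k S (\<lambda>x. M x $ i $ j)"
  shows "CC k S (\<lambda>x. det (M x))"
  unfolding det_def by (intro CC_sum CC_cmult CC_prod assms)

lemma CC_cof_shift:
  fixes M :: "'a::euclidean_space \<Rightarrow> complex^'n^'n"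
  assumes S: "open S" and M: "\<And>i j. CC k S (\<lambda>x. M x $ i $ j)"
  shows "CC k S (\<lambda>x. cof (shift (M x) t) l m)"
  unfolding cof_def
proof (rule CC_det[OF S])
  fix i j
  show "CC k S (\<lambda>x. (\<chi> i. if i = l then axis m 1 else shift (M x) t $ i) $ i $ j)"
    by (cases "i = l") (auto simp: shift_def intro!: CC_const CC_add S M)
qed

lemma CC_Tk:
  fixes M :: "'a::euclidean_space \<Rightarrow> complex^'n^'n"
  assumes "open S" "\<And>i j. CC k S (\<lambda>x. M x $ i $ j)"
  shows "CC k S (\<lambda>x. Tk \<gamma> (M x) l m)" "CC k S (\<lambda>x. Rk \<gamma> (M x) l m)"
  unfolding Tk_def Rk_def lam_def by (intro CC_sum CC_cmult CC_cof_shift assms)+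

text \<open>For a complex Hessian \<open>sym\<close> is the commutation of the derivatives dzbar.
  The shift by t is constant, so \<open>cof_divergence_free\<close> applies for every t.\<close>

lemma dzbar_cof_shift_divergence:
  fixes M :: "complex^'n \<Rightarrow> complex^'n^'n"
  assumes d: "\<And>i j. (\<lambda>x. M x $ i $ j) differentiable (at z)"
    and sym: "\<And>i j m. dzbar m (\<lambda>x. M x $ i $ j) z = dzbar j (\<lambda>x. M x $ i $ m) z"
  shows "(\<Sum>m\<in>UNIV. dzbar m (\<lambda>x. cof (shift (M x) t) l m) z) = 0"
proof -
  let ?B = "\<lambda>m. \<chi> a. if a = l then axis m 1 else shift (M z) t $ a"
  have "((\<lambda>x. shift (M x) t $ i $ j) has_derivative frechet_derivative (\<lambda>x. M x $ i $ j) (at z)) (at z)" for i j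
    using d[of i j] unfolding frechet_derivative_works shift_def by (auto intro!: derivative_eq_intros)
  from dzbar_eq[OF has_derivative_cof[of "\<lambda>x. shift (M x) t", OF this]]
  have "dzbar m (\<lambda>x. cof (shift (M x) t) l m) z = (\<Sum>i\<in>UNIV-{l}. \<Sum>j\<in>UNIV. dzbar m (\<lambda>x. M x $ i $ j) z * cof (?B m) i j)" for m
    by (simp add: dzbar_def sum_distrib_left sum_divide_distrib add_divide_distrib distrib_right sum.distrib mult.assoc)
  then show ?thesis using cof_divergence_free[of "\<lambda>i j m. dzbar m (\<lambda>x. M x $ i $ j) z" l "shift (M z) t"] sym
    by simp
qed

lemma dzbar_Tk_divergence:
  fixes M :: "complex^'n \<Rightarrow> complex^'n^'n"
  assumes S: "open S" "z \<in> S" and M: "\<And>i j. CC (Suc 0) S (\<lambda>x. M x $ i $ j)"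
    and sym: "\<And>i j m. dzbar m (\<lambda>x. M x $ i $ j) z = dzbar j (\<lambda>x. M x $ i $ m) z"
  shows "(\<Sum>m\<in>UNIV. dzbar m (\<lambda>x. Tk \<gamma> (M x) l m) z) = 0" "(\<Sum>m\<in>UNIV. dzbar m (\<lambda>x. Rk \<gamma> (M x) l m) z) = 0"
proof -
  have d: "(\<lambda>x. cof (shift (M x) t) l m) differentiable (at z)" for t m
    by (rule CC_differentiable[OF CC_cof_shift[OF S(1) M] S(2)])
  have d': "(\<lambda>x. c * cof (shift (M x) t) l m) differentiable (at z)" for c t m
    by (rule CC_differentiable[OF CC_cmult[OF S(1) CC_cof_shift[OF S(1) M]] S(2)])
  have 0: "(\<Sum>m\<in>UNIV. dzbar m (\<lambda>x. cof (shift (M x) t) l m) z) = 0" for t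
    by (rule dzbar_cof_shift_divergence[OF CC_differentiable[OF M S(2)] sym])
  have "(\<Sum>m\<in>UNIV. dzbar m (\<lambda>x. \<Sum>i\<in>I. c i * cof (shift (M x) (t i)) l m) z) = 0" for I :: "nat set" and c t
  proof -
    have "(\<Sum>m\<in>UNIV. dzbar m (\<lambda>x. \<Sum>i\<in>I. c i * cof (shift (M x) (t i)) l m) z)
        = (\<Sum>m\<in>UNIV. \<Sum>i\<in>I. c i * dzbar m (\<lambda>x. cof (shift (M x) (t i)) l m) z)"
      by (simp add: dzbar_sum dzbar_cmult d d')
    also have "\<dots> = (\<Sum>i\<in>I. c i * (\<Sum>m\<in>UNIV. dzbar m (\<lambda>x. cof (shift (M x) (t i)) l m) z))"
      by (subst sum.swap) (simp add: sum_distrib_left)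
    finally show ?thesis by (simp add: 0)
  qed
  from this[of "\<lambda>i. of_real (\<gamma> i)" of_nat "{..CARD('n)}"] this[of "\<lambda>i. of_real (\<gamma> i) * of_nat i" of_nat "{..CARD('n)}"]
  show "(\<Sum>m\<in>UNIV. dzbar m (\<lambda>x. Tk \<gamma> (M x) l m) z) = 0" "(\<Sum>m\<in>UNIV. dzbar m (\<lambda>x. Rk \<gamma> (M x) l m) z) = 0"
    by (simp_all add: Tk_def Rk_def lam_def mult.assoc)
qed

section \<open>The Pohozaev field\<close>

abbreviation cx :: "('a \<Rightarrow> real) \<Rightarrow> 'a \<Rightarrow> complex" where
  "cx u \<equiv> \<lambda>w. complex_of_real (u w)"

lemma CC_cx: "open S \<Longrightarrow> CC k S u \<Longrightarrow> CC k S (cx u)"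
  by (rule CC_compose_linear[OF _ bounded_linear_of_real])

lemma differentiable_cx: "u differentiable (at z) \<Longrightarrow> cx u differentiable (at z)"
  unfolding differentiable_def using bounded_linear.has_derivative[OF bounded_linear_of_real] by blast

lemma dzbar_cx: "u differentiable (at z) \<Longrightarrow> dzbar l (cx u) z = cnj (dz l (cx u) z)"
  using dzbar_cnj[OF differentiable_cx, of u z l] by simp

context
  fixes u :: "complex^'n \<Rightarrow> real"
  assumes u4: "CC 4 (ball 0 1) u"
begin

lemma cx_CC: "j \<le> 4 \<Longrightarrow> CC j (ball 0 1) (cx u)"
  by (rule CC_mono[OF CC_cx[OF open_ball u4]])

lemma u_differentiable: "z \<in> ball 0 1 \<Longrightarrow> u differentiable (at z)"
  using u4 by (simp add: numeral_eq_Suc)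

lemma hessian_eq: "z \<in> ball 0 1 \<Longrightarrow> complex_hessian u z $ i $ j = dzbar j (dz i (cx u)) z"
  unfolding complex_hessian_def vec_lambda_beta
  by (rule dz_dzbar_commute[OF open_ball cx_CC]) simp_all

lemma dz_cx_CC: "CC 3 (ball 0 1) (dz i (cx u))"
  using CC_dz[OF open_ball, where k = 3 and f = "cx u" and l = i] cx_CC[of 4] by (simp add: numeral_eq_Suc del: CC.simps)

lemma hessian_CC: "CC 2 (ball 0 1) (\<lambda>z. complex_hessian u z $ i $ j)"
  using CC_dzbar[OF open_ball, where k = 2 and f = "dz i (cx u)" and l = j] dz_cx_CC[of i]
  by (intro CC_cong[OF open_ball hessian_eq[symmetric]]) (simp_all add: numeral_eq_Suc del: CC.simps)

lemma hessian_CC1: "CC (Suc 0) (ball 0 1) (\<lambda>z. complex_hessian u z $ i $ j)"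
  by (rule CC_mono[OF hessian_CC]) simp

lemma dz_cx_CC1: "CC (Suc 0) (ball 0 1) (dz i (cx u))"
  by (rule CC_mono[OF dz_cx_CC]) simp

text \<open>As \<open>u\<close> is real, conjugation exchanges dz and dzbar, and the two
  commute.\<close>

lemma hessian_hermitian:
  assumes z: "z \<in> ball 0 1" shows "hermitian (complex_hessian u z)"
  unfolding hermitian_def
proof (intro allI)
  fix i j
  have d: "dzbar j (cx u) differentiable (at z)" if "z \<in> ball 0 1" for j z
    using CC_differentiable[OF CC_dzbar[OF open_ball, where k = "Suc 0" and f = "cx u" and l = j]] cx_CC[of "Suc (Suc 0)"] that by simp
  have "cnj (complex_hessian u z $ i $ j) = dzbar i (\<lambda>z. cnj (dzbar j (cx u) z)) z"
    unfolding complex_hessian_def vec_lambda_beta by (rule dzbar_cnj[OF d[OF z], symmetric])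
  also have "\<dots> = dzbar i (dz j (cx u)) z"
    by (rule wirtinger_cong(2)[OF open_ball z _ differentiable_cnj[OF d[OF z]]])
       (simp only: dzbar_cx[OF u_differentiable] complex_cnj_cnj)
  also have "\<dots> = complex_hessian u z $ j $ i" by (rule hessian_eq[OF z, symmetric])
  finally show "cnj (complex_hessian u z $ i $ j) = complex_hessian u z $ j $ i" .
qed

lemma hessian_dzbar_sym:
  assumes z: "z \<in> ball 0 1"
  shows "dzbar m (\<lambda>z. complex_hessian u z $ i $ j) z = dzbar j (\<lambda>z. complex_hessian u z $ i $ m) z"
proof -
  have *: "dzbar m (\<lambda>z. complex_hessian u z $ i $ j) z = dzbar m (dzbar j (dz i (cx u))) z" for m j
    by (rule wirtinger_cong(2)[OF open_ball z hessian_eq CC_differentiable[OF hessian_CC1 z]])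
  have c: "CC (Suc (Suc 0)) (ball 0 1) (dz i (cx u))" by (rule CC_mono[OF dz_cx_CC]) simp
  show ?thesis unfolding * by (rule dzbar_dzbar_commute[OF open_ball c z])
qed

end

text \<open>With \<open>w = \<Sum>p. z\<^sub>p u\<^sub>p\<close>, the field \<open>(w - K1) T u\<^sub>l\<close> carries the Pohozaev identity (\<open>w\<close>) and the mass
  \<open>\<integral> S\<^sub>k\<close> (\<open>K1\<close>), the term with \<open>Rk\<close> compensates for \<open>k < n\<close>, \<open>K2\<close> is a multiple of the position field, and
  \<open>K3\<close> removes \<open>e\<^sup>-\<^sup>u Re w\<close> from the divergence without contributing on the sphere.\<close>

definition pohozaev_field ::
  "(nat \<Rightarrow> real) \<Rightarrow> real \<Rightarrow> real \<Rightarrow> real \<Rightarrow> complex^'n^'n \<Rightarrow> ('n \<Rightarrow> complex) \<Rightarrow> real \<Rightarrow> complex^'n \<Rightarrow> 'n \<Rightarrow> complex" where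
  "pohozaev_field \<gamma> K1 K2 K3 H U s z m =
     ((\<Sum>p\<in>UNIV. z $ p * U p) + of_real (- K1)) * (\<Sum>l\<in>UNIV. Tk \<gamma> H l m * U l)
     + of_real s * (\<Sum>p\<in>UNIV. cnj (z $ p) * Rk \<gamma> H p m)
     + of_real (K2 + K3 * (exp (- s) - 1)) * cnj (z $ m)"

text \<open>The argument 0 for \<open>s\<close> is the boundary value of u and removes the terms
  with \<open>Rk\<close> and \<open>K3\<close>. Since the norm of z is 1, the radial sum is
  \<open>h\<close>, and \<open>Tk_scalar_plus_rank_two\<close> gives C h^k for the flux of the T
  part.\<close>

lemma pohozaev_field_sphere:
  fixes z :: "complex^'n"
  assumes ex: "extracts CARD('n) (CARD('n) - k) \<gamma>" and k: "1 \<le> k" "k \<le> CARD('n)"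
    and H: "\<And>i j. H $ i $ j = (if i = j then of_real h else 0) + a i * z $ j + cnj (z $ i) * b j"
    and U: "\<And>l. U l = of_real h * cnj (z $ l)" and z: "norm z = 1"
  defines "C \<equiv> of_nat ((CARD('n) - 1) choose (k - 1))"
  shows "(\<Sum>m\<in>UNIV. pohozaev_field \<gamma> K1 K2 K3 H U 0 z m * z $ m) = of_real (C * h ^ (k + 1) - K1 * C * h ^ k + K2)"
proof -
  have zz: "(\<Sum>l\<in>UNIV. cnj (z $ l) * z $ l) = 1"
  proof -
    have "(\<Sum>l\<in>UNIV. cnj (z $ l) * z $ l) = of_real (\<Sum>l\<in>UNIV. (cmod (z $ l))\<^sup>2)"
      unfolding of_real_sum by (intro sum.cong) (simp_all only: complex_norm_square mult.commute)
    also have "(\<Sum>l\<in>UNIV. (cmod (z $ l))\<^sup>2) = (norm z)\<^sup>2" by (simp add: norm_vec_def L2_set_def sum_nonneg)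
    finally show ?thesis using z by simp
  qed
  have w: "(\<Sum>p\<in>UNIV. z $ p * U p) = of_real h"
    using arg_cong[OF zz, of "\<lambda>x. of_real h * x"] by (simp add: U sum_distrib_left mult_ac)
  have V: "(\<Sum>m\<in>UNIV. (\<Sum>l\<in>UNIV. Tk \<gamma> H l m * U l) * z $ m) = of_real (C * h ^ k)"
  proof -
    have "(\<Sum>m\<in>UNIV. (\<Sum>l\<in>UNIV. Tk \<gamma> H l m * U l) * z $ m)
        = of_real h * (\<Sum>m\<in>UNIV. \<Sum>l\<in>UNIV. cnj (z $ l) * (z $ m * Tk \<gamma> H l m))"
      by (simp add: U sum_distrib_left sum_distrib_right mult_ac)
    also have "\<dots> = of_real h * (\<Sum>l\<in>UNIV. \<Sum>m\<in>UNIV. cnj (z $ l) * (z $ m * Tk \<gamma> H l m))"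
      by (subst sum.swap) (rule refl)
    also have "\<dots> = of_real h * (of_nat ((CARD('n) - 1) choose (k - 1)) * of_real h ^ (k - 1))"
      by (simp only: Tk_scalar_plus_rank_two[OF ex k H zz])
    also have "\<dots> = of_real (C * h ^ k)" using k by (cases k) (simp_all add: C_def)
    finally show ?thesis .
  qed
  have "(\<Sum>m\<in>UNIV. pohozaev_field \<gamma> K1 K2 K3 H U 0 z m * z $ m)
      = (\<Sum>m\<in>UNIV. of_real (h - K1) * ((\<Sum>l\<in>UNIV. Tk \<gamma> H l m * U l) * z $ m) + of_real K2 * (cnj (z $ m) * z $ m))"
    unfolding pohozaev_field_def w by (simp add: algebra_simps)
  also have "\<dots> = of_real (h - K1) * of_real (C * h ^ k) + of_real K2"
    unfolding sum.distrib sum_distrib_left[symmetric] V zz by simp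
  finally show ?thesis by (simp add: algebra_simps)
qed

text \<open>As \<open>Tk\<close> and \<open>Rk\<close> are divergence free, the derivatives fall
  only on \<open>w\<close>, on the gradient and on the scalar factors. The derivative of
  \<open>w\<close> contributes S_k w together with an unwanted - X, the derivative of u in the
  \<open>Rk\<close> term contributes conj X, and the sum of these two has real part 0.\<close>

lemma pohozaev_divergence:
  fixes u :: "complex^'n \<Rightarrow> real" and K1 K2 K3 :: real
  assumes u4: "CC 4 (ball 0 1) u" and z: "z \<in> ball 0 1"
    and ex: "extracts CARD('n) (CARD('n) - k) \<gamma>" and k: "1 \<le> k" "k \<le> CARD('n)"
  defines "F \<equiv> \<lambda>m z. pohozaev_field \<gamma> K1 K2 K3 (complex_hessian u z) (\<lambda>l. dz l (cx u) z) (u z) z m"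
  defines "w \<equiv> \<Sum>p\<in>UNIV. z $ p * dz p (cx u) z" and "S \<equiv> Sk k (complex_hessian u z)"
  shows "Re (\<Sum>m\<in>UNIV. dzbar m (F m) z) = (real k + 1) * S * Re w + (real CARD('n) - real k) * u z * S
           - K1 * real k * S + real CARD('n) * (K2 + K3 * (exp (- u z) - 1)) - K3 * exp (- u z) * Re w"
    and "CC (Suc 0) (ball 0 1) (F m)"
proof -
  let ?B = "ball (0::complex^'n) 1"
  let ?n = "CARD('n)"
  define H where "H z = complex_hessian u z" for z
  define U where "U l = dz l (cx u)" for l
  define T where "T l m z = Tk \<gamma> (H z) l m" for l m z
  define R where "R l m z = Rk \<gamma> (H z) l m" for l m z
  define W where "W z = (\<Sum>p\<in>UNIV. z $ p * U p z)" for z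
  define V where "V m z = (\<Sum>l\<in>UNIV. T l m z * U l z)" for m z
  define Q where "Q m z = (\<Sum>p\<in>UNIV. cnj (z $ p) * R p m z)" for m z
  define e where "e z = K2 + K3 * (exp (- u z) - 1)" for z
  have F: "F m = (\<lambda>z. (W z + of_real (- K1)) * V m z + cx u z * Q m z + cx e z * cnj (z $ m))" for m
    by (simp add: F_def pohozaev_field_def W_def V_def Q_def T_def R_def H_def U_def e_def fun_eq_iff)
  have cH: "CC (Suc 0) ?B (\<lambda>z. H z $ i $ j)" for i j unfolding H_def by (rule hessian_CC1[OF u4])
  have cU: "CC (Suc 0) ?B (U l)" for l unfolding U_def by (rule dz_cx_CC1[OF u4])
  have cT: "CC (Suc 0) ?B (T l m)" and cR: "CC (Suc 0) ?B (R l m)" for l m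
    unfolding T_def R_def by (rule CC_Tk[OF open_ball cH])+
  have cz: "CC (Suc 0) ?B (\<lambda>z. z $ p)" "CC (Suc 0) ?B (\<lambda>z. cnj (z $ p))" for p
    by (intro CC_bounded_linear[OF open_ball] bounded_linear_coord bounded_linear_compose[OF bounded_linear_cnj])+
  have cW: "CC (Suc 0) ?B W" and cV: "CC (Suc 0) ?B (V m)" and cQ: "CC (Suc 0) ?B (Q m)" for m
    unfolding W_def V_def Q_def by (intro CC_sum CC_mult open_ball cz cU cT cR)+
  have cu: "CC (Suc 0) ?B u" by (rule CC_mono[OF u4]) simp
  have ce: "CC (Suc 0) ?B e"
  proof -
    have "CC (Suc 0) ?B (\<lambda>z. K2 + K3 * (exp ((- 1) * u z) + - 1))"
      by (intro CC_add CC_cmult CC_exp CC_const open_ball cu)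
    then show ?thesis by (simp add: e_def[abs_def] del: CC.simps)
  qed
  show "CC (Suc 0) ?B (F m)" for m
    unfolding F by (intro CC_add CC_mult CC_const CC_cx open_ball cW cV cQ cu ce cz)
  note d = CC_differentiable[OF cH z] CC_differentiable[OF cU z] CC_differentiable[OF cT z] CC_differentiable[OF cR z]
    CC_differentiable[OF cz(1) z] CC_differentiable[OF cz(2) z]
    CC_differentiable[OF cW z] CC_differentiable[OF cV z] CC_differentiable[OF cQ z]
    CC_differentiable[OF CC_cx[OF open_ball cu] z] CC_differentiable[OF CC_cx[OF open_ball ce] z]
  have herm: "hermitian (H z)" unfolding H_def by (rule hessian_hermitian[OF u4 z])
  have S: "S = Sk k (H z)" by (simp add: S_def H_def)
  have dU: "dzbar m (U l) z = H z $ l $ m" for l m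
    unfolding U_def H_def by (rule hessian_eq[OF u4 z, symmetric])
  have divT: "(\<Sum>m\<in>UNIV. dzbar m (T l m) z) = 0" and divR: "(\<Sum>m\<in>UNIV. dzbar m (R l m) z) = 0" for l
    unfolding T_def R_def
    by (intro dzbar_Tk_divergence[OF open_ball z cH]; simp add: H_def hessian_dzbar_sym[OF u4 z])+
  have dW: "dzbar m W z = (\<Sum>p\<in>UNIV. z $ p * H z $ p $ m)" for m
    unfolding W_def by (simp add: dzbar_sum dzbar_mult d dU)
  have dV: "(\<Sum>m\<in>UNIV. dzbar m (V m) z) = of_nat k * of_real S"
  proof -
    have "(\<Sum>m\<in>UNIV. dzbar m (V m) z) = (\<Sum>m\<in>UNIV. \<Sum>l\<in>UNIV. T l m z * H z $ l $ m + dzbar m (T l m) z * U l z)"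
      unfolding V_def by (simp add: dzbar_sum dzbar_mult d dU)
    also have "\<dots> = (\<Sum>l\<in>UNIV. \<Sum>m\<in>UNIV. T l m z * H z $ l $ m + dzbar m (T l m) z * U l z)" by (rule sum.swap)
    also have "\<dots> = (\<Sum>l\<in>UNIV. \<Sum>m\<in>UNIV. H z $ l $ m * T l m z)"
      unfolding sum.distrib sum_distrib_right[symmetric] divT by (simp add: mult.commute)
    also have "\<dots> = of_nat k * of_real S" unfolding T_def S by (rule Tk_mult_trace[OF herm ex k])
    finally show ?thesis .
  qed
  \<comment> \<open>What \<open>Tk_mult_row\<close> leaves besides S_k in the product of the Hessian
    with T, contracted with z and the gradient.\<close>
  define X where "X = (\<Sum>l\<in>UNIV. \<Sum>p\<in>UNIV. U l z * (z $ p * R l p z))"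
  have VW: "(\<Sum>m\<in>UNIV. dzbar m W z * V m z) = W z * of_real S - X"
  proof -
    have "(\<Sum>m\<in>UNIV. dzbar m W z * V m z) = (\<Sum>m\<in>UNIV. \<Sum>l\<in>UNIV. \<Sum>p\<in>UNIV. U l z * (z $ p * (H z $ p $ m * T l m z)))"
      unfolding dW V_def sum_product by (rule sum.cong[OF refl], rule trans[OF sum.swap], simp add: mult_ac)
    also have "\<dots> = (\<Sum>l\<in>UNIV. \<Sum>m\<in>UNIV. \<Sum>p\<in>UNIV. U l z * (z $ p * (H z $ p $ m * T l m z)))" by (rule sum.swap)
    also have "\<dots> = (\<Sum>l\<in>UNIV. \<Sum>p\<in>UNIV. U l z * (z $ p * (\<Sum>m\<in>UNIV. H z $ p $ m * T l m z)))"
      by (rule sum.cong[OF refl], rule trans[OF sum.swap], simp add: sum_distrib_left)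
    also have "\<dots> = (\<Sum>l\<in>UNIV. \<Sum>p\<in>UNIV. U l z * (z $ p * ((if p = l then of_real S else 0) - R l p z)))"
    proof -
      have "(\<Sum>m\<in>UNIV. H z $ p $ m * T l m z) = (if p = l then of_real S else 0) - R l p z" for p l
        using Tk_mult_row[OF herm ex k, of p l] unfolding T_def R_def S eq_diff_eq .
      then show ?thesis by (simp only:)
    qed
    also have "\<dots> = (\<Sum>l\<in>UNIV. \<Sum>p\<in>UNIV. (if p = l then z $ p * U l z * of_real S else 0) - U l z * (z $ p * R l p z))"
      by (intro sum.cong refl) (auto simp: algebra_simps)
    also have "\<dots> = W z * of_real S - X"
      by (simp add: sum_subtractf X_def W_def sum_distrib_right)
    finally show ?thesis .
  qed
  have duc: "dzbar m (cx u) z = cnj (U m z)" for m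
    unfolding U_def by (rule dzbar_cx[OF CC_differentiable[OF cu z]])
  have dQ: "(\<Sum>m\<in>UNIV. dzbar m (Q m) z) = (of_nat ?n - of_nat k) * of_real S"
  proof -
    have "(\<Sum>m\<in>UNIV. dzbar m (Q m) z) = (\<Sum>m\<in>UNIV. \<Sum>p\<in>UNIV. cnj (z $ p) * dzbar m (R p m) z + (if m = p then R p m z else 0))"
      unfolding Q_def by (simp add: dzbar_sum dzbar_mult d if_distrib[of "\<lambda>x. x * _"] cong: if_cong)
    also have "\<dots> = (\<Sum>p\<in>UNIV. \<Sum>m\<in>UNIV. cnj (z $ p) * dzbar m (R p m) z + (if m = p then R p m z else 0))" by (rule sum.swap)
    also have "\<dots> = (\<Sum>p\<in>UNIV. R p p z)"
      unfolding sum.distrib sum_distrib_left[symmetric] divR by simp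
    also have "\<dots> = (of_nat ?n - of_nat k) * of_real S" unfolding R_def S by (rule trace_Rk[OF herm ex k])
    finally show ?thesis .
  qed
  \<comment> \<open>The derivatives dzbar of the real function u are the conjugates of
    \<open>U\<close>, and \<open>Rk\<close> is Hermitian; together they produce the conjugate of the
    same double sum.\<close>
  have uQ: "(\<Sum>m\<in>UNIV. dzbar m (cx u) z * Q m z) = cnj X"
  proof -
    have "cnj (R m p z) = R p m z" for m p unfolding R_def by (rule cnj_Rk[OF herm])
    then show ?thesis by (simp add: X_def duc Q_def sum_distrib_left)
  qed
  have de: "dzbar m (cx e) z = of_real (- K3 * exp (- u z)) * cnj (U m z)" for m
  proof -
    define u' where "u' = frechet_derivative u (at z)"
    have u': "(u has_derivative u') (at z)" unfolding u'_def by (rule CC_SucD(1)[OF cu z])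
    have "(cx e has_derivative (\<lambda>v. of_real (- K3 * exp (- u z) * u' v))) (at z)"
      unfolding e_def by (auto intro!: derivative_eq_intros u')
    moreover have "(cx u has_derivative (\<lambda>v. of_real (u' v))) (at z)" by (intro derivative_intros u')
    ultimately show ?thesis unfolding duc[symmetric] by (simp add: dzbar_eq field_simps)
  qed
  have "(\<Sum>m\<in>UNIV. dzbar m (F m) z)
      = (\<Sum>m\<in>UNIV. (W z + of_real (- K1)) * dzbar m (V m) z + dzbar m W z * V m z
          + (cx u z * dzbar m (Q m) z + dzbar m (cx u) z * Q m z)
          + (of_real (e z) + of_real (- K3 * exp (- u z)) * cnj (z $ m * U m z)))"
    unfolding F
    by (intro sum.cong refl,
        simp only: dzbar_add dzbar_mult d de dzbar_const dzbar_cnj_coord differentiable_add differentiable_mult differentiable_const)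
       (simp add: algebra_simps)
  also have "\<dots> = (W z + of_real (- K1)) * (of_nat k * of_real S) + (W z * of_real S - X)
          + (cx u z * ((of_nat ?n - of_nat k) * of_real S) + cnj X)
          + (of_nat ?n * of_real (e z) + of_real (- K3 * exp (- u z)) * cnj (W z))"
    unfolding sum.distrib sum_distrib_left[symmetric] dV VW dQ uQ
    by (simp add: W_def)
  finally have "Re (\<Sum>m\<in>UNIV. dzbar m (F m) z) = Re \<dots>" by simp
  also have "W z = w" by (simp add: W_def w_def U_def)
  finally show "Re (\<Sum>m\<in>UNIV. dzbar m (F m) z) = (real k + 1) * S * Re w + (real ?n - real k) * u z * S
           - K1 * real k * S + real ?n * (K2 + K3 * (exp (- u z) - 1)) - K3 * exp (- u z) * Re w"
    by (simp add: e_def algebra_simps)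
qed

section \<open>Boundary values\<close>

lemma has_derivative_gradient:
  fixes g :: "'a::euclidean_space \<Rightarrow> real"
  assumes "(g has_derivative g') (at x)" "\<And>b. b \<in> Basis \<Longrightarrow> g' b = p b"
  shows "(g has_derivative (\<lambda>v. (\<Sum>b\<in>Basis. p b *\<^sub>R b) \<bullet> v)) (at x)"
proof -
  have "g' v = (\<Sum>b\<in>Basis. p b *\<^sub>R b) \<bullet> v" for v
  proof -
    have "g' v = g' (\<Sum>b\<in>Basis. (v \<bullet> b) *\<^sub>R b)" by (simp add: euclidean_representation)
    also have "\<dots> = (\<Sum>b\<in>Basis. (v \<bullet> b) * g' b)"
      using has_derivative_linear[OF assms(1)] by (simp add: linear_sum linear_cmul)
    also have "\<dots> = (\<Sum>b\<in>Basis. p b *\<^sub>R b) \<bullet> v"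
      by (simp add: inner_sum_left assms(2) inner_commute[of v] mult.commute)
    finally show ?thesis .
  qed
  then have "g' = (\<lambda>v. (\<Sum>b\<in>Basis. p b *\<^sub>R b) \<bullet> v)" by blast
  then show ?thesis using assms(1) by simp
qed

text \<open>On the sphere, where \<open>u = 0\<close>, the tangential part of the Hessian is the normal derivative times the
  identity: apply \<open>boundary_gradient\<close> to \<open>u\<close> and then to the tangential components of its gradient.\<close>

context
  fixes u :: "'a::euclidean_space \<Rightarrow> real" and p :: "'a \<Rightarrow> 'a \<Rightarrow> real" and q :: "'a \<Rightarrow> 'a \<Rightarrow> 'a \<Rightarrow> real"
    and x :: 'a
  assumes cu: "continuous_on (cball 0 1) u"
    and du: "\<And>y. y \<in> ball 0 1 \<Longrightarrow> \<exists>u'. (u has_derivative u') (at y) \<and> (\<forall>b. u' b = p b y)"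
    and cp: "\<And>b. continuous_on (cball 0 1) (p b)"
    and dp: "\<And>b y. y \<in> ball 0 1 \<Longrightarrow> (p b has_derivative (\<lambda>v. q b v y)) (at y)"
    and cq: "\<And>b v. continuous_on (cball 0 1) (q b v)"
    and u0: "\<And>y. y \<in> sphere 0 1 \<Longrightarrow> u y = 0"
    and x: "x \<in> sphere 0 1"
begin

definition "normal_deriv y = (\<Sum>b\<in>Basis. p b y * (b \<bullet> y))"

lemma gradient_u:
  assumes "y \<in> ball 0 1" shows "(u has_derivative (\<lambda>v. (\<Sum>b\<in>Basis. p b y *\<^sub>R b) \<bullet> v)) (at y)"
proof -
  obtain u' where u': "(u has_derivative u') (at y)" "\<forall>b. u' b = p b y" using du[OF assms] by blast
  show ?thesis by (rule has_derivative_gradient[OF u'(1)]) (simp add: u'(2))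
qed

lemma continuous_gradient_u: "continuous_on (cball 0 1) (\<lambda>y. \<Sum>b\<in>Basis. p b y *\<^sub>R b)"
  by (intro continuous_intros cp)

lemma boundary_first_order:
  assumes y: "y \<in> sphere 0 1" and b: "b \<in> Basis" shows "p b y = normal_deriv y * (y \<bullet> b)"
proof -
  have "(\<Sum>b\<in>Basis. p b y *\<^sub>R b) = ((\<Sum>b\<in>Basis. p b y *\<^sub>R b) \<bullet> y) *\<^sub>R y"
    by (rule boundary_gradient[OF cu gradient_u continuous_gradient_u u0 y])
  then have "(\<Sum>b\<in>Basis. p b y *\<^sub>R b) \<bullet> b = (((\<Sum>b\<in>Basis. p b y *\<^sub>R b) \<bullet> y) *\<^sub>R y) \<bullet> b" by simp
  then show ?thesis using b by (simp add: inner_sum_left normal_deriv_def inner_Basis if_distrib[of "\<lambda>x. _ * x"] cong: if_cong)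
qed

lemma normal_deriv_nonneg:
  assumes "\<And>y. y \<in> ball 0 1 \<Longrightarrow> u y \<le> 0" shows "normal_deriv x \<ge> 0"
  using boundary_gradient_nonneg[OF cu gradient_u continuous_gradient_u u0 assms x]
  by (simp add: inner_sum_left normal_deriv_def)

lemma boundary_second_order:
  "\<exists>P Q. \<forall>a\<in>Basis. \<forall>b\<in>Basis. q b a x = normal_deriv x * (a \<bullet> b) + (x \<bullet> b) * Q a + (x \<bullet> a) * P b"
proof -
  define Q where "Q a = (\<Sum>c\<in>Basis. q c a x * (c \<bullet> x)) + p a x" for a
  define r where "r b a y = q b a y - (a \<bullet> b) * normal_deriv y - (y \<bullet> b) * ((\<Sum>c\<in>Basis. q c a y * (c \<bullet> y)) + p a y)" for b a y
  define G where "G b y = (\<Sum>a\<in>Basis. r b a y *\<^sub>R a)" for b y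
  have *: "q b a x = normal_deriv x * (a \<bullet> b) + (x \<bullet> b) * Q a + (x \<bullet> a) * (G b x \<bullet> x)"
    if a: "a \<in> Basis" and b: "b \<in> Basis" for a b
  proof -
    \<comment> \<open>A component of the tangential gradient: it is 0 on the sphere by
      \<open>boundary_first_order\<close>. Its gradient \<open>G b\<close> is written with
      \<open>p\<close> and \<open>q\<close> and therefore continuous up to the sphere, as
      \<open>boundary_gradient\<close> demands.\<close>
    define g where "g y = p b y - (y \<bullet> b) * normal_deriv y" for y
    have "G b x = (G b x \<bullet> x) *\<^sub>R x"
    proof (rule boundary_gradient[where g = g, OF _ _ _ _ x])
      show "continuous_on (cball 0 1) g"
        unfolding g_def normal_deriv_def by (intro continuous_intros cp)
      show "continuous_on (cball 0 1) (G b)"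
        unfolding G_def r_def normal_deriv_def by (intro continuous_intros cp cq)
      show "g y = 0" if "y \<in> sphere 0 1" for y using boundary_first_order[OF that b] by (simp add: g_def)
      show "(g has_derivative (\<lambda>v. G b y \<bullet> v)) (at y)" if y: "y \<in> ball 0 1" for y
        unfolding G_def
      proof (rule has_derivative_gradient)
        show "(g has_derivative (\<lambda>v. q b v y - ((v \<bullet> b) * normal_deriv y + (y \<bullet> b) * (\<Sum>c\<in>Basis. q c v y * (c \<bullet> y) + p c y * (c \<bullet> v))))) (at y)"
          unfolding g_def normal_deriv_def
          by (auto intro!: derivative_eq_intros dp[OF y] simp: fun_eq_iff add.commute)
        show "q b a y - ((a \<bullet> b) * normal_deriv y + (y \<bullet> b) * (\<Sum>c\<in>Basis. q c a y * (c \<bullet> y) + p c y * (c \<bullet> a))) = r b a y"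
          if "a \<in> Basis" for a
          using that by (simp add: r_def sum.distrib inner_Basis if_distrib[of "\<lambda>x. _ * x"] algebra_simps cong: if_cong)
      qed
    qed
    then have "G b x \<bullet> a = ((G b x \<bullet> x) *\<^sub>R x) \<bullet> a" by simp
    moreover have "G b x \<bullet> a = r b a x"
      using a by (simp add: G_def inner_sum_left inner_Basis if_distrib[of "\<lambda>x. _ * x"] cong: if_cong)
    ultimately show ?thesis by (simp add: r_def Q_def algebra_simps)
  qed
  show ?thesis by (rule exI[of _ "\<lambda>b. G b x \<bullet> x"], rule exI[of _ Q], intro ballI, rule *)
qed

end

text \<open>The left sides are dz u and, as in \<open>second_wirtinger\<close>, the complex Hessian
  in terms of real derivatives. For l = m the multiple of the identity enters through both real
  directions, and division by 4 leaves \<open>\<nu> / 2\<close>, the h of the flux; the terms with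
  \<open>Q\<close> and \<open>P\<close> become the two rank-one matrices.\<close>

lemma boundary_complex_hessian:
  fixes p :: "complex^'n \<Rightarrow> complex^'n \<Rightarrow> real" and x :: "complex^'n"
  assumes p: "\<And>b. b \<in> Basis \<Longrightarrow> p b x = \<nu> * (x \<bullet> b)"
    and q: "\<And>a b. a \<in> Basis \<Longrightarrow> b \<in> Basis \<Longrightarrow> q b a x = \<nu> * (a \<bullet> b) + (x \<bullet> b) * Q a + (x \<bullet> a) * P b"
  shows "(of_real (p (axis l 1) x) - \<i> * of_real (p (axis l \<i>) x)) / 2 = of_real (\<nu> / 2) * cnj (x $ l)"
    and "\<exists>\<alpha> \<beta>. \<forall>l m. (of_real (q (axis m 1) (axis l 1) x) + of_real (q (axis m \<i>) (axis l \<i>) x)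
           + \<i> * (of_real (q (axis m \<i>) (axis l 1) x) - of_real (q (axis m 1) (axis l \<i>) x))) / 4
         = (if l = m then of_real (\<nu> / 2) else 0) + \<alpha> l * x $ m + cnj (x $ l) * \<beta> m"
proof -
  have B: "(axis l 1 :: complex^'n) \<in> Basis" "axis l \<i> \<in> Basis" for l :: 'n by (simp_all add: axis_in_Basis_iff Basis_complex_def)
  have xi: "x \<bullet> axis l 1 = Re (x $ l)" "x \<bullet> axis l \<i> = Im (x $ l)" for l
    by (simp_all add: inner_axis inner_complex_def)
  show "(of_real (p (axis l 1) x) - \<i> * of_real (p (axis l \<i>) x)) / 2 = of_real (\<nu> / 2) * cnj (x $ l)"
    by (simp add: p B xi complex_eq_iff)
  show "\<exists>\<alpha> \<beta>. \<forall>l m. (of_real (q (axis m 1) (axis l 1) x) + of_real (q (axis m \<i>) (axis l \<i>) x)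
           + \<i> * (of_real (q (axis m \<i>) (axis l 1) x) - of_real (q (axis m 1) (axis l \<i>) x))) / 4
         = (if l = m then of_real (\<nu> / 2) else 0) + \<alpha> l * x $ m + cnj (x $ l) * \<beta> m"
  proof (intro exI allI)
    fix l m :: 'n
    have aa: "axis l s \<bullet> axis m t = (if l = m then s \<bullet> t else 0)" for s t :: complex
      by (rule inner_axis_axis)
    show "(of_real (q (axis m 1) (axis l 1) x) + of_real (q (axis m \<i>) (axis l \<i>) x)
           + \<i> * (of_real (q (axis m \<i>) (axis l 1) x) - of_real (q (axis m 1) (axis l \<i>) x))) / 4
         = (if l = m then of_real (\<nu> / 2) else 0) + (\<lambda>l. (of_real (Q (axis l 1)) - \<i> * of_real (Q (axis l \<i>))) / 4) l * x $ m
           + cnj (x $ l) * (\<lambda>m. (of_real (P (axis m 1)) + \<i> * of_real (P (axis m \<i>))) / 4) m"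
      unfolding q[OF B(1) B(1)] q[OF B(2) B(1)] q[OF B(1) B(2)] q[OF B(2) B(2)] xi aa
      by (cases "l = m") (simp_all add: complex_eq_iff inner_complex_def field_simps)
  qed
qed

text \<open>The graph of x^(k+1) lies above its tangent at \<open>h\<close>, here at the point
  \<open>c\<close>; equality holds for h = c. The induction step exhibits the difference as a
  multiple of (h - c)^2.\<close>

lemma young_power:
  fixes h c :: real
  assumes "h \<ge> 0" "c \<ge> 0"
  shows "real k * h ^ (k + 1) - (real k + 1) * c * h ^ k + c ^ (k + 1) \<ge> 0"
proof (induction k)
  case 0
  then show ?case by simp
next
  case (Suc k)
  have "real (Suc k) * h ^ (Suc k + 1) - (real (Suc k) + 1) * c * h ^ Suc k + c ^ (Suc k + 1)
      = c * (real k * h ^ (k + 1) - (real k + 1) * c * h ^ k + c ^ (k + 1)) + (real k + 1) * h ^ k * (h - c)\<^sup>2"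
    by (simp add: algebra_simps power2_eq_square)
  also have "\<dots> \<ge> 0"
  proof (rule add_nonneg_nonneg)
    show "0 \<le> c * (real k * h ^ (k + 1) - (real k + 1) * c * h ^ k + c ^ (k + 1))"
      by (rule mult_nonneg_nonneg[OF assms(2) Suc])
    show "0 \<le> (real k + 1) * h ^ k * (h - c)\<^sup>2" using assms by simp
  qed
  finally show ?case .
qed

section \<open>Continuity of the field up to the sphere\<close>

lemma continuous_on_det:
  fixes M :: "'a::topological_space \<Rightarrow> complex^'n^'n"
  assumes "\<And>i j. continuous_on S (\<lambda>x. M x $ i $ j)"
  shows "continuous_on S (\<lambda>x. det (M x))"
  unfolding det_def by (intro continuous_intros assms)

lemma continuous_on_cof_shift:
  fixes M :: "'a::topological_space \<Rightarrow> complex^'n^'n"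
  assumes M: "\<And>i j. continuous_on S (\<lambda>x. M x $ i $ j)"
  shows "continuous_on S (\<lambda>x. cof (shift (M x) t) l m)"
  unfolding cof_def
proof (rule continuous_on_det)
  fix i j
  show "continuous_on S (\<lambda>x. (\<chi> i. if i = l then axis m 1 else shift (M x) t $ i) $ i $ j)"
    by (cases "i = l") (auto simp: shift_def intro!: continuous_intros M)
qed

lemma continuous_on_pohozaev_field:
  fixes H :: "complex^'n \<Rightarrow> complex^'n^'n"
  assumes "\<And>i j. continuous_on S (\<lambda>x. H x $ i $ j)" "\<And>l. continuous_on S (\<lambda>x. U x l)" "continuous_on S s"
  shows "continuous_on S (\<lambda>z. pohozaev_field \<gamma> K1 K2 K3 (H z) (U z) (s z) z m)"
  unfolding pohozaev_field_def Tk_def Rk_def lam_def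
  by (intro continuous_intros continuous_on_cof_shift assms)

text \<open>\<open>p b\<close> and \<open>q b v\<close> carry the boundary values of the first and
  second derivatives. \<open>frechet_derivative\<close> cannot supply them, since it would depend on
  the values of u outside the ball.\<close>

definition C2_extension :: "('a::euclidean_space \<Rightarrow> real) \<Rightarrow> ('a \<Rightarrow> 'a \<Rightarrow> real) \<Rightarrow> ('a \<Rightarrow> 'a \<Rightarrow> 'a \<Rightarrow> real) \<Rightarrow> bool" where
  "C2_extension u p q \<longleftrightarrow> continuous_on (cball 0 1) u \<and> (\<forall>b. continuous_on (cball 0 1) (p b)) \<and>
     (\<forall>b v. continuous_on (cball 0 1) (q b v)) \<and>
     (\<forall>y\<in>ball 0 1. \<forall>b. p b y = frechet_derivative u (at y) b \<and> (p b has_derivative (\<lambda>v. q b v y)) (at y)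
       \<and> (\<forall>v. q b v y = D2 u y b v))"

text \<open>\<open>Ck_closure\<close> differentiates the extension of the first derivative, not the
  derivative itself; in the open ball both agree near every point, so \<open>q\<close> does extend
  the second derivatives of \<open>u\<close>.\<close>

lemma Ck_closure_2_extension:
  fixes u :: "'a::euclidean_space \<Rightarrow> real"
  assumes "Ck_closure 2 (ball 0 1) u"
  obtains p q where "C2_extension u p q"
proof -
  have cl: "closure (ball (0::'a) 1) = cball 0 1" by simp
  have u: "continuous_on (cball 0 1) u" "\<And>y. y \<in> ball 0 1 \<Longrightarrow> u differentiable (at y)"
    "\<forall>v. \<exists>g. Ck_closure (Suc 0) (ball 0 1) g \<and> (\<forall>x\<in>ball 0 1. g x = frechet_derivative u (at x) v)"
    using assms unfolding numeral_2_eq_2 Ck_closure.simps(2)[of "Suc 0"] cl by auto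
  obtain p where p: "\<And>v. Ck_closure (Suc 0) (ball 0 1) (p v)" "\<And>v y. y \<in> ball 0 1 \<Longrightarrow> p v y = frechet_derivative u (at y) v"
    using u(3) by metis
  have p': "continuous_on (cball 0 1) (p v)" "\<And>y. y \<in> ball 0 1 \<Longrightarrow> p v differentiable (at y)"
    "\<forall>w. \<exists>g. continuous_on (cball 0 1) g \<and> (\<forall>x\<in>ball 0 1. g x = frechet_derivative (p v) (at x) w)" for v
    using p(1)[of v] unfolding Ck_closure.simps cl by auto
  obtain q where q: "\<And>v w. continuous_on (cball 0 1) (q v w)" "\<And>v w y. y \<in> ball 0 1 \<Longrightarrow> q v w y = frechet_derivative (p v) (at y) w"
    using p'(3) by metis
  have d: "(p b has_derivative (\<lambda>v. q b v y)) (at y)" if "y \<in> ball 0 1" for b y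
    using p'(2)[OF that, of b] q(2)[OF that, of b] by (simp add: frechet_derivative_works del: mem_ball)
  have D: "q b v y = D2 u y b v" if y: "y \<in> ball 0 1" for b v y
    unfolding q(2)[OF y]
    by (rule fun_cong[OF frechet_derivative_transform_within_open[OF p'(2)[OF y] open_ball y p(2)]])
  have "C2_extension u p q" unfolding C2_extension_def using u(1) p'(1) p(2) q(1) d D by blast
  then show ?thesis by (rule that)
qed

section \<open>The maximum principle\<close>

lemma D2_cx:
  assumes S: "open S" "z \<in> S" and u: "CC (Suc (Suc 0)) S u"
  shows "D2 (cx u) z v w = of_real (D2 u z v w)"
proof -
  have d: "(\<lambda>y. frechet_derivative u (at y) v) differentiable (at z)"
    by (rule CC_differentiable[OF CC_SucD(2)[OF u] S(2)])
  have "of_real (D2 u z v w) = frechet_derivative (\<lambda>y. complex_of_real (frechet_derivative u (at y) v)) (at z) w"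
    by (rule frechet_compose_linear[OF bounded_linear_of_real d, symmetric])
  also have "\<dots> = D2 (cx u) z v w"
  proof (rule fun_cong[OF frechet_derivative_transform_within_open[OF differentiable_cx[OF d] S]])
    show "complex_of_real (frechet_derivative u (at y) v) = frechet_derivative (cx u) (at y) v" if "y \<in> S" for y
      by (rule frechet_compose_linear[OF bounded_linear_of_real CC_differentiable[OF u that], symmetric])
  qed
  finally show ?thesis by simp
qed

lemma frechet_wirtinger:
  fixes f :: "complex^'n \<Rightarrow> complex"
  assumes "f differentiable (at z)"
  shows "frechet_derivative f (at z) \<zeta> = (\<Sum>l\<in>UNIV. \<zeta> $ l * dz l f z + cnj (\<zeta> $ l) * dzbar l f z)"
proof -
  let ?f = "frechet_derivative f (at z)"
  have l: "linear ?f" by (rule linear_frechet_derivative[OF assms])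
  have "?f \<zeta> = ?f (\<Sum>b\<in>Basis. (\<zeta> \<bullet> b) *\<^sub>R b)" by (simp add: euclidean_representation)
  also have "\<dots> = (\<Sum>b\<in>Basis. (\<zeta> \<bullet> b) *\<^sub>R ?f b)" using l by (simp add: linear_sum linear_cmul)
  also have "\<dots> = (\<Sum>m\<in>UNIV. Re (\<zeta> $ m) *\<^sub>R ?f (axis m 1) + Im (\<zeta> $ m) *\<^sub>R ?f (axis m \<i>))"
    unfolding sum_Basis_complex_vec by (simp add: inner_axis inner_complex_def)
  also have "\<dots> = (\<Sum>l\<in>UNIV. \<zeta> $ l * dz l f z + cnj (\<zeta> $ l) * dzbar l f z)"
    by (rule sum.cong) (simp_all add: dz_def dzbar_def complex_eq_iff field_simps)
  finally show ?thesis .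
qed

lemma D2_wirtinger:
  fixes f :: "complex^'n \<Rightarrow> complex"
  assumes S: "open S" "z \<in> S" and f: "CC (Suc (Suc 0)) S f"
  shows "D2 f z \<zeta> \<zeta> = (\<Sum>l\<in>UNIV. \<Sum>m\<in>UNIV. \<zeta> $ l * \<zeta> $ m * dz m (dz l f) z + \<zeta> $ l * cnj (\<zeta> $ m) * dzbar m (dz l f) z
     + (cnj (\<zeta> $ l) * \<zeta> $ m * dz m (dzbar l f) z + cnj (\<zeta> $ l) * cnj (\<zeta> $ m) * dzbar m (dzbar l f) z))"
proof -
  have d: "dz l f differentiable (at z)" "dzbar l f differentiable (at z)" for l
    by (rule CC_differentiable[OF CC_dz[OF S(1) f] S(2)] CC_differentiable[OF CC_dzbar[OF S(1) f] S(2)])+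
  define g where "g y = (\<Sum>l\<in>UNIV. \<zeta> $ l * dz l f y + cnj (\<zeta> $ l) * dzbar l f y)" for y
  have g: "(g has_derivative (\<lambda>v. \<Sum>l\<in>UNIV. \<zeta> $ l * frechet_derivative (dz l f) (at z) v
        + cnj (\<zeta> $ l) * frechet_derivative (dzbar l f) (at z) v)) (at z)"
    unfolding g_def
    by (intro has_derivative_sum has_derivative_add has_derivative_mult_right d[unfolded frechet_derivative_works])
  have "D2 f z \<zeta> \<zeta> = frechet_derivative g (at z) \<zeta>"
  proof (rule fun_cong[OF frechet_derivative_transform_within_open[OF _ S]])
    show "(\<lambda>y. frechet_derivative f (at y) \<zeta>) differentiable (at z)"
      by (rule CC_differentiable[OF CC_SucD(2)[OF f] S(2)])
    show "frechet_derivative f (at y) \<zeta> = g y" if "y \<in> S" for y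
      unfolding g_def by (rule frechet_wirtinger[OF CC_differentiable[OF f that]])
  qed
  also have "\<dots> = (\<Sum>l\<in>UNIV. \<zeta> $ l * frechet_derivative (dz l f) (at z) \<zeta>
        + cnj (\<zeta> $ l) * frechet_derivative (dzbar l f) (at z) \<zeta>)"
    by (simp add: frechet_derivative_eq[OF g])
  finally show ?thesis
    unfolding frechet_wirtinger[OF d(1)] frechet_wirtinger[OF d(2)]
    by (simp add: sum_distrib_left sum.distrib distrib_left mult.assoc)
qed

text \<open>In the sum of the second derivatives along a vector and along \<open>\<i>\<close> times
  it, the terms with two dz or two dzbar cancel and the Levi form remains. This makes real second
  derivatives bound the eigenvalues.\<close>

lemma complex_hessian_form:
  fixes u :: "complex^'n \<Rightarrow> real"
  assumes u4: "CC 4 (ball 0 1) u" and z: "z \<in> ball 0 1"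
  shows "4 * (\<Sum>l\<in>UNIV. \<Sum>m\<in>UNIV. \<zeta> $ l * cnj (\<zeta> $ m) * complex_hessian u z $ l $ m)
    = of_real (D2 u z \<zeta> \<zeta> + D2 u z (\<chi> l. \<i> * \<zeta> $ l) (\<chi> l. \<i> * \<zeta> $ l))"
proof -
  let ?H = "complex_hessian u z"
  have c: "CC (Suc (Suc 0)) (ball 0 1) u" by (rule CC_mono[OF u4]) simp
  note w = D2_wirtinger[OF open_ball z CC_cx[OF open_ball c]]
  have h: "dzbar m (dz l (cx u)) z = ?H $ l $ m" "dz l (dzbar m (cx u)) z = ?H $ l $ m" for l m
    using hessian_eq[OF u4 z] by (simp_all add: complex_hessian_def)
  have sw: "(\<Sum>l\<in>UNIV. \<Sum>m\<in>UNIV. cnj (\<zeta> $ l) * \<zeta> $ m * ?H $ m $ l) = (\<Sum>l\<in>UNIV. \<Sum>m\<in>UNIV. \<zeta> $ l * cnj (\<zeta> $ m) * ?H $ l $ m)"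
    by (subst sum.swap) (simp add: mult_ac)
  have "of_real (D2 u z \<zeta> \<zeta> + D2 u z (\<chi> l. \<i> * \<zeta> $ l) (\<chi> l. \<i> * \<zeta> $ l))
      = (\<Sum>l\<in>UNIV. \<Sum>m\<in>UNIV. 2 * (\<zeta> $ l * cnj (\<zeta> $ m) * ?H $ l $ m) + 2 * (cnj (\<zeta> $ l) * \<zeta> $ m * ?H $ m $ l))"
    unfolding of_real_add D2_cx[OF open_ball z c, symmetric] w h sum.distrib[symmetric]
    by (intro sum.cong refl) (simp add: algebra_simps)
  also have "\<dots> = 4 * (\<Sum>l\<in>UNIV. \<Sum>m\<in>UNIV. \<zeta> $ l * cnj (\<zeta> $ m) * ?H $ l $ m)"
    unfolding sum.distrib sum_distrib_left[symmetric] sw by simp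
  finally show ?thesis by simp
qed

lemma second_derivative_local_max:
  fixes \<phi> :: "real \<Rightarrow> real"
  assumes d: "d > 0" and D: "\<And>s. \<bar>s\<bar> < d \<Longrightarrow> (\<phi> has_field_derivative \<phi>' s) (at s)"
    and DD: "(\<phi>' has_field_derivative c) (at 0)" and max: "\<And>s. \<bar>s\<bar> < d \<Longrightarrow> \<phi> s \<le> \<phi> 0"
  shows "c \<le> 0"
proof (rule ccontr)
  assume "\<not> c \<le> 0"
  then have "c > 0" by simp
  have "\<phi>' 0 = 0" by (rule DERIV_local_max[OF D d]) (use d max in auto)
  then obtain e where e: "e > 0" "\<And>h. h > 0 \<Longrightarrow> h < e \<Longrightarrow> \<phi>' h > 0"
    using DERIV_pos_inc_right[OF DD \<open>c > 0\<close>] by auto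
  define s where "s = min d e / 2"
  have s: "0 < s" "s < d" "s < e" using d e by (auto simp: s_def)
  obtain t where t: "0 < t" "t < s" "\<phi> s - \<phi> 0 = (s - 0) * \<phi>' t"
    using MVT2[OF s(1), of \<phi> \<phi>'] D s by (metis abs_of_nonneg order_le_less_trans)
  then have "\<phi> s - \<phi> 0 > 0" using e(2)[of t] s by simp
  then show False using max[of s] s by simp
qed

lemma D2_local_max:
  fixes u :: "'a::euclidean_space \<Rightarrow> real"
  assumes c: "CC (Suc (Suc 0)) (ball 0 1) u" and z: "z \<in> ball 0 1"
    and max: "\<And>y. y \<in> ball 0 1 \<Longrightarrow> u y + e * (y \<bullet> y) \<le> u z + e * (z \<bullet> z)"
  shows "D2 u z \<zeta> \<zeta> \<le> - 2 * e * (\<zeta> \<bullet> \<zeta>)"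
proof -
  obtain r where r: "r > 0" "ball z r \<subseteq> ball 0 1" using openE[OF open_ball z] by blast
  define d where "d = r / (norm \<zeta> + 1)"
  have pos: "norm \<zeta> + 1 > 0" by (simp add: add_nonneg_pos)
  have d: "d > 0" using r pos by (simp add: d_def)
  have inB: "z + s *\<^sub>R \<zeta> \<in> ball 0 1" if "\<bar>s\<bar> < d" for s
  proof -
    have "\<bar>s\<bar> * norm \<zeta> \<le> d * norm \<zeta>" using that by (intro mult_right_mono) auto
    also have "\<dots> < d * (norm \<zeta> + 1)" using d by (simp add: algebra_simps)
    also have "\<dots> = r" using pos by (simp add: d_def)
    finally have "z + s *\<^sub>R \<zeta> \<in> ball z r" by (simp add: dist_norm)
    then show ?thesis using r by blast
  qed
  define \<phi> where "\<phi> s = u (z + s *\<^sub>R \<zeta>) + e * ((z + s *\<^sub>R \<zeta>) \<bullet> (z + s *\<^sub>R \<zeta>))" for s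
  define \<phi>' where "\<phi>' s = frechet_derivative u (at (z + s *\<^sub>R \<zeta>)) \<zeta> + 2 * e * ((z + s *\<^sub>R \<zeta>) \<bullet> \<zeta>)" for s
  have line: "((\<lambda>s. z + s *\<^sub>R \<zeta>) has_derivative (\<lambda>t. t *\<^sub>R \<zeta>)) (at s)" for s
    by (auto intro!: derivative_eq_intros)
  have along: "((\<lambda>s. f (z + s *\<^sub>R \<zeta>)) has_field_derivative f' \<zeta>) (at s)"
    if "(f has_derivative f') (at (z + s *\<^sub>R \<zeta>))" for f f' and s :: real
  proof -
    have "((\<lambda>s. f (z + s *\<^sub>R \<zeta>)) has_derivative (\<lambda>t. f' (t *\<^sub>R \<zeta>))) (at s)"
      by (rule has_derivative_compose[OF line that])
    then show ?thesis using has_derivative_linear[OF that]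
      by (simp add: has_field_derivative_def linear_cmul mult.commute[of _ "f' _"])
  qed
  have "D2 u z \<zeta> \<zeta> + 2 * e * (\<zeta> \<bullet> \<zeta>) \<le> 0"
  proof (rule second_derivative_local_max[OF d])
    show "(\<phi> has_field_derivative \<phi>' s) (at s)" if "\<bar>s\<bar> < d" for s
    proof -
      have "((\<lambda>y. e * (y \<bullet> y)) has_derivative (\<lambda>v. e * (2 * ((z + s *\<^sub>R \<zeta>) \<bullet> v)))) (at (z + s *\<^sub>R \<zeta>))"
        by (auto intro!: derivative_eq_intros simp: inner_commute)
      from has_derivative_add[OF CC_SucD(1)[OF c inB[OF that]] this]
      show ?thesis using along[of "\<lambda>y. u y + e * (y \<bullet> y)"] unfolding \<phi>_def \<phi>'_def by (auto simp: mult_ac)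
    qed
    show "(\<phi>' has_field_derivative D2 u z \<zeta> \<zeta> + 2 * e * (\<zeta> \<bullet> \<zeta>)) (at 0)"
    proof -
      have "((\<lambda>y. 2 * e * (y \<bullet> \<zeta>)) has_derivative (\<lambda>v. 2 * e * (v \<bullet> \<zeta>))) (at z)"
        by (auto intro!: derivative_eq_intros)
      from has_derivative_add[OF CC_SucD(1)[OF CC_SucD(2)[OF c] z] this]
      show ?thesis using along[of "\<lambda>y. frechet_derivative u (at y) \<zeta> + 2 * e * (y \<bullet> \<zeta>)" _ 0] unfolding \<phi>'_def by auto
    qed
    show "\<phi> s \<le> \<phi> 0" if "\<bar>s\<bar> < d" for s
      using max[OF inB[OF that]] by (simp add: \<phi>_def)
  qed
  then show ?thesis by simp
qed

text \<open>By \<open>complex_hessian_form\<close> an eigenvalue times the squared norm N of an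
  eigenvector is a quarter of the sum of two real second derivatives, each at most - 2 e N by
  \<open>D2_local_max\<close>.\<close>

lemma eigvals_at_max:
  fixes u :: "complex^'n \<Rightarrow> real"
  assumes u4: "CC 4 (ball 0 1) u" and z: "z \<in> ball 0 1"
    and max: "\<And>y. y \<in> ball 0 1 \<Longrightarrow> u y + e * (y \<bullet> y) \<le> u z + e * (z \<bullet> z)"
  shows "eigvals (complex_hessian u z) i \<le> - e"
proof -
  let ?H = "complex_hessian u z" and ?\<mu> = "eigvals (complex_hessian u z) i"
  have c: "CC (Suc (Suc 0)) (ball 0 1) u" by (rule CC_mono[OF u4]) simp
  obtain x where x: "x \<noteq> 0" "?H *v x = of_real ?\<mu> *s x"
    using eigvals_eigenvector[OF hessian_hermitian[OF u4 z]] by blast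
  define N where "N = (\<Sum>l\<in>UNIV. (cmod (x $ l))\<^sup>2)"
  have N: "N > 0" unfolding N_def by (rule norm_complex_vec_pos[OF x(1)])
  \<comment> \<open>Conjugated because \<open>hermitian_eigenvalue_form\<close> conjugates the
    vector at the row index and \<open>complex_hessian_form\<close> at the column index.\<close>
  define \<zeta> where "\<zeta> = (\<chi> l. cnj (x $ l))"
  have "4 * (of_real ?\<mu> * of_real N) = 4 * (\<Sum>l\<in>UNIV. \<Sum>m\<in>UNIV. \<zeta> $ l * cnj (\<zeta> $ m) * ?H $ l $ m)"
    using hermitian_eigenvalue_form[OF x(2)] by (simp add: \<zeta>_def N_def)
  also have "\<dots> = of_real (D2 u z \<zeta> \<zeta> + D2 u z (\<chi> l. \<i> * \<zeta> $ l) (\<chi> l. \<i> * \<zeta> $ l))"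
    by (rule complex_hessian_form[OF u4 z])
  finally have "complex_of_real (4 * (?\<mu> * N)) = of_real (D2 u z \<zeta> \<zeta> + D2 u z (\<chi> l. \<i> * \<zeta> $ l) (\<chi> l. \<i> * \<zeta> $ l))"
    by simp
  then have "4 * (?\<mu> * N) = D2 u z \<zeta> \<zeta> + D2 u z (\<chi> l. \<i> * \<zeta> $ l) (\<chi> l. \<i> * \<zeta> $ l)"
    by (simp only: of_real_eq_iff)
  also have "\<dots> \<le> - 2 * e * (\<zeta> \<bullet> \<zeta>) + - 2 * e * ((\<chi> l. \<i> * \<zeta> $ l) \<bullet> (\<chi> l. \<i> * \<zeta> $ l))"
    by (intro add_mono D2_local_max[OF c z max])
  also have "\<zeta> \<bullet> \<zeta> = N"
    by (simp add: inner_vec_def \<zeta>_def N_def dot_square_norm)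
  also have "(\<chi> l. \<i> * \<zeta> $ l) \<bullet> (\<chi> l. \<i> * \<zeta> $ l) = N"
    by (simp add: inner_vec_def \<zeta>_def N_def dot_square_norm norm_mult)
  finally have "(?\<mu> + e) * N \<le> 0" by (simp add: algebra_simps)
  then show ?thesis using N by (simp add: mult_le_0_iff)
qed

text \<open>If \<open>u\<close> were positive somewhere, a small multiple of the squared norm could
  be added such that the maximum is still interior. There all eigenvalues are negative, hence so is
  every \<open>Sk j\<close> with j odd; for even j the sign would give no contradiction.\<close>

lemma nonpos_of_odd_hessian:
  fixes u :: "complex^'n \<Rightarrow> real"
  assumes u4: "CC 4 (ball 0 1) u" and cu: "continuous_on (cball 0 1) u"
    and u0: "\<And>z. z \<in> sphere 0 1 \<Longrightarrow> u z = 0"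
    and j: "odd j" "j \<le> CARD('n)" and S: "\<And>z. z \<in> ball 0 1 \<Longrightarrow> 0 \<le> Sk j (complex_hessian u z)"
    and y: "y \<in> ball 0 1"
  shows "u y \<le> 0"
proof (rule ccontr)
  assume "\<not> u y \<le> 0"
  then have uy: "u y > 0" by simp
  \<comment> \<open>On the sphere the perturbed function equals e, which is less than u y, so the
    maximum is not attained there.\<close>
  define e where "e = u y / 2"
  have e: "e > 0" using uy by (simp add: e_def)
  have "continuous_on (cball 0 1) (\<lambda>x. u x + e * (x \<bullet> x))" by (intro continuous_intros cu)
  moreover have "cball (0::complex^'n) 1 \<noteq> {}" by simp
  ultimately have "\<exists>z\<in>cball 0 1. \<forall>x\<in>cball 0 1. u x + e * (x \<bullet> x) \<le> u z + e * (z \<bullet> z)"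
    by (rule continuous_attains_sup[OF compact_cball, rotated])
  then obtain z where z: "z \<in> cball 0 1" and max: "\<And>x. x \<in> cball 0 1 \<Longrightarrow> u x + e * (x \<bullet> x) \<le> u z + e * (z \<bullet> z)"
    by blast
  have "z \<in> ball 0 1"
  proof (rule ccontr)
    assume "z \<notin> ball 0 1"
    then have "z \<in> sphere 0 1" using z by auto
    then have "u z + e * (z \<bullet> z) = e" using u0 by (simp add: dot_square_norm)
    moreover have "u y \<le> u y + e * (y \<bullet> y)" using e by simp
    moreover have "u y + e * (y \<bullet> y) \<le> u z + e * (z \<bullet> z)" using max[of y] y by simp
    moreover have "e < u y" using uy by (simp add: e_def)
    ultimately show False by linarith
  qed
  have neg: "eigvals (complex_hessian u z) i < 0" for i
    using eigvals_at_max[OF u4 \<open>z \<in> ball 0 1\<close> max, of i] e by simp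
  have "0 < (\<Sum>I | I \<subseteq> (UNIV :: 'n set) \<and> card I = j. - (\<Prod>i\<in>I. eigvals (complex_hessian u z) i))"
  proof (rule sum_pos)
    show "finite {I. I \<subseteq> (UNIV :: 'n set) \<and> card I = j}" by simp
    obtain I :: "'n set" where "card I = j" using obtain_subset_with_card_n[OF j(2)] by blast
    then show "{I. I \<subseteq> (UNIV :: 'n set) \<and> card I = j} \<noteq> {}" by auto
    fix I :: "'n set" assume "I \<in> {I. I \<subseteq> (UNIV :: 'n set) \<and> card I = j}"
    then have "- (\<Prod>i\<in>I. eigvals (complex_hessian u z) i) = (\<Prod>i\<in>I. - eigvals (complex_hessian u z) i)"
      using j(1) by (simp add: prod_uminus)
    also have "\<dots> > 0" using neg by (simp add: prod_pos)
    finally show "0 < - (\<Prod>i\<in>I. eigvals (complex_hessian u z) i)" .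
  qed
  then have "Sk j (complex_hessian u z) < 0" by (simp add: Sk_def elem_sym_def sum_negf)
  then show False using S[OF \<open>z \<in> ball 0 1\<close>] by simp
qed

section \<open>Nonexistence\<close>

lemma set_integrable_ball:
  fixes f :: "'a::euclidean_space \<Rightarrow> real"
  assumes "continuous_on (cball 0 1) f"
  shows "set_integrable lborel (ball 0 1) f"
proof (rule set_integrable_subset[of _ "cball 0 1"])
  show "set_integrable lborel (cball 0 1) f"
    unfolding set_integrable_def by (rule borel_integrable_compact) (use assms in auto)
qed auto

lemma set_integral_ball_const:
  "(LINT x:ball (0::'a::euclidean_space) 1|lborel. c) = c * measure lborel (ball (0::'a) 1)"
  using emeasure_lborel_ball_finite[of "0::'a" 1] by (simp add: set_lebesgue_integral_def)

lemma dirichlet_solution_nonpos: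
  fixes u :: "complex^'n \<Rightarrow> real"
  assumes k: "1 \<le> k" "k \<le> CARD('n)" and a: "a > 0"
    and sol: "dirichlet_solution k a u" and adm: "even k \<longrightarrow> k_subharmonic k u" and y: "y \<in> ball 0 1"
  shows "u y \<le> 0"
proof -
  have u4: "CC 4 (ball 0 1) u" using sol by (simp add: dirichlet_solution_def Ck_on_iff_CC)
  have "Ck_closure 2 (ball 0 1) u" using sol by (simp add: dirichlet_solution_def)
  then have cu: "continuous_on (cball 0 1) u"
    by (rule Ck_closure_2_extension) (simp add: C2_extension_def)
  have "0 \<le> (LINT w:ball 0 1|lborel. exp (- u w))"
    unfolding set_lebesgue_integral_def by (rule Bochner_Integration.integral_nonneg) (simp add: indicator_def)
  then have Sk: "0 \<le> Sk k (complex_hessian u z)" if "z \<in> ball 0 1" for z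
    using sol that a by (simp add: dirichlet_solution_def)
  \<comment> \<open>For odd k the equation itself gives the sign of \<open>Sk k\<close>; for even k
    the admissibility condition provides the odd degree 1.\<close>
  define j where "j = (if odd k then k else 1)"
  have "0 \<le> Sk j (complex_hessian u z)" if "z \<in> ball 0 1" for z
    using Sk[OF that] adm that k by (auto simp: j_def k_subharmonic_def)
  moreover have "odd j" "j \<le> CARD('n)" using k by (auto simp: j_def)
  moreover have "u z = 0" if "z \<in> sphere 0 1" for z using sol that by (simp add: dirichlet_solution_def)
  ultimately show ?thesis using nonpos_of_odd_hessian[OF u4 cu _ _ _ _ y] by blast
qed

text \<open>The nonnegative flux of the field F makes the integral of its divergence nonnegative;
  with the equation inserted, this is a bound for a. It is strict, which excludes the critical value
  for k = n.\<close>

theorem dirichlet_solution_bound: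
  fixes u :: "complex^'n \<Rightarrow> real"
  assumes k: "1 \<le> k" "k \<le> CARD('n)" and a: "a > 0"
    and sol: "dirichlet_solution k a u" and adm: "even k \<longrightarrow> k_subharmonic k u"
  shows "a < real CARD('n) * real ((CARD('n) - 1) choose (k - 1)) * (real CARD('n) + 1) ^ (k + 1) / (real k * (real k + 1))
            * measure lborel (ball (0::complex^'n) 1)"
proof -
  let ?B = "ball (0::complex^'n) 1" and ?n = "CARD('n)"
  let ?vol = "measure lborel ?B"
  let ?H = "complex_hessian u"
  have u4: "CC 4 ?B u" using sol by (simp add: dirichlet_solution_def Ck_on_iff_CC)
  have c2: "CC (Suc (Suc 0)) ?B u" by (rule CC_mono[OF u4]) simp
  have c1: "CC (Suc 0) ?B u" by (rule CC_mono[OF u4]) simp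
  have "Ck_closure 2 ?B u" using sol by (simp add: dirichlet_solution_def)
  then obtain p q where pq: "C2_extension u p q" by (rule Ck_closure_2_extension)
  have cu: "continuous_on (cball 0 1) u" using pq by (simp add: C2_extension_def)
  have p: "continuous_on (cball 0 1) (p b)" "\<And>y. y \<in> ?B \<Longrightarrow> p b y = frechet_derivative u (at y) b" for b
    using pq by (simp_all add: C2_extension_def)
  have q: "continuous_on (cball 0 1) (q b v)" "\<And>y. y \<in> ?B \<Longrightarrow> (p b has_derivative (\<lambda>v. q b v y)) (at y)"
    "\<And>y. y \<in> ?B \<Longrightarrow> q b v y = D2 u y b v" for b v
    using pq unfolding C2_extension_def by blast+
  have u0: "u z = 0" if "z \<in> sphere 0 1" for z using sol that by (simp add: dirichlet_solution_def)
  have neg: "u z \<le> 0" if "z \<in> ?B" for z by (rule dirichlet_solution_nonpos[OF k a sol adm that])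
  have vol: "?vol > 0" using content_ball_pos[of 1 "0::complex^'n"] by simp
  define I where "I = (LINT w:?B|lborel. exp (- u w))"
  have iexp: "set_integrable lborel ?B (\<lambda>w. exp (- u w))" by (intro set_integrable_ball continuous_intros cu)
  have "(LINT w:?B|lborel. 1) \<le> I" unfolding I_def
    by (rule set_integral_mono[OF set_integrable_ball[OF continuous_on_const] iexp]) (use neg in simp)
  then have I: "I > 0" using vol unfolding set_integral_ball_const by linarith
  define \<mu> where "\<mu> = a / I"
  have \<mu>: "\<mu> > 0" using a I by (simp add: \<mu>_def)
  have S: "Sk k (?H z) = \<mu> * exp (- u z)" if "z \<in> ?B" for z
    using sol that by (simp add: dirichlet_solution_def \<mu>_def I_def)
  obtain \<gamma> where ex: "extracts ?n (?n - k) \<gamma>" by (rule coefficient_functional)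
  \<comment> \<open>A general c > n would lead to a bound proportional to c^(k+1) / (c - n); for k =
    n this is smallest at c = n + 1.\<close>
  define c where "c = real ?n + 1"
  define C where "C = real ((?n - 1) choose (k - 1))"
  \<comment> \<open>With \<open>K1\<close> and \<open>K2\<close> the flux C h^(k+1) - K1 C h^k + K2
    is C / k times the left side of \<open>young_power\<close>.\<close>
  define K1 where "K1 = c * (real k + 1) / real k"
  define K2 where "K2 = C * c ^ (k + 1) / real k"
  \<comment> \<open>As \<open>Sk k\<close> equals \<open>\<mu> * exp (- u z)\<close>, this value
    cancels the two terms with Re w in \<open>pohozaev_divergence\<close>.\<close>
  define K3 where "K3 = (real k + 1) * \<mu>"
  define F where "F m z = pohozaev_field \<gamma> K1 K2 K3 (?H z) (\<lambda>l. dz l (cx u) z) (u z) z m" for m z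
  \<comment> \<open>The formulas for the complex Hessian and, in \<open>Ux\<close>, for dz u, with
    the extensions \<open>q\<close> and \<open>p\<close> in place of the derivatives: equal to them
    in the ball and continuous up to the sphere.\<close>
  define Hx where "Hx z = (\<chi> l m. (complex_of_real (q (axis m 1) (axis l 1) z) + of_real (q (axis m \<i>) (axis l \<i>) z)
      + \<i> * (of_real (q (axis m \<i>) (axis l 1) z) - of_real (q (axis m 1) (axis l \<i>) z))) / 4)" for z
  define Ux where "Ux z l = (complex_of_real (p (axis l 1) z) - \<i> * of_real (p (axis l \<i>) z)) / 2" for z l
  define G where "G m z = pohozaev_field \<gamma> K1 K2 K3 (Hx z) (Ux z) (u z) z m" for m z
  \<comment> \<open>The divergence after the equation is inserted. No derivative of u is left, so it
    is continuous on the closed ball and integrable.\<close>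
  define D where "D z = (real ?n - real k) * u z * (\<mu> * exp (- u z)) - (real k + 1) * \<mu> * exp (- u z)
      + (real ?n * K2 - real ?n * (real k + 1) * \<mu>)" for z
  have cD: "continuous_on (cball 0 1) D" unfolding D_def by (intro continuous_intros cu)
  have "0 \<le> (LINT z:?B|lborel. D z)"
  proof (rule integral_complex_divergence_nonneg[of F G])
    show "CC (Suc 0) ?B (F m)" for m
      unfolding F_def by (rule pohozaev_divergence(2)[OF u4 _ ex k, where z = 0]) simp
    show "continuous_on (cball 0 1) (G m)" for m
      unfolding G_def Hx_def Ux_def
      by (rule continuous_on_pohozaev_field) (auto intro!: continuous_intros p q cu)
    show "G m z = F m z" if z: "z \<in> ?B" for m z
    proof -
      have "Hx z = ?H z"
        unfolding Hx_def complex_hessian_def second_wirtinger(1)[OF CC_cx[OF open_ball c2] z] D2_cx[OF open_ball z c2] q(3)[OF z] ..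
      moreover have "Ux z l = dz l (cx u) z" for l
        unfolding Ux_def dz_def p(2)[OF z] frechet_compose_linear[OF bounded_linear_of_real CC_differentiable[OF c1 z]] ..
      ultimately show ?thesis unfolding G_def F_def by presburger
    qed
    show "0 \<le> Re (\<Sum>m\<in>UNIV. G m z * z $ m)" if z: "z \<in> sphere 0 1" for z
    proof -
      define \<nu> where "\<nu> = normal_deriv p z"
      have du: "\<exists>u'. (u has_derivative u') (at y) \<and> (\<forall>b. u' b = p b y)" if "y \<in> ?B" for y
        using CC_SucD(1)[OF c1 that] p(2)[OF that] by auto
      have \<nu>: "\<nu> \<ge> 0" unfolding \<nu>_def by (rule normal_deriv_nonneg[OF cu du p(1) q(2,1) u0 z neg])
      obtain P Q where PQ: "\<And>a b. a \<in> Basis \<Longrightarrow> b \<in> Basis \<Longrightarrow> q b a z = \<nu> * (a \<bullet> b) + (z \<bullet> b) * Q a + (z \<bullet> a) * P b"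
        using boundary_second_order[OF cu du p(1) q(2,1) u0 z] unfolding \<nu>_def by metis
      have pz: "p b z = \<nu> * (z \<bullet> b)" if "b \<in> Basis" for b
        unfolding \<nu>_def by (rule boundary_first_order[OF cu du p(1) q(2,1) u0 z z that])
      have U: "Ux z l = of_real (\<nu> / 2) * cnj (z $ l)" for l
        unfolding Ux_def by (rule boundary_complex_hessian(1)[of p z \<nu> q Q P, OF pz PQ])
      obtain \<alpha> \<beta> where Hz: "Hx z $ i $ j = (if i = j then of_real (\<nu> / 2) else 0) + \<alpha> i * z $ j + cnj (z $ i) * \<beta> j" for i j
        using boundary_complex_hessian(2)[of p z \<nu> q Q P, OF pz PQ] unfolding Hx_def vec_lambda_beta by metis
      have "(\<Sum>m\<in>UNIV. G m z * z $ m) = of_real (C * (\<nu> / 2) ^ (k + 1) - K1 * C * (\<nu> / 2) ^ k + K2)"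
        unfolding G_def u0[OF z] C_def by (rule pohozaev_field_sphere[OF ex k Hz U]) (use z in simp)
      also have "C * (\<nu> / 2) ^ (k + 1) - K1 * C * (\<nu> / 2) ^ k + K2
          = C / real k * (real k * (\<nu> / 2) ^ (k + 1) - (real k + 1) * c * (\<nu> / 2) ^ k + c ^ (k + 1))"
        using k by (simp add: K1_def K2_def field_simps)
      finally have "Re (\<Sum>m\<in>UNIV. G m z * z $ m)
          = C / real k * (real k * (\<nu> / 2) ^ (k + 1) - (real k + 1) * c * (\<nu> / 2) ^ k + c ^ (k + 1))"
        by (simp only: Re_complex_of_real)
      also have "\<dots> \<ge> 0" by (rule mult_nonneg_nonneg[OF _ young_power]) (use \<nu> in \<open>simp_all add: C_def c_def\<close>)
      finally show ?thesis .
    qed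
    show "set_integrable lborel ?B D" by (rule set_integrable_ball[OF cD])
    show "Re (\<Sum>m\<in>UNIV. dzbar m (F m) z) = D z" if z: "z \<in> ?B" for z
    proof -
      have K: "K1 * real k = (real k + 1) * (real ?n + 1)" using k by (simp add: K1_def c_def)
      show ?thesis
        unfolding F_def pohozaev_divergence(1)[OF u4 z ex k] S[OF z] K D_def K3_def
        by (simp add: algebra_simps)
    qed
  qed
  \<comment> \<open>The term with n - k is nonpositive since u <= 0. It is 0 for k = n, so nothing
    is lost in that case.\<close>
  also have "\<dots> \<le> (LINT z:?B|lborel. - ((real k + 1) * \<mu>) * exp (- u z) + (real ?n * K2 - real ?n * (real k + 1) * \<mu>))"
  proof (rule set_integral_mono)
    show "set_integrable lborel ?B D" by (rule set_integrable_ball[OF cD])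
    show "set_integrable lborel ?B (\<lambda>z. - ((real k + 1) * \<mu>) * exp (- u z) + (real ?n * K2 - real ?n * (real k + 1) * \<mu>))"
      by (intro set_integrable_ball continuous_intros cu)
    show "D z \<le> - ((real k + 1) * \<mu>) * exp (- u z) + (real ?n * K2 - real ?n * (real k + 1) * \<mu>)" if z: "z \<in> ?B" for z
    proof -
      have "(real ?n - real k) * u z * (\<mu> * exp (- u z)) \<le> 0"
        using neg[OF z] k \<mu> by (intro mult_nonpos_nonneg mult_nonneg_nonpos) auto
      then show ?thesis by (simp add: D_def)
    qed
  qed
  also have "\<dots> = - ((real k + 1) * \<mu>) * I + (real ?n * K2 - real ?n * (real k + 1) * \<mu>) * ?vol"
  proof (subst set_integral_add(2))
    show "set_integrable lborel ?B (\<lambda>z. - ((real k + 1) * \<mu>) * exp (- u z))"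
      by (intro set_integrable_ball continuous_intros cu)
  qed (simp_all only: set_integral_mult_right set_integral_ball_const I_def set_integrable_ball[OF continuous_on_const])
  also have "- ((real k + 1) * \<mu>) * I = - ((real k + 1) * a)" using I by (simp add: \<mu>_def)
  finally have "(real k + 1) * a + real ?n * (real k + 1) * \<mu> * ?vol \<le> real ?n * K2 * ?vol"
    by (simp add: algebra_simps)
  \<comment> \<open>The source of the strict inequality.\<close>
  moreover have "real ?n * (real k + 1) * \<mu> * ?vol > 0" using \<mu> vol by simp
  ultimately have "(real k + 1) * a < real ?n * K2 * ?vol" by linarith
  then have "a < real ?n * K2 * ?vol / (real k + 1)" by (simp add: field_simps)
  also have "real ?n * K2 * ?vol / (real k + 1) = real ?n * C * c ^ (k + 1) / (real k * (real k + 1)) * ?vol"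
    using k by (simp add: K2_def field_simps)
  finally show ?thesis by (simp add: C_def c_def)
qed

lemma measure_ball_complex: "measure lborel (ball (0::complex^'n) 1) = pi ^ CARD('n) / fact CARD('n)"
proof -
  have "DIM(complex^'n) = 2 * CARD('n)" by simp
  then show ?thesis using content_ball[of 1 "0::complex^'n"] unit_ball_vol_even[of "CARD('n)"] by (simp add: mult.commute)
qed

section \<open>The radial solutions\<close>

lemma CC_imp_Ck_closure: "CC k UNIV f \<Longrightarrow> Ck_closure k S f"
proof (induction k arbitrary: f)
  case 0
  then show ?case by (auto intro: continuous_on_subset)
next
  case (Suc k)
  have "continuous_on (closure S) f"
    using CC_continuous[OF Suc.prems] by (rule continuous_on_subset) simp
  moreover have "\<forall>x\<in>S. f differentiable (at x)" using Suc.prems by simp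
  moreover have "\<forall>v. \<exists>g. Ck_closure k S g \<and> (\<forall>x\<in>S. g x = frechet_derivative f (at x) v)"
    using Suc.IH[OF CC_SucD(2)[OF Suc.prems]] by blast
  ultimately show ?case by simp
qed

lemma CC_power:
  fixes f :: "'a::euclidean_space \<Rightarrow> 'b::real_normed_field"
  shows "open S \<Longrightarrow> CC k S f \<Longrightarrow> CC k S (\<lambda>x. f x ^ n)"
  by (induction n) (auto intro: CC_const CC_mult simp del: CC.simps)

lemma CC_inner_self: "open S \<Longrightarrow> CC k S (\<lambda>z::'a::euclidean_space. z \<bullet> z)"
proof (cases k)
  case (Suc j)
  assume S: "open S"
  have d: "((\<lambda>z::'a. z \<bullet> z) has_derivative (\<lambda>v. z \<bullet> v + v \<bullet> z)) (at z)" for z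
    by (auto intro!: derivative_eq_intros)
  show ?thesis unfolding Suc
  proof (rule CC_SucI[OF S d])
    show "CC j S (\<lambda>z. z \<bullet> v + v \<bullet> z)" for v
      by (intro CC_add S CC_bounded_linear bounded_linear_inner_left bounded_linear_inner_right)
  qed
qed (auto intro: continuous_intros)

text \<open>By \<open>cof_scalar_plus_rank_two\<close> the determinant with the rank-one part scaled
  by s has the same derivative \<open>K\<close> for all s, so it is affine in s; s = 0 and s = 1 are
  compared.\<close>

lemma det_scalar_plus_rank_one:
  fixes w z :: "'n::finite \<Rightarrow> complex"
  assumes M: "\<And>i j. M $ i $ j = (if i = j then c else 0) + w i * z j"
  shows "det (M :: complex^'n^'n) = c ^ (CARD('n) - 1) * (c + (\<Sum>l\<in>UNIV. w l * z l))"
proof -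
  define N :: "complex \<Rightarrow> complex^'n^'n" where "N s = (\<chi> i j. (if i = j then c else 0) + s * (w i * z j))" for s
  define K where "K = c ^ (CARD('n) - 1) * (\<Sum>l\<in>UNIV. w l * z l)"
  have "((\<lambda>s. det (N s) - s * K) has_derivative (\<lambda>h. 0)) (at s)" for s
  proof -
    have "((\<lambda>s. det (N s)) has_derivative (\<lambda>h. \<Sum>i\<in>UNIV. \<Sum>j\<in>UNIV. (h * (w i * z j)) * cof (N s) i j)) (at s)"
      by (rule has_derivative_det) (auto simp: N_def intro!: derivative_eq_intros)
    moreover have "(\<Sum>i\<in>UNIV. \<Sum>j\<in>UNIV. (h * (w i * z j)) * cof (N s) i j) = h * K" for h
    proof -
      have "(\<Sum>i\<in>UNIV. \<Sum>j\<in>UNIV. (h * (w i * z j)) * cof (N s) i j) = h * (\<Sum>i\<in>UNIV. \<Sum>j\<in>UNIV. w i * (z j * cof (N s) i j))"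
        by (simp add: sum_distrib_left mult_ac)
      also have "(\<Sum>i\<in>UNIV. \<Sum>j\<in>UNIV. w i * (z j * cof (N s) i j)) = K"
        unfolding K_def by (rule cof_scalar_plus_rank_two[where a = "\<lambda>i. s * w i" and b = "\<lambda>_. 0"]) (simp add: N_def mult_ac)
      finally show ?thesis .
    qed
    ultimately have "((\<lambda>s. det (N s)) has_derivative (\<lambda>h. h * K)) (at s)" by simp
    from has_derivative_diff[OF this has_derivative_mult_left[OF has_derivative_ident, of K]] show ?thesis by simp
  qed
  then obtain d where "\<And>s. det (N s) - s * K = d"
    using has_derivative_zero_constant[of UNIV "\<lambda>s. det (N s) - s * K"] by auto
  then have "det (N 1) - K = det (N 0)" by (metis diff_zero mult_zero_left mult_1)
  moreover have "N 1 = M" by (simp add: N_def vec_eq_iff M)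
  moreover have "det (N 0) = c ^ CARD('n)" by (subst det_diagonal) (simp_all add: N_def)
  moreover have "c ^ CARD('n) = c ^ (CARD('n) - 1) * c"
    using zero_less_card_finite[where 'a = 'n] by (metis Suc_diff_1 mult.commute power_Suc)
  ultimately show ?thesis by (simp add: K_def algebra_simps)
qed

section \<open>The family \<open>u_eps\<close>: Hessian, eigenvalues and mass\<close>

context
  fixes \<epsilon> :: real and g :: "complex^'n \<Rightarrow> real"
  assumes \<epsilon>: "\<epsilon> > 0" and g: "g = (\<lambda>z. inverse (z \<bullet> z + \<epsilon>\<^sup>2))"
begin

lemma g_pos: "z \<bullet> z + \<epsilon>\<^sup>2 > 0" "g z > 0"
proof -
  show "z \<bullet> z + \<epsilon>\<^sup>2 > 0" for z :: "complex^'n" using \<epsilon> by (simp add: add_nonneg_pos)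
  then show "g z > 0" by (simp add: g)
qed

lemma g_derivative: "(g has_derivative (\<lambda>v. - 2 * (z \<bullet> v) * (g z)\<^sup>2)) (at z)"
  unfolding g using g_pos(1)[of z]
  by (auto intro!: derivative_eq_intros simp: inner_commute power2_eq_square)

lemma g_CC: "CC k UNIV g"
  unfolding g
proof (intro CC_inverse CC_add CC_const CC_inner_self open_UNIV)
  show "z \<bullet> z + \<epsilon>\<^sup>2 \<noteq> 0" for z :: "complex^'n" using g_pos(1)[of z] by simp
qed

lemma u_eps_derivative:
  "(u_eps \<epsilon> has_derivative (\<lambda>v. 2 * (real CARD('n) + 1) * ((z \<bullet> v) * g z))) (at (z :: complex^'n))"
  unfolding u_eps_def power2_norm_eq_inner using g_pos(1)[of z]
  by (auto intro!: derivative_eq_intros simp: inner_commute g divide_inverse)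

lemma u_eps_CC: "CC k UNIV (u_eps \<epsilon> :: complex^'n \<Rightarrow> real)"
proof (cases k)
  case 0
  then show ?thesis
    by (auto intro!: continuous_at_imp_continuous_on has_derivative_continuous[OF u_eps_derivative])
next
  case (Suc j)
  show ?thesis unfolding Suc
  proof (rule CC_SucI[OF open_UNIV u_eps_derivative])
    show "CC j UNIV (\<lambda>z. 2 * (real CARD('n) + 1) * ((z \<bullet> v) * g z))" for v :: "complex^'n"
      by (intro CC_cmult CC_mult CC_bounded_linear bounded_linear_inner_left g_CC open_UNIV)
  qed
qed

lemma dzbar_radial:
  assumes "(f has_derivative (\<lambda>v. c * (z \<bullet> v))) (at z)"
  shows "dzbar m (cx f) z = of_real (c / 2) * z $ m"
proof -
  have "(cx f has_derivative (\<lambda>v. of_real (c * (z \<bullet> v)))) (at z)"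
    by (rule bounded_linear.has_derivative[OF bounded_linear_of_real assms])
  from dzbar_eq[OF this] show ?thesis
    by (simp add: inner_axis inner_complex_def complex_eq_iff)
qed

lemma u_eps_hessian:
  "complex_hessian (u_eps \<epsilon>) (z :: complex^'n) $ l $ m
     = (if l = m then of_real ((real CARD('n) + 1) * g z) else 0) + of_real (- (real CARD('n) + 1) * (g z)\<^sup>2) * cnj (z $ l) * z $ m"
proof -
  let ?n = "real CARD('n) + 1"
  have 1: "dzbar m (cx (u_eps \<epsilon>)) = (\<lambda>z. of_real (?n * g z) * z $ m)"
  proof
    fix z :: "complex^'n"
    have "(u_eps \<epsilon> has_derivative (\<lambda>v. (2 * ?n * g z) * (z \<bullet> v))) (at z)"
      using u_eps_derivative[of z] by (simp add: mult_ac)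
    moreover have "2 * ?n * g z / 2 = ?n * g z" by simp
    ultimately show "dzbar m (cx (u_eps \<epsilon>)) z = of_real (?n * g z) * z $ m" using dzbar_radial by metis
  qed
  have d: "((\<lambda>z. of_real (?n * g z) * z $ m) has_derivative
      (\<lambda>v. of_real (?n * g z) * v $ m + of_real (?n * (- 2 * (z \<bullet> v) * (g z)\<^sup>2)) * z $ m)) (at z)"
    by (intro has_derivative_mult bounded_linear.has_derivative[OF bounded_linear_of_real]
        has_derivative_mult_right g_derivative bounded_linear.has_derivative[OF bounded_linear_coord has_derivative_ident])
  have ax: "z \<bullet> axis l 1 = Re (z $ l)" "z \<bullet> axis l \<i> = Im (z $ l)"
    "axis l c $ m = (if l = m then c else 0)" for c :: complex
    by (simp_all add: inner_axis inner_complex_def) (simp add: axis_def)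
  have "complex_hessian (u_eps \<epsilon>) z $ l $ m = dz l (\<lambda>z. of_real (?n * g z) * z $ m) z"
    by (simp only: complex_hessian_def vec_lambda_beta 1)
  also have "\<dots> = (if l = m then of_real (?n * g z) else 0) + of_real (- ?n * (g z)\<^sup>2) * cnj (z $ l) * z $ m"
    unfolding dz_eq[OF d] ax by (cases "l = m") (simp_all add: complex_eq_iff field_simps)
  finally show ?thesis .
qed

lemma sum_cnj_mult: "(\<Sum>l\<in>UNIV. cnj (z $ l) * z $ l) = of_real (z \<bullet> (z :: complex^'n))"
  by (simp add: inner_vec_def complex_eq_iff inner_complex_def)

text \<open>The factors display the eigenvalues: (n + 1) g with multiplicity n - 1 for the
  directions orthogonal to z, and (n + 1) \<open>\<epsilon>\<close>^2 g^2 for the radial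
  direction.\<close>

lemma det_shift_u_eps:
  "det (shift (complex_hessian (u_eps \<epsilon>) (z :: complex^'n)) t)
     = (of_real ((real CARD('n) + 1) * g z) + t) ^ (CARD('n) - 1) * (of_real ((real CARD('n) + 1) * \<epsilon>\<^sup>2 * (g z)\<^sup>2) + t)"
proof -
  let ?n = "real CARD('n) + 1"
  have "det (shift (complex_hessian (u_eps \<epsilon>) z) t) = (of_real (?n * g z) + t) ^ (CARD('n) - 1)
     * ((of_real (?n * g z) + t) + (\<Sum>l\<in>UNIV. of_real (- ?n * (g z)\<^sup>2) * cnj (z $ l) * z $ l))"
    by (rule det_scalar_plus_rank_one) (simp add: shift_def u_eps_hessian)
  also have "(\<Sum>l\<in>UNIV. of_real (- ?n * (g z)\<^sup>2) * cnj (z $ l) * z $ l) = of_real (- ?n * (g z)\<^sup>2 * (z \<bullet> z))"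
    unfolding mult.assoc sum_distrib_left[symmetric] sum_cnj_mult by simp
  also have "(of_real (?n * g z) + t) + of_real (- ?n * (g z)\<^sup>2 * (z \<bullet> z)) = of_real (?n * \<epsilon>\<^sup>2 * (g z)\<^sup>2) + t"
  proof -
    have "g z = (z \<bullet> z + \<epsilon>\<^sup>2) * (g z)\<^sup>2" using g_pos(1)[of z] by (simp add: g power2_eq_square)
    then have "?n * g z = ?n * ((z \<bullet> z + \<epsilon>\<^sup>2) * (g z)\<^sup>2)" by (rule arg_cong)
    then have "?n * g z + - ?n * (g z)\<^sup>2 * (z \<bullet> z) = ?n * \<epsilon>\<^sup>2 * (g z)\<^sup>2" by (simp add: algebra_simps)
    moreover have "of_real a + t + of_real b = of_real (a + b) + t" for a b :: real by simp
    ultimately show ?thesis by (simp only:)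
  qed
  finally show ?thesis .
qed

lemma hermitian_u_eps: "hermitian (complex_hessian (u_eps \<epsilon>) (z :: complex^'n))"
  by (simp add: hermitian_def u_eps_hessian mult_ac)

text \<open>The roots of the characteristic polynomial are read off from the factorization in
  \<open>det_shift_u_eps\<close>; this makes the radial solutions admissible.\<close>

lemma eigvals_u_eps_nonneg: "eigvals (complex_hessian (u_eps \<epsilon>) (z :: complex^'n)) i \<ge> 0"
proof -
  let ?H = "complex_hessian (u_eps \<epsilon>) z" and ?n = "real CARD('n) + 1"
  let ?\<mu> = "eigvals ?H i"
  have "poly (charpoly ?H) (of_real ?\<mu>) = 0"
    unfolding charpoly_eigvals[OF hermitian_u_eps] poly_prod by (intro prod_zero bexI[of _ i]) auto
  then have "det (shift ?H (- of_real ?\<mu>)) = 0" using poly_charpoly[of ?H "- of_real ?\<mu>"] by simp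
  then have "of_real (?n * g z) + - complex_of_real ?\<mu> = 0 \<or> of_real (?n * \<epsilon>\<^sup>2 * (g z)\<^sup>2) + - complex_of_real ?\<mu> = 0"
    unfolding det_shift_u_eps by auto
  then have "complex_of_real ?\<mu> = of_real (?n * g z) \<or> complex_of_real ?\<mu> = of_real (?n * \<epsilon>\<^sup>2 * (g z)\<^sup>2)"
    by (metis add_eq_0_iff minus_minus)
  then have "?\<mu> = ?n * g z \<or> ?\<mu> = ?n * \<epsilon>\<^sup>2 * (g z)\<^sup>2" by (simp only: of_real_eq_iff)
  moreover have "?n * g z \<ge> 0" "?n * \<epsilon>\<^sup>2 * (g z)\<^sup>2 \<ge> 0" using g_pos(2)[of z] by simp_all
  ultimately show ?thesis by metis
qed

lemma u_eps_k_subharmonic: "k_subharmonic k (u_eps \<epsilon> :: complex^'n \<Rightarrow> real)"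
  unfolding k_subharmonic_def Sk_def elem_sym_def
  by (intro ballI sum_nonneg prod_nonneg) (simp add: eigvals_u_eps_nonneg)

lemma Sk_u_eps:
  "Sk CARD('n) (complex_hessian (u_eps \<epsilon>) (z :: complex^'n)) = (real CARD('n) + 1) ^ CARD('n) * \<epsilon>\<^sup>2 * g z ^ (CARD('n) + 1)"
proof -
  let ?n = "CARD('n)"
  have n: "?n = Suc (?n - 1)" by simp
  have "of_real (Sk ?n (complex_hessian (u_eps \<epsilon>) z)) = det (shift (complex_hessian (u_eps \<epsilon>) z) 0)"
    unfolding det_shift[OF hermitian_u_eps] power_0_left
    by (simp add: if_distrib[of "\<lambda>x. _ * x"] sum.delta' Suc_le_eq cong: if_cong)
  also have "\<dots> = of_real (((real ?n + 1) * g z) ^ (?n - 1) * ((real ?n + 1) * \<epsilon>\<^sup>2 * (g z)\<^sup>2))"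
    unfolding det_shift_u_eps by simp
  finally have "Sk ?n (complex_hessian (u_eps \<epsilon>) z) = ((real ?n + 1) * g z) ^ (?n - 1) * ((real ?n + 1) * \<epsilon>\<^sup>2 * (g z)\<^sup>2)"
    by (simp only: of_real_eq_iff)
  also have "\<dots> = (real ?n + 1) ^ ?n * \<epsilon>\<^sup>2 * g z ^ (?n + 1)"
  proof -
    obtain m where m: "?n = Suc m" using n by blast
    have "(A * G) ^ (?n - 1) * (A * e * G\<^sup>2) = A ^ ?n * e * G ^ (?n + 1)" for A G e :: real
      unfolding m by (simp add: power_mult_distrib power2_eq_square)
    then show ?thesis .
  qed
  finally show ?thesis .
qed

text \<open>The field (g^n - K) conj z is 0 on the sphere, because K is the value of g^n there, and
  the real part of its dzbar divergence is n \<open>\<epsilon>\<close>^2 g^(n+1) - n K. The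
  divergence inequality for both signs \<open>\<sigma>\<close> makes the integral of this expression
  0.\<close>

lemma integral_g:
  "(LINT z:ball 0 1|lborel. g z ^ (CARD('n) + 1)) = measure lborel (ball (0::complex^'n) 1) / (\<epsilon>\<^sup>2 * (1 + \<epsilon>\<^sup>2) ^ CARD('n))"
proof -
  let ?n = "CARD('n)" and ?B = "ball (0::complex^'n) 1"
  define K where "K = inverse ((1 + \<epsilon>\<^sup>2) ^ ?n)"
  define F where "F \<sigma> m z = cx (\<lambda>z. \<sigma> * (g z ^ ?n + - K)) z * cnj (z $ m)" for \<sigma> :: real and m z
  have cg: "continuous_on (cball 0 1) g" using CC_continuous[OF g_CC] by (rule continuous_on_subset) simp
  have nonneg: "0 \<le> (LINT z:?B|lborel. \<sigma> * (real ?n * \<epsilon>\<^sup>2 * g z ^ (?n + 1) + - (real ?n * K)))" for \<sigma>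
  proof (rule integral_complex_divergence_nonneg[of "F \<sigma>" "F \<sigma>"])
    have F: "CC (Suc 0) UNIV (F \<sigma> m)" for m
      unfolding F_def
      by (intro CC_mult CC_cx CC_cmult CC_add CC_power CC_const open_UNIV g_CC CC_bounded_linear
          bounded_linear_compose[OF bounded_linear_cnj] bounded_linear_coord)
    show "CC (Suc 0) ?B (F \<sigma> m)" for m by (rule CC_subset[OF F]) simp
    show "continuous_on (cball 0 1) (F \<sigma> m)" for m using CC_continuous[OF F] by (rule continuous_on_subset) simp
    show "0 \<le> Re (\<Sum>m\<in>UNIV. F \<sigma> m z * z $ m)" if "z \<in> sphere 0 1" for z
    proof -
      have "z \<bullet> z = 1" using that by (simp add: dot_square_norm)
      then have "g z ^ ?n = K" by (simp add: g K_def power_inverse)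
      then show ?thesis by (simp add: F_def)
    qed
    show "set_integrable lborel ?B (\<lambda>z. \<sigma> * (real ?n * \<epsilon>\<^sup>2 * g z ^ (?n + 1) + - (real ?n * K)))"
      by (intro set_integrable_ball continuous_intros cg)
    show "Re (\<Sum>m\<in>UNIV. dzbar m (F \<sigma> m) z) = \<sigma> * (real ?n * \<epsilon>\<^sup>2 * g z ^ (?n + 1) + - (real ?n * K))" for z
    proof -
      have n: "g z ^ (?n - 1) * (g z)\<^sup>2 = g z ^ (?n + 1)"
        by (metis Suc_eq_plus1 Suc_diff_1 add_2_eq_Suc' power_add zero_less_card_finite)
      have d: "((\<lambda>z. \<sigma> * (g z ^ ?n + - K)) has_derivative (\<lambda>v. (\<sigma> * (- 2 * real ?n * g z ^ (?n + 1))) * (z \<bullet> v))) (at z)"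
        unfolding n[symmetric] by (auto intro!: derivative_eq_intros g_derivative simp: mult_ac)
      have d': "cx (\<lambda>z. \<sigma> * (g z ^ ?n + - K)) differentiable (at z)"
        by (rule differentiable_cx[OF differentiableI[OF d]])
      have "dzbar m (F \<sigma> m) z = of_real (\<sigma> * (g z ^ ?n + - K)) + of_real (\<sigma> * (- real ?n * g z ^ (?n + 1))) * (cnj (z $ m) * z $ m)" for m
        unfolding F_def dzbar_mult[OF d' differentiable_cnj_coord] dzbar_radial[OF d] by simp
      then have "(\<Sum>m\<in>UNIV. dzbar m (F \<sigma> m) z) = of_nat ?n * of_real (\<sigma> * (g z ^ ?n + - K))
          + of_real (\<sigma> * (- real ?n * g z ^ (?n + 1))) * of_real (z \<bullet> z)"
        by (simp only: sum.distrib sum_distrib_left[symmetric] sum_cnj_mult sum_constant)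
      also have "\<dots> = of_real (real ?n * (\<sigma> * (g z ^ ?n + - K)) + \<sigma> * (- real ?n * g z ^ (?n + 1)) * (z \<bullet> z))" by simp
      finally have "Re (\<Sum>m\<in>UNIV. dzbar m (F \<sigma> m) z) = real ?n * (\<sigma> * (g z ^ ?n + - K)) + \<sigma> * (- real ?n * g z ^ (?n + 1)) * (z \<bullet> z)"
        by (simp only: Re_complex_of_real)
      moreover have "g z ^ ?n = (z \<bullet> z + \<epsilon>\<^sup>2) * g z ^ (?n + 1)" using g_pos(1)[of z] by (simp add: g)
      moreover have "N * (\<sigma> * (G + - K)) + \<sigma> * (- N * P) * s = \<sigma> * (N * e * P + - (N * K))"
        if "G = (s + e) * P" for N G P s e :: real
        using that by (simp add: algebra_simps)
      ultimately show ?thesis by (simp only:)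
    qed
  qed simp
  let ?J = "LINT z:?B|lborel. real ?n * \<epsilon>\<^sup>2 * g z ^ (?n + 1) + - (real ?n * K)"
  have "0 \<le> 1 * ?J" "0 \<le> - 1 * ?J" using nonneg[of 1] nonneg[of "-1"] unfolding set_integral_mult_right by simp_all
  then have "?J = 0" by simp
  moreover have "?J = real ?n * \<epsilon>\<^sup>2 * (LINT z:?B|lborel. g z ^ (?n + 1)) + - (real ?n * K) * measure lborel ?B"
  proof -
    have "set_integrable lborel ?B (\<lambda>z. real ?n * \<epsilon>\<^sup>2 * g z ^ (?n + 1))" by (intro set_integrable_ball continuous_intros cg)
    from set_integral_add(2)[OF this set_integrable_ball[OF continuous_on_const]] show ?thesis
      by (simp only: set_integral_mult_right set_integral_ball_const)
  qed
  ultimately have "real ?n * (\<epsilon>\<^sup>2 * (LINT z:?B|lborel. g z ^ (?n + 1))) = real ?n * (K * measure lborel ?B)" by simp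
  then have eq: "\<epsilon>\<^sup>2 * (LINT z:?B|lborel. g z ^ (?n + 1)) = K * measure lborel ?B" by (simp only: mult_cancel_left) simp
  have "X = V / (e * Q)" if "e * X = inverse Q * V" "e \<noteq> 0" for X V e Q :: real
  proof -
    have "X = e * X / e" using that(2) by simp
    also have "\<dots> = V / (e * Q)" unfolding that(1) by (simp add: divide_inverse mult_ac)
    finally show ?thesis .
  qed
  from this[OF eq[unfolded K_def]] show ?thesis using \<epsilon> by simp
qed

lemma exp_u_eps: "exp (- u_eps \<epsilon> (z :: complex^'n)) = ((1 + \<epsilon>\<^sup>2) * g z) ^ (CARD('n) + 1)"
proof -
  have p: "1 + \<epsilon>\<^sup>2 > 0" by (simp add: add_pos_nonneg)
  have "- u_eps \<epsilon> z = real (CARD('n) + 1) * (ln (1 + \<epsilon>\<^sup>2) - ln (z \<bullet> z + \<epsilon>\<^sup>2))"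
    by (simp add: u_eps_def power2_norm_eq_inner algebra_simps)
  also have "ln (1 + \<epsilon>\<^sup>2) - ln (z \<bullet> z + \<epsilon>\<^sup>2) = ln ((1 + \<epsilon>\<^sup>2) * g z)"
    using p g_pos[of z] by (simp add: g ln_mult ln_inverse)
  finally show ?thesis using p g_pos(2)[of z] by (simp add: exp_of_nat_mult del: of_nat_add of_nat_Suc)
qed

text \<open>By \<open>Sk_u_eps\<close> and \<open>exp_u_eps\<close> both sides of the equation are
  multiples of g^(n+1); \<open>integral_g\<close> determines the normalizing integral and with it
  the value of a.\<close>

theorem u_eps_solution:
  "dirichlet_solution CARD('n) (a_eps CARD('n) \<epsilon>) (u_eps \<epsilon> :: complex^'n \<Rightarrow> real)"
  unfolding dirichlet_solution_def
proof (intro conjI ballI)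
  let ?n = "CARD('n)" and ?B = "ball (0::complex^'n) 1"
  let ?u = "u_eps \<epsilon> :: complex^'n \<Rightarrow> real"
  show "Ck_closure 2 ?B ?u" by (rule CC_imp_Ck_closure[OF u_eps_CC])
  show "Ck_on 4 ?B ?u" unfolding Ck_on_iff_CC by (rule CC_subset[OF u_eps_CC]) simp
  show "?u z = 0" if "z \<in> sphere 0 1" for z using that by (simp add: u_eps_def)
  fix z :: "complex^'n"
  have p: "1 + \<epsilon>\<^sup>2 > 0" by (simp add: add_pos_nonneg)
  have "(LINT w:?B|lborel. exp (- ?u w)) = (1 + \<epsilon>\<^sup>2) ^ (?n + 1) * (LINT w:?B|lborel. g w ^ (?n + 1))"
    unfolding exp_u_eps power_mult_distrib by (rule set_integral_mult_right)
  also have "\<dots> = (1 + \<epsilon>\<^sup>2) / \<epsilon>\<^sup>2 * (pi ^ ?n / fact ?n)"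
  proof -
    have "q ^ (m + 1) * (V / (e * q ^ m)) = q / e * V" if "q > 0" for q V e :: real and m
      using that by simp
    from this[OF p] show ?thesis unfolding integral_g measure_ball_complex .
  qed
  finally have I: "(LINT w:?B|lborel. exp (- ?u w)) = (1 + \<epsilon>\<^sup>2) / \<epsilon>\<^sup>2 * (pi ^ ?n / fact ?n)" .
  have "a_eps ?n \<epsilon> * (((1 + \<epsilon>\<^sup>2) * g z) ^ (?n + 1) / ((1 + \<epsilon>\<^sup>2) / \<epsilon>\<^sup>2 * (pi ^ ?n / fact ?n)))
      = (real ?n + 1) ^ ?n * \<epsilon>\<^sup>2 * g z ^ (?n + 1)"
  proof -
    have "A * (P / (f * q ^ m)) * (q ^ (m + 1) * G / (q / e * (P / f))) = A * e * G"
      if "q > 0" "P > 0" "f > 0" "e > 0" for A P f q G e :: real and m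
      using that by (simp add: field_simps)
    then show ?thesis unfolding a_eps_def power_mult_distrib using p \<epsilon> by simp
  qed
  then show "Sk ?n (complex_hessian ?u z) = a_eps ?n \<epsilon> * (exp (- ?u z) / (LINT w:?B|lborel. exp (- ?u w)))"
    unfolding I unfolding Sk_u_eps exp_u_eps by (rule sym)
qed

end

text \<open>Since \<open>a_eps\<close> is \<open>a_crit\<close> divided by (1 +
  \<open>\<epsilon>\<close>^2)^n, the number 1 + \<open>\<epsilon>\<close>^2 must be the n-th root
  of a_crit / a, which exceeds 1.\<close>

lemma a_eps_surj:
  assumes n: "n > 0" and a: "0 < a" "a < a_crit n"
  obtains \<epsilon> where "\<epsilon> > 0" "a = a_eps n \<epsilon>"
proof -
  define r where "r = root n (a_crit n / a)"
  have "a_crit n / a > 1" using a by simp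
  then have r: "r > 1" "r ^ n = a_crit n / a"
    using n by (auto simp: r_def intro: real_root_gt_1_iff[THEN iffD2] real_root_pow_pos2)
  have "(sqrt (r - 1))\<^sup>2 = r - 1" using r by simp
  then have "a_eps n (sqrt (r - 1)) = a_crit n / r ^ n" by (simp add: a_eps_def a_crit_def)
  also have "\<dots> = a" using a by (simp add: r(2))
  finally show ?thesis using that[of "sqrt (r - 1)"] r by simp
qed

theorem theorem3:
  fixes k :: nat
  assumes "1 \<le> k" and "k \<le> CARD('n::finite)"
  shows "(\<exists>\<alpha>>0. \<forall>a>\<alpha>. \<not> (\<exists>u :: complex^'n \<Rightarrow> real.
            dirichlet_solution k a u \<and> (even k \<longrightarrow> k_subharmonic k u)))
       \<and> (k = CARD('n) \<longrightarrow>
            (\<forall>a\<ge>a_crit CARD('n). \<not> (\<exists>u :: complex^'n \<Rightarrow> real.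
               dirichlet_solution k a u \<and> (even k \<longrightarrow> k_subharmonic k u)))
          \<and> (\<forall>a. 0 < a \<and> a < a_crit CARD('n) \<longrightarrow>
               (\<exists>\<epsilon>>0. a = a_eps CARD('n) \<epsilon> \<and>
                  dirichlet_solution k a (u_eps \<epsilon> :: complex^'n \<Rightarrow> real) \<and>
                  k_subharmonic k (u_eps \<epsilon> :: complex^'n \<Rightarrow> real))))"
proof -
  let ?n = "CARD('n)"
  let ?C = "real ?n * real ((?n - 1) choose (k - 1)) * (real ?n + 1) ^ (k + 1) / (real k * (real k + 1))"
  let ?V = "measure lborel (ball (0::complex^'n) 1)"
  have none: "\<not> (\<exists>u :: complex^'n \<Rightarrow> real. dirichlet_solution k a u \<and> (even k \<longrightarrow> k_subharmonic k u))"
    if "a > 0" "a \<ge> ?C * ?V" for a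
    using dirichlet_solution_bound[OF assms \<open>a > 0\<close>] that(2) by (metis not_le)
  have "?V > 0" unfolding measure_ball_complex by simp
  moreover have "?C > 0" using assms by (simp add: zero_less_binomial_iff)
  ultimately have pos: "?C * ?V > 0" by (rule mult_pos_pos[rotated])
  \<comment> \<open>For k = n the binomial coefficient is 1, and n (n + 1)^(n+1) / (n (n + 1)) is (n
    + 1)^n.\<close>
  have crit: "?C * ?V = a_crit ?n" if "k = ?n"
  proof -
    have "N * q ^ (m + 1) / (N * q) * X = q ^ m * X" if "N > 0" "q > 0" for N q X :: real and m
      using that by simp
    from this[of "real ?n" "real ?n + 1"] show ?thesis
      using that unfolding a_crit_def measure_ball_complex by simp
  qed
  show ?thesis
  proof (intro conjI impI)
    show "\<exists>\<alpha>>0. \<forall>a>\<alpha>. \<not> (\<exists>u :: complex^'n \<Rightarrow> real. dirichlet_solution k a u \<and> (even k \<longrightarrow> k_subharmonic k u))"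
    proof (intro exI[of _ "?C * ?V"] conjI pos allI impI)
      fix a assume a: "a > ?C * ?V"
      show "\<not> (\<exists>u :: complex^'n \<Rightarrow> real. dirichlet_solution k a u \<and> (even k \<longrightarrow> k_subharmonic k u))"
        by (rule none[OF less_trans[OF pos a] less_imp_le[OF a]])
    qed
  next
    assume k: "k = ?n"
    show "\<forall>a\<ge>a_crit ?n. \<not> (\<exists>u :: complex^'n \<Rightarrow> real. dirichlet_solution k a u \<and> (even k \<longrightarrow> k_subharmonic k u))"
    proof (intro allI impI)
      fix a assume "a \<ge> a_crit ?n"
      then have a: "a \<ge> ?C * ?V" using crit[OF k] by simp
      show "\<not> (\<exists>u :: complex^'n \<Rightarrow> real. dirichlet_solution k a u \<and> (even k \<longrightarrow> k_subharmonic k u))"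
        by (rule none[OF less_le_trans[OF pos a] a])
    qed
    show "\<forall>a. 0 < a \<and> a < a_crit ?n \<longrightarrow>
               (\<exists>\<epsilon>>0. a = a_eps ?n \<epsilon> \<and>
                  dirichlet_solution k a (u_eps \<epsilon> :: complex^'n \<Rightarrow> real) \<and>
                  k_subharmonic k (u_eps \<epsilon> :: complex^'n \<Rightarrow> real))"
    proof (intro allI impI)
      fix a assume "0 < a \<and> a < a_crit ?n"
      then obtain \<epsilon> where \<epsilon>: "\<epsilon> > 0" "a = a_eps ?n \<epsilon>" using a_eps_surj[of ?n a] by auto
      then show "\<exists>\<epsilon>>0. a = a_eps ?n \<epsilon> \<and> dirichlet_solution k a (u_eps \<epsilon> :: complex^'n \<Rightarrow> real) \<and>
          k_subharmonic k (u_eps \<epsilon> :: complex^'n \<Rightarrow> real)"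
        using u_eps_solution[OF \<epsilon>(1) refl, where 'n = 'n] u_eps_k_subharmonic[OF \<epsilon>(1) refl, where 'n = 'n] k
        by (intro exI[of _ \<epsilon>]) simp
    qed
  qed
qed

end
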